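(* Let $G=(V,E)$ be a finite, simple, connected graph. The following are equivalent: (i) $G$ is reflective; (ii) $G$ is a cocktail party graph, a Johnson graph, a halved cube, the Schläfli graph, the Gosset graph, or a cartesian product of (finitely many) graphs from this list.
   Context: $d$ is the combinatorial distance. For adjacent $x\sim y$ let $V_x^y=\{v: d(v,x)<d(v,y)\}$ and $V^{xy}=\{v:d(v,x)=d(v,y)\}$. A map $\phi:V\to V$ is a reflection from $x$ to $y$ if: $\phi$ is a graph automorphism; $\phi\circ\phi=\mathrm{id}$; $\phi(x)=y$; the set of edges between $V_x^y$ and $V_y^x$ is exactly $\{\{x',\phi(x')\}: x'\in V_x^y\}$; and $\phi(z)=z$ for all $z\in V^{xy}$. $G$ is reflective if for every edge $x\sim y$ there is a reflection from $x$ to $y$. Cocktail party graph $CP(k)$: $K_{2k}$ minus a perfect matching. Johnson graph $J(n,k)$: $k$-subsets of an $n$-set, adjacent iff they share $k-1$ elements. Halved cube: binary strings of length $n$ of even weight, adjacent iff they differ in exactly two coordinates. Schläfli graph: the strongly regular graph with parameters $(27,16,10,8)$. Gosset graph: the 56-vertex, 27-regular distance regular graph (1-skeleton of the $3_{21}$ polytope). Cartesian product: $(a,b)\sim(a',b')$ iff ($a=a'$, $b\sim b'$) or ($a\sim a'$, $b=b'$). *)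

theory Defs
  imports Main
begin

section \<open>Finite simple graphs, given by a vertex set and an adjacency relation\<close>

definition simple_graph :: "'a set \<Rightarrow> ('a \<Rightarrow> 'a \<Rightarrow> bool) \<Rightarrow> bool" where
  "simple_graph V E \<longleftrightarrow>
     (\<forall>u v. E u v \<longrightarrow> u \<in> V \<and> v \<in> V) \<and>
     (\<forall>u v. E u v \<longrightarrow> E v u) \<and>
     (\<forall>u. \<not> E u u)"

definition adj_rel :: "'a set \<Rightarrow> ('a \<Rightarrow> 'a \<Rightarrow> bool) \<Rightarrow> ('a \<times> 'a) set" where
  "adj_rel V E = {(u, v). u \<in> V \<and> v \<in> V \<and> E u v}"

definition connected_graph :: "'a set \<Rightarrow> ('a \<Rightarrow> 'a \<Rightarrow> bool) \<Rightarrow> bool" where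
  "connected_graph V E \<longleftrightarrow> V \<noteq> {} \<and> (\<forall>u\<in>V. \<forall>v\<in>V. (u, v) \<in> (adj_rel V E)\<^sup>*)"

text \<open>Combinatorial distance: length of a shortest walk.\<close>
definition gdist :: "'a set \<Rightarrow> ('a \<Rightarrow> 'a \<Rightarrow> bool) \<Rightarrow> 'a \<Rightarrow> 'a \<Rightarrow> nat" where
  "gdist V E u v = (LEAST n. (u, v) \<in> (adj_rel V E) ^^ n)"

definition closer_set :: "'a set \<Rightarrow> ('a \<Rightarrow> 'a \<Rightarrow> bool) \<Rightarrow> 'a \<Rightarrow> 'a \<Rightarrow> 'a set" where
  "closer_set V E x y = {v \<in> V. gdist V E v x < gdist V E v y}"

definition equi_set :: "'a set \<Rightarrow> ('a \<Rightarrow> 'a \<Rightarrow> bool) \<Rightarrow> 'a \<Rightarrow> 'a \<Rightarrow> 'a set" where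
  "equi_set V E x y = {v \<in> V. gdist V E v x = gdist V E v y}"

definition is_automorphism :: "'a set \<Rightarrow> ('a \<Rightarrow> 'a \<Rightarrow> bool) \<Rightarrow> ('a \<Rightarrow> 'a) \<Rightarrow> bool" where
  "is_automorphism V E \<phi> \<longleftrightarrow>
     bij_betw \<phi> V V \<and> (\<forall>u\<in>V. \<forall>v\<in>V. E u v \<longleftrightarrow> E (\<phi> u) (\<phi> v))"

definition is_reflection ::
  "'a set \<Rightarrow> ('a \<Rightarrow> 'a \<Rightarrow> bool) \<Rightarrow> 'a \<Rightarrow> 'a \<Rightarrow> ('a \<Rightarrow> 'a) \<Rightarrow> bool" where
  "is_reflection V E x y \<phi> \<longleftrightarrow>
     is_automorphism V E \<phi> \<and>
     (\<forall>v\<in>V. \<phi> (\<phi> v) = v) \<and>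
     \<phi> x = y \<and>
     {{u, v} | u v. u \<in> closer_set V E x y \<and> v \<in> closer_set V E y x \<and> E u v}
       = {{u, \<phi> u} | u. u \<in> closer_set V E x y} \<and>
     (\<forall>z\<in>equi_set V E x y. \<phi> z = z)"

definition reflective :: "'a set \<Rightarrow> ('a \<Rightarrow> 'a \<Rightarrow> bool) \<Rightarrow> bool" where
  "reflective V E \<longleftrightarrow>
     (\<forall>x\<in>V. \<forall>y\<in>V. E x y \<longrightarrow> (\<exists>\<phi>. is_reflection V E x y \<phi>))"

definition graph_iso ::
  "'a set \<Rightarrow> ('a \<Rightarrow> 'a \<Rightarrow> bool) \<Rightarrow> 'b set \<Rightarrow> ('b \<Rightarrow> 'b \<Rightarrow> bool) \<Rightarrow> bool" where
  "graph_iso V E W F \<longleftrightarrow>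
     (\<exists>f. bij_betw f V W \<and> (\<forall>u\<in>V. \<forall>v\<in>V. E u v \<longleftrightarrow> F (f u) (f v)))"

section \<open>The concrete families\<close>

text \<open>Cocktail party graph CP(k): K_{2k} on {0..<2k} minus the perfect matching {2i,2i+1}.\<close>
definition cp_V :: "nat \<Rightarrow> nat set" where "cp_V k = {..<2*k}"
definition cp_E :: "nat \<Rightarrow> nat \<Rightarrow> nat \<Rightarrow> bool" where
  "cp_E k u v \<longleftrightarrow> u < 2*k \<and> v < 2*k \<and> u \<noteq> v \<and> u div 2 \<noteq> v div 2"

text \<open>Johnson graph J(n,k): k-subsets of {0..<n}, adjacent iff they share k-1 elements.\<close>
definition johnson_V :: "nat \<Rightarrow> nat \<Rightarrow> nat set set" where
  "johnson_V n k = {A. A \<subseteq> {..<n} \<and> card A = k}"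
definition johnson_E :: "nat \<Rightarrow> nat \<Rightarrow> nat set \<Rightarrow> nat set \<Rightarrow> bool" where
  "johnson_E n k A B \<longleftrightarrow> A \<in> johnson_V n k \<and> B \<in> johnson_V n k \<and> card (A \<inter> B) + 1 = k"

text \<open>Halved cube: binary strings of length n of even weight, adjacent iff they differ
  in exactly two coordinates.\<close>
definition halved_V :: "nat \<Rightarrow> bool list set" where
  "halved_V n = {xs. length xs = n \<and> even (length (filter id xs))}"
definition halved_E :: "nat \<Rightarrow> bool list \<Rightarrow> bool list \<Rightarrow> bool" where
  "halved_E n xs ys \<longleftrightarrow> xs \<in> halved_V n \<and> ys \<in> halved_V n \<and>
     card {i. i < n \<and> xs ! i \<noteq> ys ! i} = 2"

text \<open>Schlaefli graph: the 27 lines a_i, b_i, c_ij (0 <= i < j < 6) on a smooth cubic surface,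
  adjacent iff skew (this is the unique srg(27,16,10,8)).\<close>
datatype line27 = LA nat | LB nat | LC "nat set"

definition schlafli_V :: "line27 set" where
  "schlafli_V = {LA i | i. i < 6} \<union> {LB i | i. i < 6} \<union> {LC {i, j} | i j. i < j \<and> j < 6}"

fun lines_meet :: "line27 \<Rightarrow> line27 \<Rightarrow> bool" where
  "lines_meet (LA i) (LA j) = False"
| "lines_meet (LB i) (LB j) = False"
| "lines_meet (LA i) (LB j) = (i \<noteq> j)"
| "lines_meet (LB i) (LA j) = (i \<noteq> j)"
| "lines_meet (LA i) (LC s) = (i \<in> s)"
| "lines_meet (LC s) (LA i) = (i \<in> s)"
| "lines_meet (LB i) (LC s) = (i \<in> s)"
| "lines_meet (LC s) (LB i) = (i \<in> s)"
| "lines_meet (LC s) (LC t) = (s \<inter> t = {})"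

definition schlafli_E :: "line27 \<Rightarrow> line27 \<Rightarrow> bool" where
  "schlafli_E p q \<longleftrightarrow> p \<in> schlafli_V \<and> q \<in> schlafli_V \<and> p \<noteq> q \<and> \<not> lines_meet p q"

text \<open>Gosset graph: two copies of the 28 edges of K_8; in the same copy adjacent iff the
  edges share exactly one vertex, in different copies adjacent iff the edges are disjoint.\<close>
definition gosset_V :: "(bool \<times> nat set) set" where
  "gosset_V = {(b, A). A \<subseteq> {..<8} \<and> card A = 2}"
definition gosset_E :: "bool \<times> nat set \<Rightarrow> bool \<times> nat set \<Rightarrow> bool" where
  "gosset_E p q \<longleftrightarrow> p \<in> gosset_V \<and> q \<in> gosset_V \<and>
     (if fst p = fst q then card (snd p \<inter> snd q) = 1 else snd p \<inter> snd q = {})"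

definition basic_reflective_graph :: "nat set \<Rightarrow> (nat \<Rightarrow> nat \<Rightarrow> bool) \<Rightarrow> bool" where
  "basic_reflective_graph W F \<longleftrightarrow>
     (\<exists>k. graph_iso W F (cp_V k) (cp_E k)) \<or>
     (\<exists>n k. graph_iso W F (johnson_V n k) (johnson_E n k)) \<or>
     (\<exists>n. graph_iso W F (halved_V n) (halved_E n)) \<or>
     graph_iso W F schlafli_V schlafli_E \<or>
     graph_iso W F gosset_V gosset_E"

section \<open>Cartesian product of a finite list of graphs\<close>

definition prod_V :: "('b set \<times> ('b \<Rightarrow> 'b \<Rightarrow> bool)) list \<Rightarrow> 'b list set" where
  "prod_V Gs = {xs. length xs = length Gs \<and> (\<forall>i<length Gs. xs ! i \<in> fst (Gs ! i))}"

definition prod_E :: "('b set \<times> ('b \<Rightarrow> 'b \<Rightarrow> bool)) list \<Rightarrow> 'b list \<Rightarrow> 'b list \<Rightarrow> bool" where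
  "prod_E Gs xs ys \<longleftrightarrow> xs \<in> prod_V Gs \<and> ys \<in> prod_V Gs \<and>
     (\<exists>i<length Gs. snd (Gs ! i) (xs ! i) (ys ! i) \<and>
        (\<forall>j<length Gs. j \<noteq> i \<longrightarrow> xs ! j = ys ! j))"

end

theory Submission
  imports Defs
begin

text \<open>
  Every edge x y of a reflective graph behaves like a root of a simply laced root system taking
  values in {-1, 0, 1} on the vertices: the differences d(v, x) - d(v, y) depend only on the
  reflection that exchanges x and y. Hence the numbers d(v, x) - d(v, z), for z a neighbour of a
  fixed vertex x, separate the vertices v, and the reflections in the edges x z act on them by
  formulas that involve only the graph induced on the neighbours of x. A connected graph with
  reflections is therefore determined by the neighbourhood of one vertex. The components of this
  neighbourhood have diameter at most two and again have reflections. By induction on the number of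
  vertices they are products of basic graphs, and having diameter at most two they are the
  neighbourhoods of a vertex in some basic graphs: a product of two complete graphs occurs in a
  Johnson graph, CP(k) in CP(k+1), J(n,2) in a halved cube, the halved 5-cube in the Schlaefli graph
  and the Schlaefli graph in the Gosset graph. The product of these basic graphs has the same
  neighbourhood as the given graph, so the two are isomorphic.
\<close>

section \<open>Mirrors and half spaces\<close>

text \<open>Distances inside a neighbourhood differ from those of the whole graph, so
  \<open>is_reflection\<close> does not visibly pass to neighbourhoods. \<open>mirror\<close>
  therefore mentions only an automorphism and a half space. The price is that a single mirror need
  not be a reflection: in two triangles x y w and a b w with common vertex w, exchanging x with y
  and a with b is a mirror with half space {x, a}, although a is equally far from x and y and is not
  fixed. Such ties are excluded only by using the mirrors of all edges at once. The graphs of the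
  list carry the minuscule weights of the root systems A (Johnson graphs), D (cocktail party graphs
  and halved cubes), E6 (Schlaefli) and E7 (Gosset), and a neighbourhood belongs to a smaller root
  system. The chain breaks off because a component of a neighbourhood has diameter at most two: the
  halved 6-cube and the Gosset graph have diameter three, so they never have to be realised as
  neighbourhoods.\<close>

locale conn_graph =
  fixes V :: "'a set" and E :: "'a \<Rightarrow> 'a \<Rightarrow> bool"
  assumes simple: "simple_graph V E" and conn: "connected_graph V E"
begin

abbreviation d where "d \<equiv> gdist V E"

lemma adj_in: "E u v \<Longrightarrow> u \<in> V \<and> v \<in> V"
  using simple unfolding simple_graph_def by blast

lemma adj_sym: "E u v \<Longrightarrow> E v u"
  using simple unfolding simple_graph_def by blast

lemma adj_irrefl: "\<not> E u u"
  using simple unfolding simple_graph_def by blast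

lemma adj_rel_iff [simp]: "(u, v) \<in> adj_rel V E \<longleftrightarrow> E u v"
  using adj_in by (auto simp: adj_rel_def)

lemma walk_gdist: "u \<in> V \<Longrightarrow> v \<in> V \<Longrightarrow> (u, v) \<in> adj_rel V E ^^ d u v"
  unfolding gdist_def
  by (rule LeastI_ex) (use conn rtrancl_power in \<open>fastforce simp: connected_graph_def\<close>)

lemma gdist_le: "(u, v) \<in> adj_rel V E ^^ n \<Longrightarrow> d u v \<le> n"
  unfolding gdist_def by (rule Least_le)

lemma gdist_self [simp]: "d u u = 0"
  using gdist_le[of u u 0] by simp

lemma gdist_0: "u \<in> V \<Longrightarrow> v \<in> V \<Longrightarrow> d u v = 0 \<longleftrightarrow> u = v"
  using walk_gdist[of u v] by auto

lemma walk_sym: "(u, v) \<in> adj_rel V E ^^ n \<Longrightarrow> (v, u) \<in> adj_rel V E ^^ n"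
proof (induction n arbitrary: v)
  case (Suc n)
  then obtain w where "(u, w) \<in> adj_rel V E ^^ n" "E w v" by auto
  then show ?case using Suc.IH adj_sym by (meson adj_rel_iff relpow_Suc_I2)
qed simp

lemma gdist_sym: "u \<in> V \<Longrightarrow> v \<in> V \<Longrightarrow> d u v = d v u"
  by (meson gdist_le le_antisym walk_gdist walk_sym)

lemma gdist_step_le: "E u w \<Longrightarrow> v \<in> V \<Longrightarrow> d u v \<le> Suc (d w v)"
  by (meson adj_in adj_rel_iff gdist_le relpow_Suc_I2 walk_gdist)

lemma gdist_step_le': "E u w \<Longrightarrow> v \<in> V \<Longrightarrow> d v u \<le> Suc (d v w)"
  using gdist_step_le gdist_sym adj_in by metis

lemma gdist_SucE:
  assumes "u \<in> V" "v \<in> V" "d u v = Suc n"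
  obtains w where "E u w" "d w v = n"
proof -
  obtain w where w: "E u w" "(w, v) \<in> adj_rel V E ^^ n"
    using walk_gdist[OF assms(1,2)] assms(3) by (metis adj_rel_iff relpow_Suc_D2)
  then have "d w v \<le> n" by (simp add: gdist_le)
  moreover have "Suc n \<le> Suc (d w v)" using gdist_step_le[OF w(1) assms(2)] assms(3) by simp
  ultimately show thesis using that w(1) by simp
qed

lemma gdist_1: "u \<in> V \<Longrightarrow> v \<in> V \<Longrightarrow> d u v = 1 \<longleftrightarrow> E u v"
proof
  assume uv: "u \<in> V" "v \<in> V"
  show "d u v = 1 \<Longrightarrow> E u v" using gdist_SucE[OF uv, of 0] gdist_0 adj_in uv
    by (metis One_nat_def)
  assume "E u v"
  then show "d u v = 1" using gdist_step_le[of u v v] gdist_0[OF uv] adj_irrefl uv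
    by (auto simp: le_Suc_eq)
qed

lemma gdist_common_neighbour:
  assumes "E x u" "E x v"
  shows "d u v = (if u = v then 0 else if E u v then 1 else 2)"
proof -
  have "d u v \<le> Suc (d x v)" using gdist_step_le assms adj_sym adj_in by blast
  then have "d u v \<le> 2" using gdist_1[of x v] assms adj_in by fastforce
  then have "d u v = 0 \<or> d u v = 1 \<or> d u v = 2" by linarith
  then show ?thesis using gdist_0[of u v] gdist_1[of u v] assms adj_in adj_irrefl
    by (auto simp del: One_nat_def)
qed

lemma walk_aut:
  assumes "is_automorphism V E \<phi>"
  shows "(u, v) \<in> adj_rel V E ^^ n \<Longrightarrow> (\<phi> u, \<phi> v) \<in> adj_rel V E ^^ n"
proof (induction n arbitrary: v)
  case (Suc n)
  then obtain w where "(u, w) \<in> adj_rel V E ^^ n" "E w v" by auto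
  moreover have "E (\<phi> w) (\<phi> v)"
    using assms \<open>E w v\<close> adj_in unfolding is_automorphism_def by blast
  ultimately show ?case by (auto intro!: relcompI[OF Suc.IH])
qed simp

end

text \<open>A reflection without reference to distances: A is the half space of x, and the set fixed by
  the reflection is the complement of A and its image.\<close>
definition mirror ::
  "'a set \<Rightarrow> ('a \<Rightarrow> 'a \<Rightarrow> bool) \<Rightarrow> 'a \<Rightarrow> 'a \<Rightarrow> ('a \<Rightarrow> 'a) \<Rightarrow> 'a set \<Rightarrow> bool" where
  "mirror V E x y \<phi> A \<longleftrightarrow>
     is_automorphism V E \<phi> \<and> (\<forall>v\<in>V. \<phi> (\<phi> v) = v) \<and> A \<subseteq> V \<and> x \<in> A \<and> \<phi> x = y \<and>
     (\<forall>v\<in>A. \<phi> v \<notin> A) \<and> (\<forall>v\<in>V. v \<notin> A \<longrightarrow> \<phi> v \<notin> A \<longrightarrow> \<phi> v = v) \<and>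
     (\<forall>v\<in>A. E v (\<phi> v)) \<and> (\<forall>u\<in>A. \<forall>v\<in>A. E u (\<phi> v) \<longrightarrow> u = v)"

definition has_mirrors :: "'a set \<Rightarrow> ('a \<Rightarrow> 'a \<Rightarrow> bool) \<Rightarrow> bool" where
  "has_mirrors V E \<longleftrightarrow> (\<forall>x\<in>V. \<forall>y\<in>V. E x y \<longrightarrow> (\<exists>\<phi> A. mirror V E x y \<phi> A))"

lemma mirrorD:
  assumes "mirror V E x y \<phi> A"
  shows "is_automorphism V E \<phi>" "v \<in> V \<Longrightarrow> \<phi> (\<phi> v) = v" "A \<subseteq> V" "x \<in> A" "\<phi> x = y"
    "v \<in> A \<Longrightarrow> \<phi> v \<notin> A" "v \<in> V \<Longrightarrow> v \<notin> A \<Longrightarrow> \<phi> v \<notin> A \<Longrightarrow> \<phi> v = v"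
    "v \<in> A \<Longrightarrow> E v (\<phi> v)" "u \<in> A \<Longrightarrow> v \<in> A \<Longrightarrow> E u (\<phi> v) \<Longrightarrow> u = v"
    "v \<in> V \<Longrightarrow> \<phi> v \<in> V" "u \<in> V \<Longrightarrow> v \<in> V \<Longrightarrow> E (\<phi> u) (\<phi> v) = E u v"
  using assms unfolding mirror_def is_automorphism_def bij_betw_def by blast+

context conn_graph
begin

lemma mirror_gdist:
  assumes "mirror V E x y \<phi> A" "u \<in> V" "v \<in> V"
  shows "d (\<phi> u) (\<phi> v) = d u v"
proof -
  note m = mirrorD[OF assms(1)]
  have le: "d (\<phi> a) (\<phi> b) \<le> d a b" if "a \<in> V" "b \<in> V" for a b
    using gdist_le walk_aut m(1) walk_gdist that by blast
  show ?thesis using le[of u v] le[of "\<phi> u" "\<phi> v"] m(2,10) assms by simp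
qed

lemma mirror_gdist':
  assumes "mirror V E x y \<phi> A" "u \<in> V" "v \<in> V"
  shows "d (\<phi> u) v = d u (\<phi> v)"
  using mirror_gdist[OF assms(1), of u "\<phi> v"] mirrorD(2,10)[OF assms(1)] assms by simp

text \<open>A walk from \<open>a\<close> to \<open>\<phi> b\<close> starts outside the image of
  \<open>A\<close> and ends in it; reflecting its last part gives a walk to \<open>b\<close> that is
  not longer. The induction follows a geodesic: at a fixed vertex both distances agree, and a
  crossing edge from \<open>a\<close> to \<open>w\<close> has \<open>a = \<phi> w\<close>, which
  even saves a step.\<close>

lemma mirror_fold:
  assumes "mirror V E x y \<phi> A" "b \<in> A" "a \<in> V" "\<phi> a \<notin> A"
  shows "d a b \<le> d a (\<phi> b)"
  using assms(3,4)
proof (induction "d a (\<phi> b)" arbitrary: a)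
  case 0
  note m = mirrorD[OF assms(1)]
  have "a = \<phi> b" using 0 gdist_0 m(3,10) assms(2) by (metis subsetD)
  then show ?case using 0 m(2,3) assms(2) by auto
next
  case (Suc n)
  note m = mirrorD[OF assms(1)]
  have bV: "b \<in> V" "\<phi> b \<in> V" using m(3,10) assms(2) by auto
  show ?case
  proof (cases "a \<in> A")
    case False
    then have "\<phi> a = a" using m(7) Suc by auto
    then show ?thesis using mirror_gdist'[OF assms(1) \<open>a \<in> V\<close> bV(1)] by simp
  next
    case True
    obtain w where w: "E a w" "d w (\<phi> b) = n"
      using gdist_SucE[OF \<open>a \<in> V\<close> bV(2)] Suc(2) by metis
    have wV: "w \<in> V" using w adj_in by blast
    show ?thesis
    proof (cases "\<phi> w \<in> A")
      case True
      then have "a = \<phi> w" using m(9)[OF \<open>a \<in> A\<close> True] w wV m(2) by simp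
      then have "d a b = n" using mirror_gdist'[OF assms(1) wV bV(1)] w by simp
      then show ?thesis using Suc(2) by simp
    next
      case False
      then have "d w b \<le> n" using Suc(1)[of w] w wV by simp
      then show ?thesis using gdist_step_le[OF w(1) bV(1)] Suc(2) by simp
    qed
  qed
qed

end

locale mirror_graph = conn_graph +
  assumes mirrors: "has_mirrors V E"
begin

lemma mirror_ex: "E x y \<Longrightarrow> \<exists>\<phi> A. mirror V E x y \<phi> A"
  using mirrors adj_in unfolding has_mirrors_def by blast

text \<open>In a minimal counterexample, a geodesic from a to phi b leaves a towards a vertex w fixed
  by phi. The mirror of the edge a w commutes with phi near b and moves b closer to a, which
  yields a smaller counterexample.\<close>
lemma mirror_no_tie:
  assumes "mirror V E x y \<phi> A" "a \<in> A" "b \<in> A" "d a b = m"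
  shows "d a (\<phi> b) \<noteq> m"
  using assms(2-)
proof (induction m arbitrary: a b rule: less_induct)
  case (less m)
  note m = mirrorD[OF assms(1)]
  show ?case
  proof
    assume eq: "d a (\<phi> b) = m"
    have V: "a \<in> V" "b \<in> V" "\<phi> b \<in> V" "\<phi> a \<in> V" using less.prems m(3,10) by auto
    have "m \<noteq> 0" using less.prems eq gdist_0 V m(6) by metis
    then obtain k where k: "m = Suc k" by (cases m) auto
    obtain w where w: "E a w" "d w (\<phi> b) = k"
      using gdist_SucE[OF V(1,3)] eq k by metis
    have wV: "w \<in> V" using w adj_in by blast
    have ge: "k \<le> d w b" using gdist_step_le[OF w(1) V(2)] less.prems(3) k by simp
    \<comment> \<open>Only a fixed \<open>w\<close> is a real obstacle. If \<open>w\<close> is in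
      \<open>A\<close>, folding yields a tie at distance \<open>k\<close>; if \<open>w\<close> is on
      the other side, it is \<open>\<phi> a\<close>, and then \<open>b\<close> is at distance
      \<open>k\<close> from \<open>a\<close>.\<close>
    show False
    proof (cases "w \<in> A \<or> \<phi> w \<in> A")
      case True
      then show False
      proof
        assume wA: "w \<in> A"
        have "d w b = k" using mirror_fold[OF assms(1) less.prems(2) wV] m(6)[OF wA] w ge by simp
        then show False using less.IH[OF _ wA less.prems(2)] w(2) k by simp
      next
        assume "\<phi> w \<in> A"
        then have "a = \<phi> w" using m(9)[OF less.prems(1), of "\<phi> w"] w wV m(2) by simp
        then show False using mirror_gdist'[OF assms(1) wV V(2)] w less.prems k by simp
      qed
    next
      case False
      then have fw: "\<phi> w = w" using m(7) wV by blast
      then have dwb: "d w b = k" using mirror_gdist'[OF assms(1) wV V(2)] w by simp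
      obtain \<sigma> C where s: "mirror V E a w \<sigma> C" using mirror_ex w by blast
      note n = mirrorD[OF s]
      \<comment> \<open>Such a \<open>c\<close> is strictly nearer to \<open>w\<close> than to
        \<open>a\<close>; folding at the mirror of \<open>a\<close> and \<open>w\<close> would say
        the opposite if \<open>\<sigma> c\<close> were outside \<open>C\<close>.\<close>
      have far: "\<sigma> c \<in> C" if "c \<in> V" "d a c = m" "d w c = k" for c
      proof (rule ccontr)
        assume "\<sigma> c \<notin> C"
        then have "d c a \<le> d c w" using mirror_fold[OF s n(4) that(1)] n(5) by simp
        then show False using that k gdist_sym V wV by simp
      qed
      have c: "\<sigma> b \<in> C" "\<sigma> (\<phi> b) \<in> C" using far less.prems eq dwb w V by auto
      have cV: "\<sigma> b \<in> V" "\<sigma> (\<phi> b) \<in> V" using c n(3) by auto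
      have nb: "b \<notin> C" "\<phi> b \<notin> C" using c n(6) by blast+
      have bb: "b \<noteq> \<phi> b" using less.prems(2) m(6) by metis
      have e1: "E (\<sigma> b) b" "E (\<sigma> (\<phi> b)) (\<phi> b)" using n(8)[OF c(1)] n(8)[OF c(2)] n(2) V by auto
      have e2: "\<not> E (\<sigma> b) (\<phi> b)"
        using n(9)[OF c, unfolded n(2)[OF V(3)]] bb n(2) V by metis
      have e3: "\<not> E (\<sigma> (\<phi> b)) b"
        using n(9)[OF c(2,1), unfolded n(2)[OF V(2)]] bb n(2) V by metis
      \<comment> \<open>The edge from \<open>\<sigma> b\<close> to \<open>b\<close> decides: on the
        other side \<open>\<sigma> b\<close> would be \<open>\<phi> b\<close>, and as a fixed vertex
        it would also be adjacent to \<open>\<phi> b\<close>. The same argument places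
        \<open>\<sigma> (\<phi> b)\<close> in \<open>A2\<close>.\<close>
      have A1: "\<sigma> b \<in> A"
      proof (rule ccontr)
        assume no: "\<sigma> b \<notin> A"
        show False
        proof (cases "\<phi> (\<sigma> b) \<in> A")
          case True
          then have "b = \<phi> (\<sigma> b)" using m(9)[OF less.prems(2) True] e1 adj_sym m(2) cV by simp
          then have "\<phi> b = \<sigma> b" using m(2) cV by metis
          then show False using c nb by simp
        next
          case False
          then have "\<phi> (\<sigma> b) = \<sigma> b" using m(7) no cV by blast
          then show False using e1 e2 m(11)[of "\<sigma> b" b] cV V by simp
        qed
      qed
      have A2: "\<phi> (\<sigma> (\<phi> b)) \<in> A"
      proof (rule ccontr)
        assume no: "\<phi> (\<sigma> (\<phi> b)) \<notin> A"
        show False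
        proof (cases "\<sigma> (\<phi> b) \<in> A")
          case True
          then have "\<sigma> (\<phi> b) = b" using m(9)[OF True less.prems(2)] e1 by simp
          then show False using c nb by simp
        next
          case False
          then have "\<phi> (\<sigma> (\<phi> b)) = \<sigma> (\<phi> b)" using m(7) no cV by blast
          then show False using e1(2) e3 m(11)[of "\<sigma> (\<phi> b)" "\<phi> b"] m(2) cV V by simp
        qed
      qed
      \<comment> \<open>The edge from \<open>b\<close> to \<open>\<phi> b\<close>, moved by
        \<open>\<sigma>\<close>, crosses the mirror, so its ends are exchanged by
        \<open>\<phi>\<close>; both are at distance \<open>k\<close> from \<open>a\<close>, which is
        the smaller tie.\<close>
      have "E (\<sigma> b) (\<sigma> (\<phi> b))" using n(11) V m(8) less.prems(2) by simp
      then have "\<sigma> b = \<phi> (\<sigma> (\<phi> b))" using m(9)[OF A1 A2] m(2) cV by simp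
      then have "\<phi> (\<sigma> b) = \<sigma> (\<phi> b)" using m(2) cV by simp
      moreover have "d a (\<sigma> b) = k" "d a (\<sigma> (\<phi> b)) = k"
        using mirror_gdist'[OF s V(1,2)] mirror_gdist'[OF s V(1,3)] n(5) dwb w by auto
      ultimately show False using less.IH[OF _ less.prems(1) A1] k by simp
    qed
  qed
qed

lemma mirror_half_space:
  assumes "mirror V E x y \<phi> A" "a \<in> A" "b \<in> A"
  shows "d a (\<phi> b) = Suc (d a b)"
proof -
  note m = mirrorD[OF assms(1)]
  have "d a b \<le> d a (\<phi> b)" using mirror_fold[OF assms(1,3)] m(3,6) assms by auto
  moreover have "d a (\<phi> b) \<noteq> d a b" using mirror_no_tie[OF assms] by blast
  moreover have "d a (\<phi> b) \<le> Suc (d a b)" 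
    using gdist_step_le'[OF adj_sym[OF m(8)[OF assms(3)]]] m(3) assms(2) by blast
  ultimately show ?thesis by simp
qed

text \<open>The value does not depend on \<open>b\<close>: all edges from \<open>b\<close> to
  \<open>\<phi> b\<close> with \<open>b\<close> in \<open>A\<close> are parallel and define the same
  root. So knowledge about one crossing edge transfers to every other.\<close>

lemma mirror_gdist_diff:
  assumes "mirror V E x y \<phi> A" "v \<in> V" "b \<in> A"
  shows "int (d v (\<phi> b)) - int (d v b) = (if v \<in> A then 1 else if \<phi> v \<in> A then -1 else 0)"
proof -
  note m = mirrorD[OF assms(1)]
  have V: "b \<in> V" "\<phi> b \<in> V" "\<phi> v \<in> V" using assms m(3,10) by auto
  consider "v \<in> A" | "v \<notin> A" "\<phi> v \<in> A" | "v \<notin> A" "\<phi> v \<notin> A" by blast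
  then show ?thesis
  proof cases
    case 1 then show ?thesis using mirror_half_space[OF assms(1) 1 assms(3)] by simp
  next
    case 2 
    have "d v b = d (\<phi> v) (\<phi> b)" "d v (\<phi> b) = d (\<phi> v) b"
      using mirror_gdist[OF assms(1,2) V(1)] mirror_gdist'[OF assms(1,2) V(1)] by auto
    then show ?thesis using 2 mirror_half_space[OF assms(1) 2(2) assms(3)] by simp
  next
    case 3
    then have "\<phi> v = v" using m(7) assms(2) by blast
    then show ?thesis using 3 mirror_gdist'[OF assms(1,2) V(1)] by simp
  qed
qed

lemma mirror_sides:
  assumes "mirror V E x y \<phi> A" "v \<in> V"
  shows "int (d v y) - int (d v x) = (if v \<in> A then 1 else if \<phi> v \<in> A then -1 else 0)"
  using mirror_gdist_diff[OF assms mirrorD(4)[OF assms(1)]] mirrorD(5)[OF assms(1)] by simp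

text \<open>By \<open>mirror_sides\<close> the half space can only be
  \<open>closer_set V E x y\<close>; after this identification the clauses of a reflection are those
  of a mirror.\<close>

lemma mirror_is_reflection:
  assumes m: "mirror V E x y \<phi> A"
  shows "is_reflection V E x y \<phi>"
proof -
  note n = mirrorD[OF m]
  have "d v x < d v y \<longleftrightarrow> v \<in> A" "d v y < d v x \<longleftrightarrow> \<phi> v \<in> A" if "v \<in> V" for v
    using mirror_sides[OF m that] n(6)[of v] by (auto split: if_splits)
  then have c1: "closer_set V E x y = A" and c2: "closer_set V E y x = {v \<in> V. \<phi> v \<in> A}"
    using n(3) by (auto simp: closer_set_def)
  have "\<phi> z = z" if "z \<in> equi_set V E x y" for z
    using that mirror_sides[OF m, of z] n(7) by (auto simp: equi_set_def split: if_splits)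
  moreover have "{{u, v} | u v. u \<in> A \<and> v \<in> {v \<in> V. \<phi> v \<in> A} \<and> E u v} = {{u, \<phi> u} | u. u \<in> A}"
    (is "?L = ?R")
  proof
    show "?L \<subseteq> ?R"
    proof
      fix e assume "e \<in> ?L"
      then obtain u v where uv: "e = {u, v}" "u \<in> A" "v \<in> V" "\<phi> v \<in> A" "E u v" by blast
      then have "u = \<phi> v" using n(2) n(9)[OF uv(2) uv(4)] by simp
      then have "v = \<phi> u" using n(2) uv by simp
      then show "e \<in> ?R" using uv by blast
    qed
    show "?R \<subseteq> ?L"
    proof
      fix e assume "e \<in> ?R"
      then obtain u where u: "e = {u, \<phi> u}" "u \<in> A" by blast
      then have "\<phi> u \<in> {v \<in> V. \<phi> v \<in> A}" using n(2,3,10) by auto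
      then show "e \<in> ?L" using u n(8) by blast
    qed
  qed
  ultimately show ?thesis unfolding is_reflection_def c1 c2 using n(1,2,5) by simp
qed

lemma reflective: "reflective V E"
  unfolding reflective_def using mirror_ex mirror_is_reflection by blast

end

text \<open>The half space is \<open>closer_set V E x y\<close>, which \<open>\<phi>\<close>
  exchanges with \<open>closer_set V E y x\<close> because it preserves distances and swaps
  \<open>x\<close> and \<open>y\<close>.\<close>

lemma reflective_has_mirrors:
  assumes "simple_graph V E" "connected_graph V E" "reflective V E"
  shows "has_mirrors V E"
  unfolding has_mirrors_def
proof (intro ballI impI)
  interpret conn_graph V E using assms by unfold_locales
  fix x y assume xy: "x \<in> V" "y \<in> V" "E x y"
  then obtain \<phi> where r: "is_reflection V E x y \<phi>" using assms unfolding reflective_def by blast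
  have aut: "is_automorphism V E \<phi>" and inv: "\<And>v. v \<in> V \<Longrightarrow> \<phi> (\<phi> v) = v" and pxy: "\<phi> x = y"
    and cross: "{{u, v} | u v. u \<in> closer_set V E x y \<and> v \<in> closer_set V E y x \<and> E u v}
       = {{u, \<phi> u} | u. u \<in> closer_set V E x y}"
    and fixd: "\<And>z. z \<in> equi_set V E x y \<Longrightarrow> \<phi> z = z"
    using r unfolding is_reflection_def by auto
  have pyx: "\<phi> y = x" using inv xy pxy by blast
  have inV: "\<phi> v \<in> V" if "v \<in> V" for v using aut that unfolding is_automorphism_def bij_betw_def by blast
  have le: "d (\<phi> a) (\<phi> b) \<le> d a b" if "a \<in> V" "b \<in> V" for a b
    using gdist_le walk_aut aut walk_gdist that by blast
  have dd: "d (\<phi> a) b = d a (\<phi> b)" if "a \<in> V" "b \<in> V" for a b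
    using le[of "\<phi> a" b] le[of a "\<phi> b"] inv that inV by simp
  let ?A = "closer_set V E x y"
  have AV: "?A \<subseteq> V" by (auto simp: closer_set_def)
  have swap: "\<phi> v \<in> ?A \<longleftrightarrow> v \<in> closer_set V E y x" if "v \<in> V" for v
    using dd[OF that xy(1)] dd[OF that xy(2)] pxy pyx that inV by (simp add: closer_set_def)
  have disj: "\<phi> v \<notin> ?A" if "v \<in> ?A" for v
    using swap that by (auto simp: closer_set_def)
  have fixv: "\<phi> v = v" if "v \<in> V" "v \<notin> ?A" "\<phi> v \<notin> ?A" for v
  proof -
    have "v \<notin> closer_set V E y x" using swap that by blast
    then have "v \<in> equi_set V E x y" using that by (auto simp: closer_set_def equi_set_def)
    then show ?thesis using fixd by blast
  qed
  have edge: "E v (\<phi> v)" if "v \<in> ?A" for v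
  proof -
    have "{v, \<phi> v} \<in> {{u, \<phi> u} | u. u \<in> ?A}" using that by blast
    then have "{v, \<phi> v} \<in> {{u, v} | u v. u \<in> ?A \<and> v \<in> closer_set V E y x \<and> E u v}"
      unfolding cross .
    then obtain a b where "{v, \<phi> v} = {a, b}" "E a b" by blast
    then show ?thesis using adj_sym by (auto simp: doubleton_eq_iff)
  qed
  \<comment> \<open>The given equation is about unordered edges; the ends can be told apart because
    \<open>\<phi>\<close> leads out of the half space.\<close>
  have only: "u = v" if uv: "u \<in> ?A" "v \<in> ?A" "E u (\<phi> v)" for u v
  proof -
    have "\<phi> v \<in> closer_set V E y x" using swap[of "\<phi> v"] inv inV AV uv by auto
    then have "{u, \<phi> v} \<in> {{u, v} | u v. u \<in> ?A \<and> v \<in> closer_set V E y x \<and> E u v}"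
      using uv by blast
    then obtain w where w: "{u, \<phi> v} = {w, \<phi> w}" "w \<in> ?A" unfolding cross by blast
    then have "u = w" "\<phi> v = \<phi> w" using disj uv by (metis doubleton_eq_iff)+
    then show ?thesis using inv AV uv by (metis subsetD)
  qed
  have "x \<in> ?A" using xy gdist_1[of x y] by (simp add: closer_set_def)
  then have "mirror V E x y \<phi> ?A"
    unfolding mirror_def using aut inv AV pxy disj fixv edge only by blast
  then show "\<exists>\<phi> A. mirror V E x y \<phi> A" by blast
qed

section \<open>A graph with mirrors is determined by one neighbourhood\<close>

definition nbrs :: "'a set \<Rightarrow> ('a \<Rightarrow> 'a \<Rightarrow> bool) \<Rightarrow> 'a \<Rightarrow> 'a set" where
  "nbrs V E x = {v \<in> V. E x v}"

text \<open>The relation itself is cut down to \<open>C\<close>, since \<open>simple_graph\<close>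
  forbids related elements outside the vertex set.\<close>

definition restr :: "'a set \<Rightarrow> ('a \<Rightarrow> 'a \<Rightarrow> bool) \<Rightarrow> 'a \<Rightarrow> 'a \<Rightarrow> bool" where
  "restr C E u v \<longleftrightarrow> u \<in> C \<and> v \<in> C \<and> E u v"

text \<open>For x adjacent to z, this is the value of the root z - x at v.\<close>
definition pairing :: "'a set \<Rightarrow> ('a \<Rightarrow> 'a \<Rightarrow> bool) \<Rightarrow> 'a \<Rightarrow> 'a \<Rightarrow> 'a \<Rightarrow> int" where
  "pairing V E x v z = int (gdist V E v x) - int (gdist V E v z)"

context mirror_graph
begin

text \<open>A vertex of \<open>A\<close> has only one neighbour across the mirror. So
  \<open>x\<close> in \<open>A\<close>, being adjacent to \<open>z = \<phi> y\<close>, would be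
  \<open>y\<close> itself; the other side is excluded in the same way.\<close>

lemma mirror_fixes_common_neighbour:
  assumes "mirror V E y z \<phi> A" "E x y" "E x z"
  shows "\<phi> x = x"
proof -
  note m = mirrorD[OF assms(1)]
  have V: "x \<in> V" "y \<in> V" "z \<in> V" using adj_in assms by auto
  have "x \<notin> A" using m(9)[of x y] m(4,5) assms adj_irrefl by metis
  moreover have "\<phi> x \<notin> A"
  proof
    assume "\<phi> x \<in> A"
    moreover have "E (\<phi> x) (\<phi> y)" using m(11) V assms by simp
    ultimately have "\<phi> x = y" using m(4,9) by blast
    then show False using m(2)[OF V(1)] m(5) assms adj_irrefl by simp
  qed
  ultimately show ?thesis using m(7) V by blast
qed

text \<open>This is the reflection formula of a root system. The last factor is the inner product of
  the roots \<open>z - x\<close> and \<open>w - x\<close>, scaled to squared length 2; it depends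
  only on equality and adjacency among the neighbours of \<open>x\<close>.\<close>

lemma mirror_pairing:
  assumes m: "mirror V E x z \<phi> A" and "E x z" "E x w" "v \<in> V"
  shows "pairing V E x (\<phi> v) w =
    pairing V E x v w - pairing V E x v z * (if w = z then 2 else if E z w then 1 else 0)"
proof -
  note n = mirrorD[OF m]
  have V: "x \<in> V" "z \<in> V" "w \<in> V" using assms adj_in by auto
  have pz: "\<phi> z = x" using n(2,5) V by metis
  have dx: "d (\<phi> v) x = d v z" using mirror_gdist'[OF m assms(4) V(1)] n(5) by simp
  consider "w = z" | "w \<noteq> z" "E z w" | "w \<noteq> z" "\<not> E z w" by blast
  then show ?thesis
  proof cases
    case 1
    then show ?thesis using mirror_gdist'[OF m assms(4) V(2)] pz dx by (simp add: pairing_def)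
  next
    case 2
    then have "\<phi> w = w" using mirror_fixes_common_neighbour[OF m] assms adj_sym by blast
    then show ?thesis using 2 mirror_gdist'[OF m assms(4) V(3)] dx by (simp add: pairing_def)
  next
    case 3
    \<comment> \<open>\<open>x\<close>, \<open>z\<close>, \<open>\<phi> w\<close>, \<open>w\<close>
      form a square, whose edge from \<open>w\<close> to \<open>\<phi> w\<close> is parallel to the
      edge from \<open>x\<close> to \<open>z\<close>.\<close>
    have "d w z = 2" using gdist_common_neighbour[of x w z] 3 assms adj_sym by auto
    moreover have "d w x = 1" using gdist_1 V assms adj_sym by blast
    ultimately have "w \<in> A" using mirror_sides[OF m V(3)] by (auto split: if_splits)
    then have "int (d v (\<phi> w)) - int (d v w) = int (d v z) - int (d v x)"
      using mirror_gdist_diff[OF m assms(4)] mirror_sides[OF m assms(4)] by simp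
    then show ?thesis using 3 mirror_gdist'[OF m assms(4) V(3)] dx by (simp add: pairing_def)
  qed
qed

lemma pairing_base:
  assumes "E x z"
  shows "pairing V E x x z = -1"
  using gdist_1[of x z] assms adj_in by (simp add: pairing_def)

lemma pairing_neighbour:
  assumes "E x z" "E x w"
  shows "pairing V E x w z = (if w = z then 1 else if E w z then 0 else -1)"
  using gdist_1[of w x] gdist_common_neighbour[of x w z] assms adj_in[of x w] adj_sym
  by (simp add: pairing_def)

lemma closer_neighbour:
  assumes "x \<in> V" "v \<in> V" "v \<noteq> x"
  obtains z where "E x z" "pairing V E x v z = 1" "d v z < d v x"
proof -
  obtain n where n: "d x v = Suc n" using gdist_0 assms by (metis not0_implies_Suc)
  then obtain z where "E x z" "d z v = n" using gdist_SucE assms by metis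
  then show thesis using that[of z] n gdist_sym adj_in assms by (simp add: pairing_def)
qed

text \<open>The mirror of an edge at \<open>x\<close> that points towards \<open>v\<close> brings
  \<open>v\<close> closer to \<open>x\<close>, and it changes the numbers of \<open>v\<close> and
  \<open>w\<close> by the same formula. At \<open>x\<close> all numbers are -1, while any other
  vertex has a neighbour of \<open>x\<close> with value 1.\<close>

lemma pairing_inj:
  assumes "x \<in> V" "v \<in> V" "w \<in> V" "\<And>z. E x z \<Longrightarrow> pairing V E x v z = pairing V E x w z"
  shows "v = w"
  using assms(2-)
proof (induction "d v x" arbitrary: v w rule: less_induct)
  case less
  show ?case
  proof (cases "v = x")
    case True
    show ?thesis
    proof (rule ccontr)
      assume "v \<noteq> w"
      then obtain z where "E x z" "pairing V E x w z = 1"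
        using closer_neighbour[OF assms(1) less(3)] True by metis
      then show False using less.prems(3)[of z] pairing_base True by simp
    qed
  next
    case False
    then obtain z where z: "E x z" "pairing V E x v z = 1" "d v z < d v x"
      using closer_neighbour assms(1) less.prems by metis
    obtain \<phi> A where m: "mirror V E x z \<phi> A" using mirror_ex z by blast
    note n = mirrorD[OF m]
    have "d (\<phi> v) x = d v z" using mirror_gdist'[OF m less(2) assms(1)] n(5) by simp
    then have "\<phi> v = \<phi> w"
      using less.hyps[of "\<phi> v" "\<phi> w"] z n(10) less.prems mirror_pairing[OF m z(1)] by simp
    then show ?thesis using n(2) less.prems by metis
  qed
qed

end

text \<open>A relation by equal coordinates instead of a recursively defined map: reflecting
  vertices along geodesics would make the image depend on the geodesics chosen.\<close>

definition matched where
  "matched V E x W F y f v w \<longleftrightarrow> v \<in> V \<and> w \<in> W \<and>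
     (\<forall>z\<in>nbrs V E x. pairing V E x v z = pairing W F y w (f z))"

locale local_iso = G: mirror_graph V E + H: mirror_graph W F
  for V :: "'a set" and E and W :: "'b set" and F +
  fixes x y f
  assumes x: "x \<in> V" and y: "y \<in> W" and bij: "bij_betw f (nbrs V E x) (nbrs W F y)"
    and adj: "\<And>u v. u \<in> nbrs V E x \<Longrightarrow> v \<in> nbrs V E x \<Longrightarrow> F (f u) (f v) \<longleftrightarrow> E u v"
begin

abbreviation matches (infix "~~" 50) where "v ~~ w \<equiv> matched V E x W F y f v w"

lemma nb: "z \<in> nbrs V E x \<longleftrightarrow> E x z"
  using G.adj_in by (auto simp: nbrs_def)

lemma f_nb: "E x z \<Longrightarrow> F y (f z)"
  using bij nb unfolding bij_betw_def nbrs_def by blast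

lemma matches_base: "x ~~ y"
  using x y G.pairing_base H.pairing_base nb f_nb unfolding matched_def by auto

lemma matches_neighbour:
  assumes "E x u"
  shows "u ~~ f u"
proof -
  have "f u = f z \<longleftrightarrow> u = z" if "E x z" for z
    using bij nb that assms by (metis bij_betw_inv_into_left)
  then show ?thesis using assms f_nb[OF assms] G.adj_in H.adj_in[OF f_nb[OF assms]] nb adj
    by (auto simp: matched_def G.pairing_neighbour H.pairing_neighbour f_nb)
qed

text \<open>Corresponding mirrors change both sets of coordinates with the same coefficients,
  because \<open>f\<close> preserves equality and adjacency of neighbours.\<close>

lemma matches_mirror:
  assumes "mirror V E x z \<phi> A" "mirror W F y (f z) \<psi> B" "E x z" "v ~~ w"
  shows "\<phi> v ~~ \<psi> w"
  unfolding matched_def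
proof (intro conjI ballI)
  have V: "v \<in> V" "w \<in> W" using assms by (auto simp: matched_def)
  show "\<phi> v \<in> V" "\<psi> w \<in> W" using V mirrorD(10) assms by metis+
  fix u assume u: "u \<in> nbrs V E x"
  have "f u = f z \<longleftrightarrow> u = z" 
    using bij nb u assms by (metis bij_betw_inv_into_left)
  then show "pairing V E x (\<phi> v) u = pairing W F y (\<psi> w) (f u)"
    using u assms f_nb nb V adj G.mirror_pairing[OF assms(1,3) _ V(1)] 
      H.mirror_pairing[OF assms(2) _ _ V(2)] by (auto simp: matched_def)
qed

lemma mirrors_ex:
  assumes "E x z"
  obtains \<phi> A \<psi> B where "mirror V E x z \<phi> A" "mirror W F y (f z) \<psi> B"
  using G.mirror_ex[OF assms] H.mirror_ex[OF f_nb[OF assms]] that by blast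

lemma matches_total:
  assumes "v \<in> V"
  shows "\<exists>w. v ~~ w"
  using assms
proof (induction "G.d v x" arbitrary: v rule: less_induct)
  case less
  show ?case
  proof (cases "v = x")
    case False
    then obtain z where z: "E x z" "G.d v z < G.d v x"
      using G.closer_neighbour x less.prems by metis
    obtain \<phi> A \<psi> B where m: "mirror V E x z \<phi> A" "mirror W F y (f z) \<psi> B" 
      using mirrors_ex z by blast
    have "G.d (\<phi> v) x = G.d v z" using G.mirror_gdist'[OF m(1) less(2) x] mirrorD(5)[OF m(1)] by simp
    then obtain w where "\<phi> v ~~ w" using less.hyps[of "\<phi> v"] z mirrorD(10)[OF m(1)] less(2) by auto
    then have "\<phi> (\<phi> v) ~~ \<psi> w" using matches_mirror m z by blast
    then show ?thesis using mirrorD(2)[OF m(1)] less(2) by auto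
  qed (use matches_base in blast)
qed

lemma matches_inj: "v ~~ w \<Longrightarrow> v' ~~ w \<Longrightarrow> v = v'"
  using G.pairing_inj[OF x, of v v'] nb unfolding matched_def by simp

lemma matches_unique: "v ~~ w \<Longrightarrow> v ~~ w' \<Longrightarrow> w = w'"
proof (rule H.pairing_inj[OF y])
  fix z assume *: "v ~~ w" "v ~~ w'" "F y z"
  then obtain u where "z = f u" "u \<in> nbrs V E x"
    using bij H.adj_in by (force simp: bij_betw_def nbrs_def)
  then show "pairing W F y w z = pairing W F y w' z" using * unfolding matched_def by auto
qed (auto simp: matched_def)

text \<open>Mirrors at the base vertex carry the end \<open>v\<close> of the edge to
  \<open>x\<close>; then the other end is a neighbour of \<open>x\<close>, and its partner is its
  value under \<open>f\<close>.\<close>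

lemma matches_adj:
  assumes "v ~~ w" "v' ~~ w'" "E v v'"
  shows "F w w'"
proof -
  have "v \<in> V" using assms by (simp add: matched_def)
  then show ?thesis using assms
  proof (induction "G.d v x" arbitrary: v w v' w' rule: less_induct)
    case less
    show ?case
    proof (cases "v = x")
      case True
      then show ?thesis 
        using matches_neighbour matches_base matches_unique f_nb less.prems by metis
    next
      case False
      then obtain z where z: "E x z" "G.d v z < G.d v x"
        using G.closer_neighbour x less.prems by metis
      obtain \<phi> A \<psi> B where m: "mirror V E x z \<phi> A" "mirror W F y (f z) \<psi> B" 
        using mirrors_ex z by blast
      have "G.d (\<phi> v) x = G.d v z"
        using G.mirror_gdist'[OF m(1) less(2) x] mirrorD(5)[OF m(1)] by simp
      then have "F (\<psi> w) (\<psi> w')"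
        using less.hyps[of "\<phi> v"] z matches_mirror[OF m z(1)] less.prems mirrorD(10,11)[OF m(1)] 
          G.adj_in[OF less.prems(4)]
        by metis
      then show ?thesis using mirrorD(11)[OF m(2)] less.prems by (auto simp: matched_def)
    qed
  qed
qed

end

theorem local_iso_global:
  assumes "mirror_graph V E" "mirror_graph W F" "x \<in> V" "y \<in> W"
    and "graph_iso (nbrs V E x) E (nbrs W F y) F"
  shows "graph_iso V E W F"
proof -
  obtain f where f: "bij_betw f (nbrs V E x) (nbrs W F y)"
    "\<forall>u\<in>nbrs V E x. \<forall>v\<in>nbrs V E x. E u v \<longleftrightarrow> F (f u) (f v)"
    using assms(5) unfolding graph_iso_def by blast
  define g where "g = inv_into (nbrs V E x) f"
  have g: "bij_betw g (nbrs W F y) (nbrs V E x)" using f g_def bij_betw_inv_into by blast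
  have fg: "f (g z) = z" "g z \<in> nbrs V E x" if "z \<in> nbrs W F y" for z
    using that f g_def g by (auto simp: bij_betw_inv_into_right bij_betwE)
  have gf: "g (f z) = z" "f z \<in> nbrs W F y" if "z \<in> nbrs V E x" for z
    using that f g_def by (auto simp: bij_betw_inv_into_left bij_betwE)
  interpret L: local_iso V E W F x y f
    using assms f by (intro local_iso.intro local_iso_axioms.intro) auto
  \<comment> \<open>The same situation with the two graphs exchanged; it supplies surjectivity and
    the converse implication for adjacency.\<close>
  interpret R: local_iso W F V E y x g
    using assms f g fg by (intro local_iso.intro local_iso_axioms.intro) auto
  have sym: "matched W F y V E x g w v \<longleftrightarrow> matched V E x W F y f v w" for v w
    unfolding matched_def using fg gf by metis
  define h where "h v = (SOME w. matched V E x W F y f v w)" for v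
  have h: "matched V E x W F y f v (h v)" if "v \<in> V" for v
    unfolding h_def using someI_ex[OF L.matches_total[OF that]] .
  have "inj_on h V" using h L.matches_inj by (metis inj_onI)
  moreover have "h ` V = W"
  proof
    show "h ` V \<subseteq> W" using h by (auto simp: matched_def)
    show "W \<subseteq> h ` V"
    proof
      fix w assume "w \<in> W"
      then obtain v where "matched V E x W F y f v w" using R.matches_total sym by blast
      moreover then have "v \<in> V" by (simp add: matched_def)
      ultimately have "v \<in> V" "h v = w" using h L.matches_unique by blast+
      then show "w \<in> h ` V" by blast
    qed
  qed
  moreover have "E u v \<longleftrightarrow> F (h u) (h v)" if "u \<in> V" "v \<in> V" for u v
    using L.matches_adj[OF h[OF that(1)] h[OF that(2)]] R.matches_adj[of "h u" u "h v" v] sym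
      h that by blast
  ultimately show ?thesis unfolding graph_iso_def bij_betw_def by blast
qed

lemma graph_iso_refl: "graph_iso V E V E"
  unfolding graph_iso_def by (intro exI[of _ id]) auto

lemma graph_iso_sym:
  assumes "graph_iso V E W F"
  shows "graph_iso W F V E"
proof -
  obtain f where f: "bij_betw f V W" "\<forall>u\<in>V. \<forall>v\<in>V. E u v \<longleftrightarrow> F (f u) (f v)"
    using assms unfolding graph_iso_def by blast
  have "F u v \<longleftrightarrow> E (inv_into V f u) (inv_into V f v)" if "u \<in> W" "v \<in> W" for u v
    using f that bij_betw_inv_into[OF f(1)] by (simp add: bij_betw_inv_into_right bij_betwE)
  then show ?thesis unfolding graph_iso_def using bij_betw_inv_into[OF f(1)] by blast
qed

lemma graph_iso_trans:
  assumes "graph_iso V E W F" "graph_iso W F U D"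
  shows "graph_iso V E U D"
proof -
  obtain f g where "bij_betw f V W" "\<forall>u\<in>V. \<forall>v\<in>V. E u v \<longleftrightarrow> F (f u) (f v)"
    and "bij_betw g W U" "\<forall>u\<in>W. \<forall>v\<in>W. F u v \<longleftrightarrow> D (g u) (g v)"
    using assms unfolding graph_iso_def by blast
  then show ?thesis unfolding graph_iso_def
    by (intro exI[of _ "g \<circ> f"]) (auto simp: bij_betw_trans bij_betwE)
qed

lemma mirror_iso:
  assumes f: "bij_betw f V W" "\<And>u v. u \<in> V \<Longrightarrow> v \<in> V \<Longrightarrow> F (f u) (f v) \<longleftrightarrow> E u v"
    and m: "mirror V E x y \<phi> A"
  shows "mirror W F (f x) (f y) (f \<circ> \<phi> \<circ> inv_into V f) (f ` A)"
proof -
  note n = mirrorD[OF m]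
  let ?g = "inv_into V f"
  have gf: "?g (f v) = v" if "v \<in> V" for v using f that by (simp add: bij_betw_inv_into_left)
  have W: "W = f ` V" and inj: "inj_on f V" using f by (auto simp: bij_betw_def)
  have fA: "f v \<in> f ` A \<longleftrightarrow> v \<in> A" if "v \<in> V" for v
    using inj n(3) that by (meson inj_on_image_mem_iff)
  define \<psi> where "\<psi> = f \<circ> \<phi> \<circ> ?g"
  have \<psi>: "\<psi> (f v) = f (\<phi> v)" if "v \<in> V" for v using gf that by (simp add: \<psi>_def)
  have "bij_betw \<psi> W W" unfolding \<psi>_def
    using f n(1) bij_betw_inv_into unfolding is_automorphism_def by (metis bij_betw_trans)
  then have "is_automorphism W F \<psi>"
    unfolding is_automorphism_def W by (simp add: \<psi> f(2) n(10,11))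
  moreover have "\<forall>v\<in>W. v \<notin> f ` A \<longrightarrow> \<psi> v \<notin> f ` A \<longrightarrow> \<psi> v = v"
    unfolding W by (simp add: \<psi> n(7,10) fA)
  moreover have "\<forall>v\<in>f ` A. \<psi> v \<notin> f ` A" using n(3,6,10) by (auto simp: \<psi> fA subset_iff)
  moreover have "\<forall>v\<in>f ` A. F v (\<psi> v)" using n(3,8,10) by (auto simp: \<psi> f(2) subset_iff)
  moreover have "\<forall>u\<in>f ` A. \<forall>v\<in>f ` A. F u (\<psi> v) \<longrightarrow> u = v"
    using n(3,9,10) by (auto simp: \<psi> f(2) subset_iff)
  moreover have "\<forall>v\<in>W. \<psi> (\<psi> v) = v" unfolding W by (simp add: \<psi> n(2,10))
  moreover have "x \<in> V" using n(3,4) by blast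
  ultimately show ?thesis
    unfolding mirror_def \<psi>_def[symmetric] using n(3,4,5) \<psi> W by auto
qed

lemma has_mirrors_iso:
  assumes "graph_iso V E W F" "has_mirrors V E"
  shows "has_mirrors W F"
  unfolding has_mirrors_def
proof (intro ballI impI)
  fix x y assume xy: "x \<in> W" "y \<in> W" "F x y"
  obtain f where f: "bij_betw f V W" "\<forall>u\<in>V. \<forall>v\<in>V. E u v \<longleftrightarrow> F (f u) (f v)"
    using assms unfolding graph_iso_def by blast
  then obtain u v where uv: "x = f u" "y = f v" "u \<in> V" "v \<in> V"
    using xy unfolding bij_betw_def by blast
  then obtain \<phi> A where "mirror V E u v \<phi> A"
    using assms(2) f xy unfolding has_mirrors_def by blast
  from mirror_iso[OF f(1) _ this, of F] show "\<exists>\<phi> A. mirror W F x y \<phi> A" using f uv by blast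
qed

text \<open>Since \<open>mirror\<close> contains no distances, nothing has to be known about
  shortest walks inside \<open>C\<close>.\<close>

lemma mirror_restrict:
  assumes m: "mirror V E x y \<phi> A" and "C \<subseteq> V" "x \<in> C" "\<And>v. v \<in> C \<Longrightarrow> \<phi> v \<in> C"
  shows "mirror C (restr C E) x y \<phi> (A \<inter> C)"
proof -
  note n = mirrorD[OF m]
  have "bij_betw \<phi> C C"
    by (rule bij_betw_byWitness[of _ \<phi>]) (use assms n(2) in auto)
  moreover have "v \<in> V" if "v \<in> C" for v using assms(2) that by blast
  ultimately show ?thesis
    unfolding mirror_def is_automorphism_def restr_def
    by (intro conjI ballI impI) (auto simp: n assms intro: n(7,9))
qed

lemma graph_iso_restr:
  "graph_iso C (restr C E) W F \<longleftrightarrow> graph_iso C E W F" "graph_iso W F C (restr C E) \<longleftrightarrow> graph_iso W F C E"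
  unfolding graph_iso_def restr_def by (auto simp: bij_betw_def)

lemma (in mirror_graph) nbrs_has_mirrors: "has_mirrors (nbrs V E x) (restr (nbrs V E x) E)"
  unfolding has_mirrors_def
proof (intro ballI impI)
  let ?N = "nbrs V E x"
  fix y z assume yz: "y \<in> ?N" "z \<in> ?N" "restr ?N E y z"
  then obtain \<phi> A where m: "mirror V E y z \<phi> A" using mirror_ex unfolding restr_def by blast
  note n = mirrorD[OF m]
  have x: "E x y" "E x z" "x \<in> V" using yz adj_in unfolding nbrs_def by blast+
  have "\<phi> v \<in> ?N" if "v \<in> ?N" for v
    using mirror_fixes_common_neighbour[OF m x(1,2)] that x(3) n(11)[of x v] n(10)[of v]
    by (simp add: nbrs_def)
  then show "\<exists>\<phi> A. mirror ?N (restr ?N E) y z \<phi> A"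
    using mirror_restrict[OF m, of ?N] yz by (auto simp: nbrs_def)
qed

section \<open>The components of a neighbourhood\<close>

definition diam2 :: "'a set \<Rightarrow> ('a \<Rightarrow> 'a \<Rightarrow> bool) \<Rightarrow> bool" where
  "diam2 V E \<longleftrightarrow> (\<forall>u\<in>V. \<forall>v\<in>V. u = v \<or> E u v \<or> (\<exists>w\<in>V. E u w \<and> E w v))"

lemma diam2D:
  assumes "diam2 V E" "u \<in> V" "v \<in> V" "u \<noteq> v" "\<not> E u v"
  obtains w where "w \<in> V" "E u w" "E w v"
  using assms unfolding diam2_def by blast

lemma diam2_connected:
  assumes "diam2 V E" "V \<noteq> {}"
  shows "connected_graph V E"
  unfolding connected_graph_def
proof (intro conjI ballI)
  fix u v assume uv: "u \<in> V" "v \<in> V"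
  then consider "u = v" | "E u v" | w where "w \<in> V" "E u w" "E w v"
    using assms unfolding diam2_def by blast
  then show "(u, v) \<in> (adj_rel V E)\<^sup>*"
  proof cases
    case 3
    then have "(u, w) \<in> adj_rel V E" "(w, v) \<in> adj_rel V E" using uv by (auto simp: adj_rel_def)
    then show ?thesis by (meson r_into_rtrancl rtrancl_trans)
  qed (use uv in \<open>auto simp: adj_rel_def\<close>)
qed (use assms in auto)

lemma diam2_iso:
  assumes "graph_iso V E W F" "diam2 V E"
  shows "diam2 W F"
proof -
  obtain f where f: "bij_betw f V W" "\<forall>u\<in>V. \<forall>v\<in>V. E u v \<longleftrightarrow> F (f u) (f v)"
    using assms unfolding graph_iso_def by blast
  then have W: "W = f ` V" by (auto simp: bij_betw_def)
  show ?thesis using assms(2) f(2) unfolding diam2_def W by (simp; metis)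
qed

context mirror_graph
begin

text \<open>For neighbours \<open>u\<close>, \<open>v\<close> of \<open>x\<close>: distance at most
  two within the neighbourhood. By \<open>near_trans\<close> this is transitive there, so its
  classes are the connected components.\<close>

definition near :: "'a \<Rightarrow> 'a \<Rightarrow> 'a \<Rightarrow> bool" where
  "near x u v \<longleftrightarrow> u = v \<or> E u v \<or> (\<exists>w. E x w \<and> E u w \<and> E w v)"

lemma near_sym: "near x u v \<Longrightarrow> near x v u"
  unfolding near_def using adj_sym by blast

text \<open>The mirror of the middle edge b c of a path a b c e among the neighbours of x moves a to a
  common neighbour of a and e.\<close>
lemma near_step:
  assumes "E x a" "E x e" "near x a c" "E c e" "E x c"
  shows "near x a e"
proof -
  consider "a = c" | "E a c" | b where "E x b" "E a b" "E b c" using assms(3) unfolding near_def by blast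
  then show ?thesis
  proof cases
    case 3
    show ?thesis
    proof (cases "a = e \<or> E a e \<or> a = c \<or> E a c \<or> b = e \<or> E b e")
      case True
      then show ?thesis using assms 3 adj_sym unfolding near_def by blast
    next
      case False
      obtain \<phi> A where m: "mirror V E b c \<phi> A" using mirror_ex 3 by blast
      note n = mirrorD[OF m]
      have V: "a \<in> V" "b \<in> V" "c \<in> V" "e \<in> V" "x \<in> V" using adj_in assms 3 by auto
      have px: "\<phi> x = x" using mirror_fixes_common_neighbour[OF m 3(1) assms(5)] .
      have "d a b = 1" "d a c = 2" "d a e = 2" "d e b = 2" "d e c = 1"
        using gdist_common_neighbour assms 3 False adj_sym by auto
      then have "a \<in> A" "\<phi> e \<in> A" "e \<notin> A"
        using mirror_sides[OF m V(1)] mirror_sides[OF m V(4)] by (auto split: if_splits)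
      \<comment> \<open>The edge from \<open>a\<close> to \<open>\<phi> a\<close> is parallel to the
        one from \<open>b\<close> to \<open>c\<close>, and \<open>e\<close> is nearer to
        \<open>c\<close> than to \<open>b\<close>; hence \<open>e\<close> is also nearer to
        \<open>\<phi> a\<close> than to \<open>a\<close>.\<close>
      then have "int (d e (\<phi> a)) - int (d e a) = -1" using mirror_gdist_diff[OF m V(4)] by simp
      then have "d e (\<phi> a) = 1" using \<open>d a e = 2\<close> gdist_sym V by simp
      then have "E e (\<phi> a)" using gdist_1[OF V(4) n(10)[OF V(1)]] by blast
      moreover have "E a (\<phi> a)" using n(8) \<open>a \<in> A\<close> by blast
      moreover have "E x (\<phi> a)" using n(11)[of x a] V px assms by simp
      ultimately show ?thesis using adj_sym unfolding near_def by blast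
    qed
  qed (use assms in \<open>auto simp: near_def\<close>)
qed

lemma near_trans:
  assumes "E x a" "E x b" "E x c" "near x a b" "near x b c"
  shows "near x a c"
  using assms(5) near_step[OF assms(1) _ assms(4)] near_step[OF assms(1)] assms 
  unfolding near_def[of x b c] by blast

definition local_comp :: "'a \<Rightarrow> 'a \<Rightarrow> 'a set" where
  "local_comp x u = {v. E x v \<and> near x u v}"

lemma local_comp:
  assumes "E x u"
  defines "C \<equiv> local_comp x u"
  shows "u \<in> C" "C \<subseteq> nbrs V E x" "\<And>v w. v \<in> C \<Longrightarrow> E x w \<Longrightarrow> E v w \<Longrightarrow> w \<in> C"
    "diam2 C (restr C E)" "mirror_graph C (restr C E)"
proof -
  show u: "u \<in> C" using assms by (simp add: C_def local_comp_def near_def)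
  show sub: "C \<subseteq> nbrs V E x" using adj_in by (auto simp: C_def local_comp_def nbrs_def)
  show closed: "w \<in> C" if "v \<in> C" "E x w" "E v w" for v w
    using near_step[OF assms(1), of w v] that by (auto simp: C_def local_comp_def)
  have CE: "E x v" if "v \<in> C" for v using that by (simp add: C_def local_comp_def)
  show diam: "diam2 C (restr C E)"
    unfolding diam2_def
  proof (intro ballI)
    fix v w assume vw: "v \<in> C" "w \<in> C"
    then have "near x v w" using near_trans[of x v u w] near_sym assms(1) 
      by (auto simp: C_def local_comp_def)
    then show "v = w \<or> restr C E v w \<or> (\<exists>z\<in>C. restr C E v z \<and> restr C E z w)"
      using closed vw unfolding near_def restr_def by blast
  qed
  show "mirror_graph C (restr C E)"
  proof
    show "simple_graph C (restr C E)" using adj_sym adj_irrefl by (auto simp: simple_graph_def restr_def)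
    show "connected_graph C (restr C E)" using diam2_connected diam u by blast
    show "has_mirrors C (restr C E)"
      unfolding has_mirrors_def
    proof (intro ballI impI)
      fix y z assume yz: "y \<in> C" "z \<in> C" "restr C E y z"
      then obtain \<phi> A where m: "mirror V E y z \<phi> A" using mirror_ex unfolding restr_def by blast
      note n = mirrorD[OF m]
      have px: "\<phi> x = x" using mirror_fixes_common_neighbour[OF m] CE yz by blast
      \<comment> \<open>A mirror that fixes \<open>x\<close> leaves \<open>v\<close> in place or
        moves it to a common neighbour of \<open>v\<close> and \<open>x\<close>, which is in the
        same component.\<close>
      have "\<phi> v \<in> C" if "v \<in> C" for v
      proof -
        have v: "E x v" "v \<in> V" "x \<in> V" using CE that adj_in by auto
        have "E x (\<phi> v)" using n(11)[of x v] px v by simp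
        moreover have "E v (\<phi> v) \<or> \<phi> v = v" using n(2,7,8)[of v] n(8)[of "\<phi> v"] v adj_sym by metis
        ultimately show ?thesis using closed that by metis
      qed
      moreover have "C \<subseteq> V" using sub by (auto simp: nbrs_def)
      ultimately show "\<exists>\<phi> A. mirror C (restr C E) y z \<phi> A" using mirror_restrict[OF m] yz by blast
    qed
  qed
qed

lemma local_comp_eq:
  assumes "E x u" "E x v" "local_comp x u \<inter> local_comp x v \<noteq> {}"
  shows "local_comp x u = local_comp x v"
proof -
  obtain w where "E x w" "near x u w" "near x v w" using assms by (auto simp: local_comp_def)
  then have "near x u v" using near_trans near_sym assms by metis
  then have "near x u z \<longleftrightarrow> near x v z" if "E x z" for z using near_trans near_sym assms that by metis
  then show ?thesis by (auto simp: local_comp_def)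
qed

end

section \<open>Cartesian products\<close>

lemma prod_V_iff:
  "xs \<in> prod_V Gs \<longleftrightarrow> length xs = length Gs \<and> (\<forall>i<length Gs. xs ! i \<in> fst (Gs ! i))"
  by (simp add: prod_V_def)

lemma prod_V_update:
  "xs \<in> prod_V Gs \<Longrightarrow> i < length Gs \<Longrightarrow> a \<in> fst (Gs ! i) \<Longrightarrow> xs[i := a] \<in> prod_V Gs"
  by (auto simp: prod_V_iff nth_list_update)

lemma prod_EE:
  assumes "prod_E Gs xs ys"
  obtains i where "xs \<in> prod_V Gs" "ys \<in> prod_V Gs" "i < length Gs" "snd (Gs ! i) (xs ! i) (ys ! i)"
    "\<And>j. j < length Gs \<Longrightarrow> j \<noteq> i \<Longrightarrow> ys ! j = xs ! j"
  using assms unfolding prod_E_def by metis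

lemma prod_E_update:
  assumes "xs \<in> prod_V Gs" "i < length Gs" "a \<in> fst (Gs ! i)" "snd (Gs ! i) (xs ! i) a"
  shows "prod_E Gs xs (xs[i := a])"
  unfolding prod_E_def using assms prod_V_update[OF assms(1-3)]
  by (intro conjI exI[of _ i]) (auto simp: prod_V_iff)

text \<open>The mirror acts on the one coordinate in which the edge moves; its half space is the
  cylinder over the half space in that factor.\<close>

lemma prod_has_mirrors:
  assumes "\<And>H. H \<in> set Gs \<Longrightarrow> has_mirrors (fst H) (snd H)"
  shows "has_mirrors (prod_V Gs) (prod_E Gs)"
  unfolding has_mirrors_def
proof (intro ballI impI)
  fix xs ys assume "prod_E Gs xs ys"
  then obtain i where xs: "xs \<in> prod_V Gs" "ys \<in> prod_V Gs" and i: "i < length Gs"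
    and e: "snd (Gs ! i) (xs ! i) (ys ! i)"
    and eq: "\<And>j. j < length Gs \<Longrightarrow> j \<noteq> i \<Longrightarrow> ys ! j = xs ! j" by (rule prod_EE) blast
  have "has_mirrors (fst (Gs ! i)) (snd (Gs ! i))" using assms i by simp
  then obtain \<phi> A where m: "mirror (fst (Gs ! i)) (snd (Gs ! i)) (xs ! i) (ys ! i) \<phi> A"
    using xs i e unfolding has_mirrors_def prod_V_iff by blast
  note n = mirrorD[OF m]
  define \<psi> where "\<psi> us = us[i := \<phi> (us ! i)]" for us
  let ?A = "{us \<in> prod_V Gs. us ! i \<in> A}"
  have P: "us ! j \<in> fst (Gs ! j)" "length us = length Gs" if "us \<in> prod_V Gs" "j < length Gs" for us j
    using that by (auto simp: prod_V_iff)
  have nth: "\<psi> us ! j = (if j = i then \<phi> (us ! i) else us ! j)" if "us \<in> prod_V Gs" "j < length Gs" for us j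
    using that by (auto simp: \<psi>_def prod_V_iff)
  have \<psi>V: "\<psi> us \<in> prod_V Gs" if "us \<in> prod_V Gs" for us
    unfolding \<psi>_def using prod_V_update[OF that i n(10)[OF P(1)[OF that i]]] .
  have ext: "us = vs" if "us \<in> prod_V Gs" "vs \<in> prod_V Gs" "\<And>j. j < length Gs \<Longrightarrow> us ! j = vs ! j" for us vs
    using that by (auto intro!: nth_equalityI simp: prod_V_iff)
  have inv: "\<psi> (\<psi> us) = us" if "us \<in> prod_V Gs" for us
    by (rule ext) (use that in \<open>auto simp: \<psi>V nth i n(2) P\<close>)
  have phi_inj: "\<phi> a = \<phi> b \<longleftrightarrow> a = b" if "a \<in> fst (Gs ! i)" "b \<in> fst (Gs ! i)" for a b
    using n(2) that by metis
  have bij: "bij_betw \<psi> (prod_V Gs) (prod_V Gs)"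
    by (rule bij_betw_byWitness[of _ \<psi>]) (use inv \<psi>V in auto)
  have adj: "prod_E Gs us vs \<longleftrightarrow> prod_E Gs (\<psi> us) (\<psi> vs)" if "us \<in> prod_V Gs" "vs \<in> prod_V Gs" for us vs
  proof -
    have "snd (Gs ! k) (us ! k) (vs ! k) \<and> (\<forall>j<length Gs. j \<noteq> k \<longrightarrow> us ! j = vs ! j) \<longleftrightarrow>
      snd (Gs ! k) (\<psi> us ! k) (\<psi> vs ! k) \<and> (\<forall>j<length Gs. j \<noteq> k \<longrightarrow> \<psi> us ! j = \<psi> vs ! j)"
      if "k < length Gs" for k
      using that \<open>us \<in> prod_V Gs\<close> \<open>vs \<in> prod_V Gs\<close> i
      by (auto simp: nth n(11) P phi_inj)
    then show ?thesis unfolding prod_E_def using that \<psi>V by blast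
  qed
  have "xs \<in> ?A" using xs n(4) by simp
  moreover have "\<psi> xs = ys" by (rule ext) (use xs eq n(5) in \<open>auto simp: nth \<psi>V\<close>)
  moreover have "\<forall>us\<in>?A. \<psi> us \<notin> ?A" using n(6) i by (auto simp: nth)
  moreover have "\<forall>us\<in>prod_V Gs. us \<notin> ?A \<longrightarrow> \<psi> us \<notin> ?A \<longrightarrow> \<psi> us = us"
    using n(7) i P by (auto simp: nth \<psi>V) (metis \<psi>_def list_update_id)
  moreover have "\<forall>us\<in>?A. prod_E Gs us (\<psi> us)"
    unfolding \<psi>_def using n(8,10) i P by (auto intro!: prod_E_update)
  moreover have "\<forall>us\<in>?A. \<forall>vs\<in>?A. prod_E Gs us (\<psi> vs) \<longrightarrow> us = vs"
  proof (intro ballI impI)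
    fix us vs assume a: "us \<in> ?A" "vs \<in> ?A" "prod_E Gs us (\<psi> vs)"
    from a(3) obtain k where k: "k < length Gs" "snd (Gs ! k) (us ! k) (\<psi> vs ! k)"
      "\<And>j. j < length Gs \<Longrightarrow> j \<noteq> k \<Longrightarrow> \<psi> vs ! j = us ! j" by (rule prod_EE) blast
    \<comment> \<open>An edge in another coordinate would force \<open>us ! i\<close>, which is in
      \<open>A\<close>, to equal \<open>\<phi> (vs ! i)\<close>, which is not.\<close>
    have "k = i"
    proof (rule ccontr)
      assume "k \<noteq> i"
      then have "\<phi> (vs ! i) = us ! i" using k(3)[of i] a i by (simp add: nth)
      then show False using n(6)[of "vs ! i"] a by simp
    qed
    then have "us ! i = vs ! i" using k a n(9) by (simp add: nth)
    moreover have "us ! j = vs ! j" if "j < length Gs" "j \<noteq> i" for j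
      using k(3)[of j] a that \<open>k = i\<close> by (simp add: nth)
    ultimately show "us = vs" using a ext by blast
  qed
  ultimately show "\<exists>\<phi> A. mirror (prod_V Gs) (prod_E Gs) xs ys \<phi> A"
    unfolding mirror_def is_automorphism_def using bij adj inv
    by (intro exI[of _ \<psi>] exI[of _ ?A]) simp
qed

lemma prod_rtrancl:
  assumes "(a, b) \<in> (adj_rel (fst (Gs ! i)) (snd (Gs ! i)))\<^sup>*" "i < length Gs"
    "xs \<in> prod_V Gs" "xs ! i = a"
  shows "(xs, xs[i := b]) \<in> (adj_rel (prod_V Gs) (prod_E Gs))\<^sup>*"
  using assms(1)
proof induction
  case base
  then show ?case using assms by (metis list_update_id rtrancl.rtrancl_refl)
next
  case (step b c)
  then have *: "b \<in> fst (Gs ! i)" "c \<in> fst (Gs ! i)" "snd (Gs ! i) b c" by (auto simp: adj_rel_def)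
  have "xs[i := b] ! i = b" using assms by (simp add: prod_V_iff)
  then have "prod_E Gs (xs[i := b]) (xs[i := b, i := c])"
    using prod_E_update[OF prod_V_update[OF assms(3,2) *(1)] assms(2) *(2)] *(3) by simp
  then have "(xs[i := b], xs[i := c]) \<in> adj_rel (prod_V Gs) (prod_E Gs)"
    unfolding adj_rel_def prod_E_def by simp
  then show ?case using step.IH by simp
qed

lemma prod_connected:
  assumes "\<And>H. H \<in> set Gs \<Longrightarrow> connected_graph (fst H) (snd H)"
  shows "connected_graph (prod_V Gs) (prod_E Gs)"
  unfolding connected_graph_def
proof (intro conjI ballI)
  have "map (\<lambda>H. SOME v. v \<in> fst H) Gs \<in> prod_V Gs"
    using assms unfolding connected_graph_def prod_V_iff by (auto simp: some_in_eq)
  then show "prod_V Gs \<noteq> {}" by blast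
  fix us vs assume uv: "us \<in> prod_V Gs" "vs \<in> prod_V Gs"
  then have len: "length us = length Gs" "length vs = length Gs" by (auto simp: prod_V_iff)
  have "(us, take k vs @ drop k us) \<in> (adj_rel (prod_V Gs) (prod_E Gs))\<^sup>*" if "k \<le> length Gs" for k
    using that
  proof (induction k)
    case (Suc k)
    let ?ws = "take k vs @ drop k us"
    have k: "k < length Gs" using Suc by simp
    have "?ws \<in> prod_V Gs" using uv len k by (auto simp: prod_V_iff nth_append)
    moreover have "(us ! k, vs ! k) \<in> (adj_rel (fst (Gs ! k)) (snd (Gs ! k)))\<^sup>*"
      using assms[of "Gs ! k"] k uv by (auto simp: connected_graph_def prod_V_iff)
    moreover have "?ws ! k = us ! k" using len k by (simp add: nth_append)
    ultimately have "(?ws, ?ws[k := vs ! k]) \<in> (adj_rel (prod_V Gs) (prod_E Gs))\<^sup>*"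
      by (intro prod_rtrancl[OF _ k]) 
    moreover have "?ws[k := vs ! k] = take (Suc k) vs @ drop (Suc k) us"
      using len k by (intro nth_equalityI) (auto simp: nth_append nth_list_update)
    ultimately show ?case using Suc by (simp add: rtrancl_trans)
  qed simp
  from this[of "length Gs"] show "(us, vs) \<in> (adj_rel (prod_V Gs) (prod_E Gs))\<^sup>*" using len by simp
qed

lemma prod_simple:
  assumes "\<And>H. H \<in> set Gs \<Longrightarrow> simple_graph (fst H) (snd H)"
  shows "simple_graph (prod_V Gs) (prod_E Gs)"
proof -
  have s: "simple_graph (fst (Gs ! i)) (snd (Gs ! i))" if "i < length Gs" for i
    using assms that by simp
  show ?thesis
    unfolding simple_graph_def
  proof (intro conjI allI impI)
    fix us vs assume "prod_E Gs us vs"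
    then obtain i where i: "us \<in> prod_V Gs" "vs \<in> prod_V Gs" "i < length Gs"
      "snd (Gs ! i) (us ! i) (vs ! i)" "\<And>j. j < length Gs \<Longrightarrow> j \<noteq> i \<Longrightarrow> vs ! j = us ! j"
      by (rule prod_EE) blast
    then show "us \<in> prod_V Gs" "vs \<in> prod_V Gs" by auto
    have "snd (Gs ! i) (vs ! i) (us ! i)" using s i by (simp add: simple_graph_def)
    then show "prod_E Gs vs us" using i by (auto simp: prod_E_def)
  next
    fix us show "\<not> prod_E Gs us us" using s by (auto simp: prod_E_def simple_graph_def)
  qed
qed

lemma prod_mirror_graph:
  assumes "\<And>H. H \<in> set Gs \<Longrightarrow> mirror_graph (fst H) (snd H)"
  shows "mirror_graph (prod_V Gs) (prod_E Gs)"
  using assms prod_simple prod_connected prod_has_mirrors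
  unfolding mirror_graph_def conn_graph_def mirror_graph_axioms_def by blast

text \<open>A neighbour of \<open>ys\<close> changes one coordinate, and neighbours changing
  different coordinates are not adjacent. So the neighbourhood in a product is the disjoint union of
  the neighbourhoods in the factors, and any graph splitting into such pieces is isomorphic to
  it.\<close>

lemma prod_nbrs_iso:
  assumes Gs: "\<And>H. H \<in> set Gs \<Longrightarrow> simple_graph (fst H) (snd H)" and ys: "ys \<in> prod_V Gs"
    and N: "N = (\<Union>i<length Gs. C i)" 
    and cross: "\<And>i j u v. i < length Gs \<Longrightarrow> j < length Gs \<Longrightarrow> u \<in> C i \<Longrightarrow> v \<in> C j \<Longrightarrow> i \<noteq> j \<Longrightarrow>
      u \<noteq> v \<and> \<not> E u v"
    and iso: "\<And>i. i < length Gs \<Longrightarrow>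
      graph_iso (C i) E (nbrs (fst (Gs ! i)) (snd (Gs ! i)) (ys ! i)) (snd (Gs ! i))"
  shows "graph_iso N E (nbrs (prod_V Gs) (prod_E Gs) ys) (prod_E Gs)"
proof -
  let ?nb = "\<lambda>i. nbrs (fst (Gs ! i)) (snd (Gs ! i)) (ys ! i)"
  have "\<forall>i. \<exists>f. i < length Gs \<longrightarrow> bij_betw f (C i) (?nb i) \<and>
    (\<forall>u\<in>C i. \<forall>v\<in>C i. E u v \<longleftrightarrow> snd (Gs ! i) (f u) (f v))"
    using iso unfolding graph_iso_def by blast
  then obtain f where f: "\<And>i. i < length Gs \<Longrightarrow> bij_betw (f i) (C i) (?nb i)"
    "\<And>i u v. i < length Gs \<Longrightarrow> u \<in> C i \<Longrightarrow> v \<in> C i \<Longrightarrow> E u v \<longleftrightarrow> snd (Gs ! i) (f i u) (f i v)"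
    by metis
  have "\<forall>v. \<exists>i. v \<in> N \<longrightarrow> i < length Gs \<and> v \<in> C i" using N by blast
  then obtain k where k: "\<And>v. v \<in> N \<Longrightarrow> k v < length Gs" "\<And>v. v \<in> N \<Longrightarrow> v \<in> C (k v)" by metis
  have irr: "\<not> snd (Gs ! i) a a" if "i < length Gs" for i a
    using Gs[of "Gs ! i"] that by (auto simp: simple_graph_def)
  have fnb: "f (k v) v \<in> fst (Gs ! k v)" "snd (Gs ! k v) (ys ! k v) (f (k v) v)" "f (k v) v \<noteq> ys ! k v"
    if "v \<in> N" for v
  proof -
    have "f (k v) v \<in> ?nb (k v)" using bij_betwE[OF f(1)[OF k(1)[OF that]]] k[OF that] by blast
    then show "f (k v) v \<in> fst (Gs ! k v)" "snd (Gs ! k v) (ys ! k v) (f (k v) v)"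
      by (auto simp: nbrs_def)
    then show "f (k v) v \<noteq> ys ! k v" using irr k[OF that] by metis
  qed
  define g where "g v = ys[k v := f (k v) v]" for v
  have len: "length ys = length Gs" using ys by (simp add: prod_V_iff)
  have nth: "g v ! j = (if j = k v then f (k v) v else ys ! j)" if "v \<in> N" "j < length Gs" for v j
    using that len by (auto simp: g_def)
  have gV: "g v \<in> prod_V Gs" "prod_E Gs ys (g v)" if "v \<in> N" for v
    unfolding g_def 
    using prod_V_update[OF ys k(1) fnb(1)] prod_E_update[OF ys k(1) fnb(1,2)] that by auto
  have "inj_on g N"
  proof
    fix u v assume uv: "u \<in> N" "v \<in> N" "g u = g v"
    have eq: "k u = k v"
    proof (rule ccontr)
      assume "k u \<noteq> k v"
      then show False
        using nth[OF uv(1) k(1)[OF uv(1)]] nth[OF uv(2) k(1)[OF uv(1)]] uv(3) fnb(3)[OF uv(1)] by auto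
    qed
    then have "f (k v) u = f (k v) v"
      using nth[OF uv(1) k(1)[OF uv(1)]] nth[OF uv(2) k(1)[OF uv(2)]] uv by auto
    then show "u = v" using f(1)[OF k(1)[OF uv(2)]] k(2)[OF uv(1)] k(2)[OF uv(2)] eq
      by (auto simp: bij_betw_def inj_on_def)
  qed
  moreover have "g ` N = nbrs (prod_V Gs) (prod_E Gs) ys"
  proof
    show "g ` N \<subseteq> nbrs (prod_V Gs) (prod_E Gs) ys" using gV by (auto simp: nbrs_def)
    show "nbrs (prod_V Gs) (prod_E Gs) ys \<subseteq> g ` N"
    proof
      fix zs assume "zs \<in> nbrs (prod_V Gs) (prod_E Gs) ys"
      then have "prod_E Gs ys zs" by (simp add: nbrs_def)
      then obtain i where i: "zs \<in> prod_V Gs" "i < length Gs" "snd (Gs ! i) (ys ! i) (zs ! i)"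
        "\<And>j. j < length Gs \<Longrightarrow> j \<noteq> i \<Longrightarrow> zs ! j = ys ! j" by (rule prod_EE) blast
      then have "zs ! i \<in> ?nb i" by (simp add: prod_V_iff nbrs_def)
      then obtain v where v: "v \<in> C i" "zs ! i = f i v" using f(1)[OF i(2)] by (auto simp: bij_betw_def)
      have vN: "v \<in> N" using v i N by blast
      then have "k v = i" using cross[of "k v" i v v] k i v by blast
      then have "g v = zs" using i v nth[OF vN] gV[OF vN]
        by (intro nth_equalityI) (auto simp: prod_V_iff)
      then show "zs \<in> g ` N" using vN by blast
    qed
  qed
  moreover have "E u v \<longleftrightarrow> prod_E Gs (g u) (g v)" if uv: "u \<in> N" "v \<in> N" for u v
  proof (cases "k u = k v")
    case True
    have "prod_E Gs (g u) (g v) \<longleftrightarrow> snd (Gs ! k v) (f (k v) u) (f (k v) v)"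
    proof
      assume "prod_E Gs (g u) (g v)"
      then obtain i where "i < length Gs" "snd (Gs ! i) (g u ! i) (g v ! i)" by (rule prod_EE) blast
      then show "snd (Gs ! k v) (f (k v) u) (f (k v) v)"
        using nth uv True irr by (auto split: if_splits)
    next
      assume "snd (Gs ! k v) (f (k v) u) (f (k v) v)"
      then show "prod_E Gs (g u) (g v)" unfolding prod_E_def
        using gV uv k nth True by (intro conjI exI[of _ "k v"]) auto
    qed
    then show ?thesis using f(2)[of "k v" u v] k uv True by metis
  next
    case False
    then have "\<not> E u v" using cross k uv by metis
    moreover have "\<not> prod_E Gs (g u) (g v)"
    proof
      assume "prod_E Gs (g u) (g v)"
      then obtain i where i: "\<And>j. j < length Gs \<Longrightarrow> j \<noteq> i \<Longrightarrow> g v ! j = g u ! j" by (rule prod_EE) blast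
      have "g v ! k v \<noteq> g u ! k v" "g v ! k u \<noteq> g u ! k u"
        using nth uv k fnb False by metis+
      then have "k v = i" "k u = i" using i k uv by blast+
      then show False using False by simp
    qed
    ultimately show ?thesis by simp
  qed
  ultimately show ?thesis unfolding graph_iso_def bij_betw_def by blast
qed

section \<open>The basic graphs\<close>

lemma connected_by_descent:
  assumes "simple_graph V E" "v0 \<in> V"
    and "\<And>v. v \<in> V \<Longrightarrow> v \<noteq> v0 \<Longrightarrow> \<exists>w. E v w \<and> m w < (m v :: nat)"
  shows "connected_graph V E"
proof -
  have s: "E v w \<Longrightarrow> v \<in> V \<and> w \<in> V \<and> E w v" for v w using assms(1) unfolding simple_graph_def by blast
  have to: "(v, v0) \<in> (adj_rel V E)\<^sup>* \<and> (v0, v) \<in> (adj_rel V E)\<^sup>*" if "v \<in> V" for v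
    using that
  proof (induction "m v" arbitrary: v rule: less_induct)
    case less
    show ?case
    proof (cases "v = v0")
      case False
      then obtain w where "E v w" "m w < m v" using assms(3) less.prems by blast
      then have "(v, w) \<in> adj_rel V E" "(w, v) \<in> adj_rel V E"
        "(w, v0) \<in> (adj_rel V E)\<^sup>*" "(v0, w) \<in> (adj_rel V E)\<^sup>*"
        using less.hyps s by (auto simp: adj_rel_def)
      then show ?thesis by (meson converse_rtrancl_into_rtrancl rtrancl.rtrancl_into_rtrancl)
    qed simp
  qed
  then show ?thesis unfolding connected_graph_def using assms(2) by (meson empty_iff rtrancl_trans)
qed

text \<open>One implication for adjacency suffices, since \<open>\<phi>\<close> is its own
  inverse.\<close>

lemma mirrorI:
  assumes "\<And>v. v \<in> V \<Longrightarrow> \<phi> v \<in> V" "\<And>v. v \<in> V \<Longrightarrow> \<phi> (\<phi> v) = v"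
    and "\<And>u v. u \<in> V \<Longrightarrow> v \<in> V \<Longrightarrow> E u v \<Longrightarrow> E (\<phi> u) (\<phi> v)"
    and "A \<subseteq> V" "x \<in> A" "\<phi> x = y" "\<And>v. v \<in> A \<Longrightarrow> \<phi> v \<notin> A"
    and "\<And>v. v \<in> V \<Longrightarrow> v \<notin> A \<Longrightarrow> \<phi> v \<notin> A \<Longrightarrow> \<phi> v = v"
    and "\<And>v. v \<in> A \<Longrightarrow> E v (\<phi> v)" "\<And>u v. u \<in> A \<Longrightarrow> v \<in> A \<Longrightarrow> E u (\<phi> v) \<Longrightarrow> u = v"
  shows "mirror V E x y \<phi> A"
proof -
  have "bij_betw \<phi> V V" by (rule bij_betw_byWitness[of _ \<phi>]) (use assms(1,2) in auto)
  moreover have "E u v \<longleftrightarrow> E (\<phi> u) (\<phi> v)" if "u \<in> V" "v \<in> V" for u v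
    using assms(3)[OF that] assms(3)[of "\<phi> u" "\<phi> v"] assms(1,2) that by auto
  ultimately have aut: "is_automorphism V E \<phi>" unfolding is_automorphism_def by blast
  show ?thesis unfolding mirror_def
    by (intro conjI ballI impI) (rule aut assms; assumption?)+
qed

section \<open>Cocktail party graphs\<close>

lemma cp_simple: "simple_graph (cp_V k) (cp_E k)"
  by (auto simp: simple_graph_def cp_V_def cp_E_def)

lemma cp_diam2:
  assumes "k \<ge> 2"
  shows "diam2 (cp_V k) (cp_E k)"
  unfolding diam2_def
proof (intro ballI)
  fix u v assume uv: "u \<in> cp_V k" "v \<in> cp_V k"
  show "u = v \<or> cp_E k u v \<or> (\<exists>w\<in>cp_V k. cp_E k u w \<and> cp_E k w v)"
  proof (cases "u div 2 = v div 2")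
    case True
    define w where "w = (if u div 2 = 0 then 2 else 0 :: nat)"
    have "w \<in> cp_V k" "cp_E k u w" "cp_E k w v"
      using uv assms True by (auto simp: w_def cp_V_def cp_E_def)
    then show ?thesis by blast
  qed (use uv in \<open>auto simp: cp_V_def cp_E_def\<close>)
qed

lemma cp_has_mirrors: "has_mirrors (cp_V k) (cp_E k)"
  unfolding has_mirrors_def
proof (intro ballI impI)
  fix x y assume xy: "cp_E k x y"
  \<comment> \<open>\<open>p\<close> is the partner in the removed matching, \<open>c\<close> the
    index of the pair; all adjacency questions reduce to \<open>c\<close>.\<close>
  define p where "p u = (if even u then u + 1 else u - 1)" for u :: nat
  define c where "c u = u div 2" for u :: nat
  have p: "c (p u) = c u" "p u \<noteq> u" "p (p u) = u" for u
    by (auto simp: p_def c_def elim!: evenE oddE)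
  have cls: "c u = c v \<longleftrightarrow> u = v \<or> u = p v" for u v
    unfolding c_def by (cases "even u"; cases "even v") (auto simp: p_def elim!: evenE oddE)
  have V: "u \<in> cp_V k \<longleftrightarrow> c u < k" for u by (auto simp: cp_V_def c_def)
  have E: "cp_E k u v \<longleftrightarrow> c u < k \<and> c v < k \<and> c u \<noteq> c v" for u v
    by (auto simp: cp_E_def c_def)
  have ne: "c x \<noteq> c y" "c x < k" "c y < k" using xy by (auto simp: E)
  then have ne': "x \<noteq> y" "x \<noteq> p y" "y \<noteq> p x" "p x \<noteq> p y" using cls p by metis+
  have pxy: "p x \<noteq> x" "p y \<noteq> y" using p(2) by auto
  define \<phi> where "\<phi> u = (if u = x then y else if u = y then x else if u = p x then p y
    else if u = p y then p x else u)" for u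
  have c\<phi>: "c (\<phi> u) = (if c u = c x then c y else if c u = c y then c x else c u)" for u
    using cls[of u x] cls[of u y] ne p(1) unfolding \<phi>_def by auto
  \<comment> \<open>\<open>p y\<close> is on the side of \<open>x\<close>, being adjacent to
    \<open>x\<close> but not to \<open>y\<close>.\<close>
  have "mirror (cp_V k) (cp_E k) x y \<phi> {x, p y}"
  proof (rule mirrorI)
    fix u assume u: "u \<in> cp_V k"
    show "\<phi> u \<in> cp_V k" using u ne by (simp add: V c\<phi>)
    show "\<phi> (\<phi> u) = u" using ne' pxy by (simp add: \<phi>_def)
    show "u \<notin> {x, p y} \<Longrightarrow> \<phi> u \<notin> {x, p y} \<Longrightarrow> \<phi> u = u"
      using ne' pxy by (simp add: \<phi>_def split: if_splits)
  next
    fix u v assume "cp_E k u v"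
    then show "cp_E k (\<phi> u) (\<phi> v)" using ne by (auto simp: E c\<phi>)
  next
    show "{x, p y} \<subseteq> cp_V k" using ne p(1) by (simp add: V)
  next
    fix v assume "v \<in> {x, p y}"
    then have "v = x \<and> \<phi> v = y \<or> v = p y \<and> \<phi> v = p x" using ne' pxy by (auto simp: \<phi>_def)
    then show "\<phi> v \<notin> {x, p y}" "cp_E k v (\<phi> v)" using ne ne' pxy p(1) by (auto simp: E)
  next
    fix u v assume "u \<in> {x, p y}" "v \<in> {x, p y}" "cp_E k u (\<phi> v)"
    then show "u = v" using ne p(1) by (auto simp: E c\<phi>)
  qed (auto simp: \<phi>_def)
  then show "\<exists>\<phi> A. mirror (cp_V k) (cp_E k) x y \<phi> A" by blast
qed

text \<open>The bound ensures connectedness: CP(1) consists of two isolated vertices and CP(0) is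
  empty.\<close>

lemma cp_mirror_graph: "k \<ge> 2 \<Longrightarrow> mirror_graph (cp_V k) (cp_E k)"
  using cp_simple cp_has_mirrors diam2_connected[OF cp_diam2, of k]
  by unfold_locales (fastforce simp: cp_V_def lessThan_empty_iff)+

text \<open>Only 0 and its partner 1 are not neighbours of 0, hence the shift by 2.\<close>

lemma cp_nbrs: "graph_iso (cp_V k) (cp_E k) (nbrs (cp_V (Suc k)) (cp_E (Suc k)) 0) (cp_E (Suc k))"
proof -
  have "v \<in> (\<lambda>v. v + 2) ` {..<2 * k}" if "v < 2 * Suc k" "0 < v div 2" for v :: nat
    by (rule image_eqI[of _ _ "v - 2"]) (use that in auto)
  then have "bij_betw (\<lambda>v. v + 2) (cp_V k) (nbrs (cp_V (Suc k)) (cp_E (Suc k)) 0)"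
    by (auto simp: bij_betw_def inj_on_def nbrs_def cp_V_def cp_E_def)
  then show ?thesis unfolding graph_iso_def by (intro exI[of _ "\<lambda>v. v + 2"]) (auto simp: cp_E_def)
qed

section \<open>Johnson graphs\<close>

lemma johnson_finite: "finite (johnson_V n k)" "U \<in> johnson_V n k \<Longrightarrow> finite U"
  by (auto simp: johnson_V_def intro: finite_subset)

lemma johnson_simple: "simple_graph (johnson_V n k) (johnson_E n k)"
  by (auto simp: simple_graph_def johnson_E_def johnson_V_def Int_commute)

lemma exchange:
  assumes "finite U" "finite W" "card U = card W" "U \<noteq> W"
  obtains i j where "i \<in> U" "i \<notin> W" "j \<in> W" "j \<notin> U"
proof -
  have "\<not> U \<subseteq> W" "\<not> W \<subseteq> U" using assms card_subset_eq by metis+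
  then show thesis using that by blast
qed

lemma exchange_unique:
  assumes "finite U" "finite W" "card U = card W" "card (U \<inter> W) + 1 = card U"
  obtains i j where "i \<in> U" "i \<notin> W" "j \<in> W" "j \<notin> U" "W = insert j (U - {i})"
proof -
  have "card (U - W) = 1" "card (W - U) = 1"
    using assms card_Diff_subset_Int[of U W] card_Diff_subset_Int[of W U] by (simp_all add: Int_commute)
  then obtain i j where ij: "U - W = {i}" "W - U = {j}" by (metis card_1_singletonE)
  then have "W = insert j (U - {i})" by blast
  then show thesis using that ij by blast
qed

lemma card_exchange:
  assumes "finite U" "i \<in> U" "j \<notin> U"
  shows "card (insert j (U - {i})) = card U" "card (U \<inter> insert j (U - {i})) + 1 = card U"
proof -
  have "card U > 0" using assms card_gt_0_iff by blast
  moreover have "U \<inter> insert j (U - {i}) = U - {i}" using assms by blast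
  ultimately show "card (insert j (U - {i})) = card U" "card (U \<inter> insert j (U - {i})) + 1 = card U"
    using assms by simp_all
qed

lemma johnson_connected:
  assumes "k \<le> n"
  shows "connected_graph (johnson_V n k) (johnson_E n k)"
proof (rule connected_by_descent[OF johnson_simple, of "{..<k}" _ _ "\<lambda>U. card (U - {..<k})"])
  show "{..<k} \<in> johnson_V n k" using assms by (auto simp: johnson_V_def)
  fix U assume U: "U \<in> johnson_V n k" "U \<noteq> {..<k}"
  then have fin: "finite U" by (simp add: johnson_finite)
  obtain i j where ij: "i \<in> U" "i \<notin> {..<k}" "j \<in> {..<k}" "j \<notin> U"
    using exchange[of U "{..<k}"] U fin by (auto simp: johnson_V_def)
  let ?W = "insert j (U - {i})"
  have "johnson_E n k U ?W" using U ij assms card_exchange[OF fin ij(1,4)]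
    by (auto simp: johnson_E_def johnson_V_def)
  moreover have "?W - {..<k} = (U - {..<k}) - {i}" using ij by auto
  then have "card (?W - {..<k}) < card (U - {..<k})" using ij fin
    by (metis DiffI card_Diff1_less finite_Diff)
  ultimately show "\<exists>w. johnson_E n k U w \<and> card (w - {..<k}) < card (U - {..<k})" by blast
qed

definition swp :: "nat \<Rightarrow> nat \<Rightarrow> nat \<Rightarrow> nat" where
  "swp i j = id(i := j, j := i)"

lemma swp: "swp i j (swp i j a) = a" "inj (swp i j)" 
  by (auto simp: swp_def inj_on_def)

lemma swp_image:
  "swp i j ` U = (if i \<in> U \<and> j \<notin> U then insert j (U - {i}) else
     if j \<in> U \<and> i \<notin> U then insert i (U - {j}) else U)"
  by (auto simp: swp_def image_def split: if_splits)

lemma swp_image_image: "swp i j ` swp i j ` U = U"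
  by (simp add: image_image swp)

lemma card_swp: "card (swp i j ` U) = card U" "card (swp i j ` U \<inter> swp i j ` W) = card (U \<inter> W)"
  using swp(2) by (auto simp: card_image inj_on_def image_Int[symmetric])

lemma swp_subset: "i < n \<Longrightarrow> j < n \<Longrightarrow> U \<subseteq> {..<n} \<Longrightarrow> swp i j ` U \<subseteq> {..<n}"
  by (auto simp: swp_def)

text \<open>The transposition removes \<open>i\<close> from \<open>W\<close>, so the intersection is
  contained in \<open>U - {i}\<close> and, by its size, fills it; this forces \<open>U - {i}\<close>
  into \<open>W\<close>.\<close>

lemma swp_cross:
  assumes "finite U" "finite W" "i \<in> U" "j \<notin> U" "i \<in> W" "j \<notin> W" "card U = card W"
    "card (U \<inter> swp i j ` W) + 1 = card U"
  shows "U = W"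
proof -
  have "U \<inter> swp i j ` W = (U - {i}) \<inter> (W - {i})" using assms by (auto simp: swp_image)
  then have "card ((U - {i}) \<inter> (W - {i})) = card (U - {i})" using assms by simp
  then have "U - {i} \<subseteq> W - {i}" using assms by (metis card_subset_eq finite_Diff inf.cobounded1 inf_le2)
  then have "U \<subseteq> W" using assms by blast
  then show ?thesis using assms card_subset_eq by blast
qed

text \<open>An edge exchanges an element \<open>i\<close> for an element \<open>j\<close>. The
  mirror is the transposition of the two, the reflection in the root e_j - e_i of type A.\<close>

lemma johnson_has_mirrors: "has_mirrors (johnson_V n k) (johnson_E n k)"
  unfolding has_mirrors_def
proof (intro ballI impI)
  fix S T assume e: "johnson_E n k S T"
  then have ST: "finite S" "finite T" "card S = k" "card T = k" "S \<subseteq> {..<n}" "T \<subseteq> {..<n}"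
    using johnson_finite(2)[of S n k] johnson_finite(2)[of T n k] by (auto simp: johnson_E_def johnson_V_def)
  then obtain i j where ij: "i \<in> S" "i \<notin> T" "j \<in> T" "j \<notin> S" "T = insert j (S - {i})"
    using exchange_unique[of S T] e unfolding johnson_E_def by metis
  then have n: "i < n" "j < n" using ST by auto
  let ?A = "{U \<in> johnson_V n k. i \<in> U \<and> j \<notin> U}"
  have "mirror (johnson_V n k) (johnson_E n k) S T (\<lambda>U. swp i j ` U) ?A"
  proof (rule mirrorI)
    fix U assume "U \<in> johnson_V n k"
    then show "swp i j ` U \<in> johnson_V n k" using swp_subset n by (simp add: johnson_V_def card_swp)
    then show "U \<notin> ?A \<Longrightarrow> swp i j ` U \<notin> ?A \<Longrightarrow> swp i j ` U = U" 
      using \<open>U \<in> johnson_V n k\<close> by (auto simp: swp_image split: if_splits)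
  next
    fix U W assume "johnson_E n k U W"
    then show "johnson_E n k (swp i j ` U) (swp i j ` W)"
      using swp_subset n by (simp add: johnson_E_def johnson_V_def card_swp)
  next
    fix U assume U: "U \<in> ?A"
    show "swp i j ` U \<notin> ?A" using U by (auto simp: swp_image)
    have "swp i j ` U = insert j (U - {i})" using U by (simp add: swp_image)
    then show "johnson_E n k U (swp i j ` U)"
      using U card_exchange[of U i j] n johnson_finite(2)[of U n k] by (auto simp: johnson_E_def johnson_V_def)
  next
    fix U W assume "U \<in> ?A" "W \<in> ?A" "johnson_E n k U (swp i j ` W)"
    then show "U = W" using swp_cross[of U W i j] johnson_finite(2)[of U n k] johnson_finite(2)[of W n k]
      by (auto simp: johnson_E_def johnson_V_def)
  next
    show "S \<in> ?A" using ST ij by (auto simp: johnson_V_def)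
    show "swp i j ` S = T" using ij by (simp add: swp_image)
  qed (auto simp: swp_image_image)
  then show "\<exists>\<phi> A. mirror (johnson_V n k) (johnson_E n k) S T \<phi> A" by blast
qed

lemma johnson_mirror_graph: "k \<le> n \<Longrightarrow> mirror_graph (johnson_V n k) (johnson_E n k)"
  using johnson_simple johnson_has_mirrors johnson_connected by unfold_locales auto

text \<open>The cartesian product of two complete graphs: the inequality of truth values says that
  exactly one coordinate changes.\<close>

definition rook_E :: "'a \<times> 'b \<Rightarrow> 'a \<times> 'b \<Rightarrow> bool" where
  "rook_E p q \<longleftrightarrow> (fst p = fst q) \<noteq> (snd p = snd q)"

text \<open>A neighbour arises by removing one of the \<open>card A\<close> elements and adding one
  of the \<open>card B\<close> others, so it is a pair of choices. Two neighbours are adjacent iff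
  they agree in exactly one of the choices.\<close>

lemma johnson_nbrs:
  assumes "finite A" "finite B"
  shows "graph_iso (A \<times> B) rook_E 
    (nbrs (johnson_V (card A + card B) (card A)) (johnson_E (card A + card B) (card A)) {..<card A})
    (johnson_E (card A + card B) (card A))"
proof -
  define a b where "a = card A" and "b = card B"
  obtain f where f: "bij_betw f A {..<a}" 
    using ex_bij_betw_finite_nat[OF assms(1)] by (auto simp: a_def lessThan_atLeast0)
  have "card {a..<a + b} = card B" by (simp add: b_def)
  then obtain g where g: "bij_betw g B {a..<a + b}" 
    using finite_same_card_bij[OF assms(2)] by (metis finite_atLeastLessThan)
  have fA: "f p < a" if "p \<in> A" for p using f that by (auto simp: bij_betw_def)
  have gB: "a \<le> g q" "g q < a + b" if "q \<in> B" for q using g that by (auto simp: bij_betw_def)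
  have finj: "f p = f p' \<longleftrightarrow> p = p'" if "p \<in> A" "p' \<in> A" for p p'
    using f that by (auto simp: bij_betw_def inj_on_def)
  have ginj: "g p = g p' \<longleftrightarrow> p = p'" if "p \<in> B" "p' \<in> B" for p p'
    using g that by (auto simp: bij_betw_def inj_on_def)
  define h where "h = (\<lambda>(p, q). insert (g q) ({..<a} - {f p}))"
  let ?N = "nbrs (johnson_V (a + b) a) (johnson_E (a + b) a) {..<a}"
  have hN: "h (p, q) \<in> ?N" if "p \<in> A" "q \<in> B" for p q
    using that fA gB[of q] card_exchange[of "{..<a}" "f p" "g q"]
    by (auto simp: h_def nbrs_def johnson_E_def johnson_V_def)
  have diff: "{..<a} - h (p, q) = {f p}" "h (p, q) - {..<a} = {g q}" if "p \<in> A" "q \<in> B" for p q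
    using that fA[of p] gB[of q] by (auto simp: h_def)
  have "inj_on h (A \<times> B)"
  proof (rule inj_onI, clarify)
    fix p q p' q' assume pq: "p \<in> A" "q \<in> B" "p' \<in> A" "q' \<in> B" "h (p, q) = h (p', q')"
    then have "{f p} = {f p'}" "{g q} = {g q'}" using diff by metis+
    then show "p = p' \<and> q = q'" using finj ginj pq by simp
  qed
  moreover have "h ` (A \<times> B) = ?N"
  proof
    show "h ` (A \<times> B) \<subseteq> ?N" using hN by auto
    show "?N \<subseteq> h ` (A \<times> B)"
    proof
      fix W assume W: "W \<in> ?N"
      then have W': "W \<subseteq> {..<a + b}" "card W = a" "card ({..<a} \<inter> W) + 1 = a" "finite W"
        by (auto simp: nbrs_def johnson_E_def johnson_V_def intro: finite_subset)
      then obtain i j where ij: "i \<in> {..<a}" "i \<notin> W" "j \<in> W" "j \<notin> {..<a}" "W = insert j ({..<a} - {i})"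
        using exchange_unique[of "{..<a}" W] by auto
      then have "i \<in> f ` A" "j \<in> g ` B" using f g W' by (auto simp: bij_betw_def)
      then show "W \<in> h ` (A \<times> B)" using ij(5) by (force simp: h_def)
    qed
  qed
  moreover have "rook_E r s \<longleftrightarrow> johnson_E (a + b) a (h r) (h s)" if "r \<in> A \<times> B" "s \<in> A \<times> B" for r s
  proof -
    obtain p q p' q' where rs: "r = (p, q)" "s = (p', q')" by fastforce
    then have pq: "p \<in> A" "q \<in> B" "p' \<in> A" "q' \<in> B" using that by auto
    have "h r \<inter> h s = ({..<a} - {f p, f p'}) \<union> ({g q} \<inter> {g q'})" 
      using pq fA[of p] fA[of p'] gB[of q] gB[of q'] by (auto simp: h_def rs)
    moreover have "card (({..<a} - {f p, f p'}) \<union> ({g q} \<inter> {g q'})) = 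
        card ({..<a} - {f p, f p'}) + card ({g q} \<inter> {g q'})"
      using pq gB[of q] by (intro card_Un_disjoint) auto
    moreover have "card ({..<a} - {f p, f p'}) = a - card {f p, f p'}"
      using pq fA by (subst card_Diff_subset) auto
    moreover have "card {f p, f p'} \<le> a"
      using pq fA card_mono[of "{..<a}" "{f p, f p'}"] by simp
    moreover have "card {f p, f p'} = (if p = p' then 1 else 2)"
      "card ({g q} \<inter> {g q'}) = (if q = q' then 1 else 0)" using finj ginj pq by auto
    ultimately have "card (h r \<inter> h s) + 1 = a \<longleftrightarrow> rook_E r s"
      by (cases "p = p'"; cases "q = q'") (simp_all add: rs rook_E_def)
    moreover have "h r \<in> johnson_V (a + b) a" "h s \<in> johnson_V (a + b) a"
      using hN pq rs by (auto simp: nbrs_def)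
    ultimately show ?thesis by (simp add: johnson_E_def)
  qed
  ultimately show ?thesis unfolding graph_iso_def bij_betw_def a_def b_def by blast
qed

text \<open>Used to bring a Johnson graph of diameter at most two into the form with
  \<open>k \<le> 2\<close>.\<close>

lemma johnson_complement:
  assumes "k \<le> n"
  shows "graph_iso (johnson_V n k) (johnson_E n k) (johnson_V n (n - k)) (johnson_E n (n - k))"
proof -
  let ?c = "\<lambda>U. {..<n} - U"
  have V: "?c U \<in> johnson_V n (n - k)" if "U \<in> johnson_V n k" for U k
    using that by (auto simp: johnson_V_def card_Diff_subset finite_subset)
  have bij: "bij_betw ?c (johnson_V n k) (johnson_V n (n - k))"
    by (rule bij_betw_byWitness[of _ ?c])
      (use V[of _ k] V[of _ "n - k"] assms in \<open>auto simp: johnson_V_def\<close>)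
  have "johnson_E n k U W \<longleftrightarrow> johnson_E n (n - k) (?c U) (?c W)"
    if "U \<in> johnson_V n k" "W \<in> johnson_V n k" for U W
  proof -
    have fin: "finite U" "finite W" using that johnson_finite by auto
    have sub: "U \<union> W \<subseteq> {..<n}" "card U = k" "card W = k" using that by (auto simp: johnson_V_def)
    have "?c U \<inter> ?c W = {..<n} - (U \<union> W)" by blast
    then have "card (?c U \<inter> ?c W) = n - card (U \<union> W)" using card_Diff_subset[of "U \<union> W" "{..<n}"] sub fin by simp
    moreover have "card (U \<union> W) + card (U \<inter> W) = k + k" using card_Un_Int[OF fin] sub by simp
    moreover have "card (U \<union> W) \<le> n" using card_mono[OF _ sub(1)] by simp
    moreover have "card (U \<inter> W) \<le> k" using card_mono[of U "U \<inter> W"] fin sub by simp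
    ultimately have "card (U \<inter> W) + 1 = k \<longleftrightarrow> card (?c U \<inter> ?c W) + 1 = n - k" 
      using assms by linarith
    then show ?thesis using that V by (simp add: johnson_E_def)
  qed
  then show ?thesis unfolding graph_iso_def using bij by blast
qed

text \<open>The sets \<open>{..<k}\<close> and \<open>{3..<k + 3}\<close> share k - 3 elements. A
  common neighbour contains k - 1 elements of each, hence at least (k - 1) + (k - 1) - (k - 3) = k +
  1 elements.\<close>

lemma johnson_not_diam2:
  assumes "k \<ge> 3" "n \<ge> k + 3"
  shows "\<not> diam2 (johnson_V n k) (johnson_E n k)"
proof
  assume diam: "diam2 (johnson_V n k) (johnson_E n k)"
  let ?U = "{..<k}" and ?W = "{3..<k + 3}"
  have "?U \<inter> ?W = {3..<k}" by auto
  then have int: "card (?U \<inter> ?W) = k - 3" by simp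
  have "?U \<in> johnson_V n k" "?W \<in> johnson_V n k" using assms by (auto simp: johnson_V_def)
  moreover have "0 \<in> ?U" "0 \<notin> ?W" using assms by auto
  then have "?U \<noteq> ?W" by metis
  moreover have "\<not> johnson_E n k ?U ?W" unfolding johnson_E_def int using assms by linarith
  ultimately obtain X where X: "X \<in> johnson_V n k" "johnson_E n k ?U X" "johnson_E n k X ?W"
    using diam2D[OF diam] by blast
  have finX: "finite X" and cX: "card X = k"
    using johnson_finite(2)[OF X(1)] X(1) by (simp_all add: johnson_V_def)
  have "card (X \<inter> ?U) + card (X \<inter> ?W) = card ((X \<inter> ?U) \<union> (X \<inter> ?W)) + card ((X \<inter> ?U) \<inter> (X \<inter> ?W))"
    using finX by (intro card_Un_Int) auto
  moreover have "card ((X \<inter> ?U) \<union> (X \<inter> ?W)) \<le> k" using card_mono[OF finX, of "(X \<inter> ?U) \<union> (X \<inter> ?W)"] cX by auto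
  moreover have "card ((X \<inter> ?U) \<inter> (X \<inter> ?W)) \<le> card (?U \<inter> ?W)" by (intro card_mono) auto
  moreover have "card (X \<inter> ?U) + 1 = k" "card (X \<inter> ?W) + 1 = k"
    using X(2,3) by (simp_all add: johnson_E_def Int_commute)
  ultimately show False using int assms by linarith
qed

section \<open>Halved cubes\<close>

definition symd :: "'a set \<Rightarrow> 'a set \<Rightarrow> 'a set" where
  "symd A B = (A - B) \<union> (B - A)"

text \<open>A binary string is replaced by its support.\<close>
definition even_sets :: "nat \<Rightarrow> nat set set" where
  "even_sets n = {S. S \<subseteq> {..<n} \<and> even (card S)}"

definition even_E :: "nat \<Rightarrow> nat set \<Rightarrow> nat set \<Rightarrow> bool" where
  "even_E n S T \<longleftrightarrow> S \<in> even_sets n \<and> T \<in> even_sets n \<and> card (symd S T) = 2"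

lemma even_sets_finite: "finite (even_sets n)" "U \<in> even_sets n \<Longrightarrow> finite U"
  by (auto simp: even_sets_def intro: finite_subset)

lemma card_symd:
  assumes "finite A" "finite B"
  shows "card (symd A B) + 2 * card (A \<inter> B) = card A + card B"
proof -
  have "card (symd A B) = card (A - B) + card (B - A)"
    unfolding symd_def using assms by (intro card_Un_disjoint) auto
  moreover have "card A = card (A - B) + card (A \<inter> B)" "card B = card (B - A) + card (A \<inter> B)"
    using assms card_Int_Diff[of A B] card_Int_Diff[of B A] by (simp_all add: Int_commute)
  ultimately show ?thesis by simp
qed

lemma even_card_symd:
  assumes "finite A" "finite B"
  shows "even (card (symd A B)) \<longleftrightarrow> (even (card A) \<longleftrightarrow> even (card B))"
proof -
  have "even (card (symd A B)) \<longleftrightarrow> even (card (symd A B) + 2 * card (A \<inter> B))" by simp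
  then show ?thesis by (simp add: card_symd[OF assms])
qed

lemma halved_iso: "graph_iso (halved_V n) (halved_E n) (even_sets n) (even_E n)"
proof -
  define f where "f xs = {i. i < n \<and> xs ! i}" for xs
  have V: "f xs \<in> even_sets n" if "xs \<in> halved_V n" for xs
    using that by (auto simp: f_def even_sets_def halved_V_def length_filter_conv_card)
  have "bij_betw f (halved_V n) (even_sets n)"
  proof (rule bij_betw_byWitness[of _ "\<lambda>S. map (\<lambda>i. i \<in> S) [0..<n]"])
    show "\<forall>xs\<in>halved_V n. map (\<lambda>i. i \<in> f xs) [0..<n] = xs"
      by (auto simp: halved_V_def f_def intro: nth_equalityI)
    show "\<forall>S\<in>even_sets n. f (map (\<lambda>i. i \<in> S) [0..<n]) = S"
      by (auto simp: even_sets_def f_def)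
    show "f ` halved_V n \<subseteq> even_sets n" using V by blast
    have "{i. i < n \<and> i \<in> S} = S" if "S \<subseteq> {..<n}" for S using that by auto
    then show "(\<lambda>S. map (\<lambda>i. i \<in> S) [0..<n]) ` even_sets n \<subseteq> halved_V n"
      by (auto simp: halved_V_def even_sets_def length_filter_conv_card cong: conj_cong)
  qed
  moreover have "halved_E n xs ys \<longleftrightarrow> even_E n (f xs) (f ys)" if "xs \<in> halved_V n" "ys \<in> halved_V n" for xs ys
  proof -
    have "symd (f xs) (f ys) = {i. i < n \<and> xs ! i \<noteq> ys ! i}" by (auto simp: f_def symd_def)
    then show ?thesis using that V by (simp add: halved_E_def even_E_def)
  qed
  ultimately show ?thesis unfolding graph_iso_def by blast
qed

lemma symd_commute: "symd S T = symd T S"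
  by (auto simp: symd_def)

lemma even_simple: "simple_graph (even_sets n) (even_E n)"
  by (auto simp: simple_graph_def even_E_def symd_commute) (simp add: symd_def)

lemma even_connected: "connected_graph (even_sets n) (even_E n)"
proof (rule connected_by_descent[OF even_simple, of "{}" _ card])
  show "{} \<in> even_sets n" by (simp add: even_sets_def)
  fix U assume U: "U \<in> even_sets n" "U \<noteq> {}"
  then have fin: "finite U" using even_sets_finite by blast
  obtain i where i: "i \<in> U" using U by blast
  have "U \<noteq> {i}" using U by (auto simp: even_sets_def)
  then obtain j where j: "j \<in> U" "j \<noteq> i" using i by blast
  have sub: "{i, j} \<subseteq> U" using i j by simp
  have card: "card (U - {i, j}) = card U - 2" "card U \<ge> 2"
    using card_Diff_subset[OF _ sub] card_mono[OF fin sub] j by auto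
  have "symd U (U - {i, j}) = {i, j}" using sub by (auto simp: symd_def)
  then have "even_E n U (U - {i, j})" using U card j by (auto simp: even_E_def even_sets_def)
  then show "\<exists>W. even_E n U W \<and> card W < card U" using card by (intro exI[of _ "U - {i, j}"]) simp
qed

lemma card_symd_pair:
  assumes "finite W" "(i \<in> W) \<noteq> (j \<in> W)"
  shows "card (symd W {i, j}) = card W"
proof (cases "i \<in> W")
  case True
  then have "symd W {i, j} = insert j (W - {i})" using assms by (auto simp: symd_def)
  then show ?thesis using card_exchange(1)[OF assms(1) True, of j] True assms by simp
next
  case False
  then have "j \<in> W" using assms by blast
  then have "symd W {i, j} = insert i (W - {j})" using False by (auto simp: symd_def)
  then show ?thesis using card_exchange(1)[OF assms(1) \<open>j \<in> W\<close>, of i] False assms by simp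
qed

text \<open>An edge flips two bits \<open>i\<close> and \<open>j\<close>. The mirror flips both bits
  of the sets that agree with \<open>S\<close> at both places or at neither, and fixes the others.
  In sign vectors this is the reflection in a root \<plusminus>e_i \<plusminus> e_j of type
  D.\<close>

lemma even_has_mirrors: "has_mirrors (even_sets n) (even_E n)"
  unfolding has_mirrors_def
proof (intro ballI impI)
  fix S T assume e: "even_E n S T"
  then have ST: "S \<in> even_sets n" "T \<in> even_sets n" by (auto simp: even_E_def)
  have "card (symd S T) = 2" using e by (simp add: even_E_def)
  then obtain i j where ij: "symd S T = {i, j}" "i \<noteq> j" by (auto simp: card_2_iff)
  have T: "T = symd S {i, j}" unfolding ij(1)[symmetric] by (auto simp: symd_def)
  have n: "{i, j} \<subseteq> {..<n}" unfolding ij(1)[symmetric] using ST by (auto simp: even_sets_def symd_def)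
  define flip where "flip U \<longleftrightarrow> ((i \<in> U) = (i \<in> S)) = ((j \<in> U) = (j \<in> S))" for U
  define \<phi> where "\<phi> U = (if flip U then symd U {i, j} else U)" for U
  have mem: "i \<in> symd U {i, j} \<longleftrightarrow> i \<notin> U" "j \<in> symd U {i, j} \<longleftrightarrow> j \<notin> U" for U
    by (auto simp: symd_def)
  have flip: "flip (symd U {i, j}) = flip U" for U using mem by (auto simp: flip_def)
  have V: "symd U {i, j} \<in> even_sets n" if "U \<in> even_sets n" for U
    using that n ij(2) even_card_symd[of U "{i, j}"] even_sets_finite(2)[OF that]
    by (auto simp: even_sets_def symd_def)
  have \<phi>V: "\<phi> U \<in> even_sets n" if "U \<in> even_sets n" for U using V that by (simp add: \<phi>_def)
  let ?A = "{U \<in> even_sets n. (i \<in> U) = (i \<in> S) \<and> (j \<in> U) = (j \<in> S)}"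
  have A: "flip U" if "U \<in> ?A" for U using that by (simp add: flip_def)
  \<comment> \<open>\<open>U\<close> and \<open>W\<close> differ in exactly one of the two bits, and
    after flipping both bits of \<open>U\<close> they differ in the other one instead.\<close>
  have card: "card (symd (symd U {i, j}) W) = card (symd U W)"
    if "flip U" "\<not> flip W" "U \<in> even_sets n" "W \<in> even_sets n" for U W
  proof -
    have "symd (symd U {i, j}) W = symd (symd U W) {i, j}" by (auto simp: symd_def)
    moreover have "(i \<in> symd U W) \<noteq> (j \<in> symd U W)" using that by (auto simp: flip_def symd_def)
    moreover have "finite (symd U W)" using that even_sets_finite by (auto simp: symd_def)
    ultimately show ?thesis using card_symd_pair by simp
  qed
  have "mirror (even_sets n) (even_E n) S T \<phi> ?A"
  proof (rule mirrorI)
    fix U assume U: "U \<in> even_sets n"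
    show "\<phi> U \<in> even_sets n" using \<phi>V U .
    have "symd (symd U {i, j}) {i, j} = U" by (auto simp: symd_def)
    then show "\<phi> (\<phi> U) = U" by (simp add: \<phi>_def flip)
    assume "U \<notin> ?A" "\<phi> U \<notin> ?A"
    then have "\<not> flip U" using U \<phi>V[OF U] mem unfolding \<phi>_def flip_def by (auto split: if_splits)
    then show "\<phi> U = U" by (simp add: \<phi>_def)
  next
    fix U W assume UW: "even_E n U W"
    then have V': "U \<in> even_sets n" "W \<in> even_sets n" by (auto simp: even_E_def)
    have "symd (symd U {i, j}) (symd W {i, j}) = symd U W" by (auto simp: symd_def)
    moreover have "card (symd U (symd W {i, j})) = card (symd U W)" if "flip W" "\<not> flip U"
      using card[OF that V'(2,1)] symd_commute by metis
    ultimately have "card (symd (\<phi> U) (\<phi> W)) = card (symd U W)"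
      using card[OF _ _ V'] by (simp add: \<phi>_def)
    then show "even_E n (\<phi> U) (\<phi> W)" using UW \<phi>V by (simp add: even_E_def)
  next
    fix U assume U: "U \<in> ?A"
    then have \<phi>: "\<phi> U = symd U {i, j}" using A by (simp add: \<phi>_def)
    then show "\<phi> U \<notin> ?A" using mem U by auto
    have "symd U (symd U {i, j}) = {i, j}" by (auto simp: symd_def)
    then show "even_E n U (\<phi> U)" using \<phi> U V ij(2) by (auto simp: even_E_def)
  next
    fix U W assume UW: "U \<in> ?A" "W \<in> ?A" "even_E n U (\<phi> W)"
    then have "card (symd U (symd W {i, j})) = 2" using A[of W] by (simp add: \<phi>_def even_E_def)
    \<comment> \<open>Sets of the half space agree at \<open>i\<close> and \<open>j\<close>, so
      these two bits alone already account for the distance 2.\<close>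
    moreover have "symd U (symd W {i, j}) = symd U W \<union> {i, j}" using UW by (auto simp: symd_def)
    moreover have "card (symd U W \<union> {i, j}) = card (symd U W) + card {i, j}"
      using UW even_sets_finite by (intro card_Un_disjoint) (auto simp: symd_def)
    ultimately have "card (symd U W) = 0" using ij(2) by simp
    moreover have "finite (symd U W)" using UW even_sets_finite by (auto simp: symd_def)
    ultimately have "symd U W = {}" by simp
    then show "U = W" by (auto simp: symd_def)
  next
    show "S \<in> ?A" using ST by simp
    show "\<phi> S = T" using T by (simp add: \<phi>_def flip_def)
  qed auto
  then show "\<exists>\<phi> A. mirror (even_sets n) (even_E n) S T \<phi> A" by blast
qed

lemma even_mirror_graph: "mirror_graph (even_sets n) (even_E n)"
  using even_simple even_connected even_has_mirrors by unfold_locales auto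

lemma even_nbrs: "graph_iso (johnson_V n 2) (johnson_E n 2) (nbrs (even_sets n) (even_E n) {}) (even_E n)"
proof -
  have "nbrs (even_sets n) (even_E n) {} = johnson_V n 2"
    by (auto simp: nbrs_def even_E_def even_sets_def johnson_V_def symd_def)
  moreover have "johnson_E n 2 S T \<longleftrightarrow> even_E n S T" if "S \<in> johnson_V n 2" "T \<in> johnson_V n 2" for S T
    using that card_symd[of S T] johnson_finite(2)[OF that(1)] johnson_finite(2)[OF that(2)]
    by (auto simp: johnson_E_def johnson_V_def even_E_def even_sets_def)
  ultimately show ?thesis unfolding graph_iso_def by (intro exI[of _ id]) auto
qed

text \<open>Distinct even sets differ in a positive even number of places, and at most three places
  are available.\<close>

lemma even_complete:
  assumes "n \<le> 3" "S \<in> even_sets n" "T \<in> even_sets n"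
  shows "even_E n S T \<longleftrightarrow> S \<noteq> T"
proof
  assume ne: "S \<noteq> T"
  have fin: "finite S" "finite T" using assms even_sets_finite by auto
  have "even (card (symd S T))" using even_card_symd[OF fin] assms by (simp add: even_sets_def)
  moreover have "card (symd S T) \<noteq> 0" using ne fin by (auto simp: symd_def)
  moreover have "card (symd S T) \<le> card {..<n}"
    using assms by (intro card_mono) (auto simp: symd_def even_sets_def)
  ultimately have "card (symd S T) = 2" using assms(1) by (auto elim!: evenE)
  then show "even_E n S T" using assms by (simp add: even_E_def)
qed (auto simp: even_E_def symd_def)

text \<open>Sets that differ in six elements need three steps, each of which changes two.\<close>

lemma even_not_diam2:
  assumes "n \<ge> 6"
  shows "\<not> diam2 (even_sets n) (even_E n)"
proof
  assume diam: "diam2 (even_sets n) (even_E n)"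
  have "{} \<in> even_sets n" "{..<6} \<in> even_sets n" using assms by (auto simp: even_sets_def)
  moreover have "\<not> even_E n {} {..<6}" by (simp add: even_E_def symd_def)
  moreover have "(0::nat) \<in> {..<6}" by simp
  then have "{} \<noteq> {..<6 :: nat}" by blast
  ultimately obtain W where W: "W \<in> even_sets n" "even_E n {} W" "even_E n W {..<6}"
    using diam2D[OF diam] by metis
  have fin: "finite W" using W even_sets_finite by blast
  have "card W = 2" using W(2) by (simp add: even_E_def symd_def)
  moreover have "card (symd W {..<6}) = 2" using W(3) by (simp add: even_E_def)
  moreover have "card {..<6::nat} \<le> card (W \<union> symd W {..<6})"
    using fin by (intro card_mono) (auto simp: symd_def)
  moreover have "card (W \<union> symd W {..<6}) \<le> card W + card (symd W {..<6})" by (rule card_Un_le)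
  ultimately show False by simp
qed

text \<open>In the halved 4-cube the only other vertex not adjacent to a set is its complement. The
  list in \<open>f\<close> places complementary sets at positions 2i and 2i + 1, the pairs removed
  in \<open>cp_E\<close>.\<close>

lemma even_4_iso: "graph_iso (even_sets 4) (even_E 4) (cp_V 4) (cp_E 4)"
proof -
  define f :: "nat \<Rightarrow> nat set" where
    "f u = [{}, {0, 1, 2, 3}, {0, 1}, {2, 3}, {0, 2}, {1, 3}, {0, 3}, {1, 2}] ! u" for u
  have u: "{..<8} = {0, 1, 2, 3, 4, 5, 6, 7 :: nat}" "{..<4} = {0, 1, 2, 3 :: nat}" by auto
  have V: "even_sets 4 = f ` {..<8}"
  proof
    show "even_sets 4 \<subseteq> f ` {..<8}"
    proof
      fix S assume "S \<in> even_sets 4"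
      then have "S \<in> Pow {0, 1, 2, 3}" "even (card S)" unfolding even_sets_def u by auto
      then show "S \<in> f ` {..<8}"
        unfolding Pow_insert Pow_empty u f_def by (simp add: image_iff) (elim disjE; simp)
    qed
    show "f ` {..<8} \<subseteq> even_sets 4" unfolding even_sets_def u by (simp add: f_def)
  qed
  have E: "cp_E 4 u v \<longleftrightarrow> even_E 4 (f u) (f v)" if "u < 8" "v < 8" for u v
  proof -
    have "\<forall>u\<in>{..<8}. \<forall>v\<in>{..<8}. u div 2 \<noteq> v div 2 \<longleftrightarrow> card (symd (f u) (f v)) = 2"
      unfolding u by (simp add: f_def symd_def insert_Diff_if)
    moreover have "f u \<in> even_sets 4" "f v \<in> even_sets 4" using V that by auto
    ultimately show ?thesis using that by (auto simp: cp_E_def even_E_def)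
  qed
  \<comment> \<open>An even subset of four points is determined by its trace on three of
    them.\<close>
  have "\<forall>u\<in>{..<8}. \<forall>v\<in>{..<8}. (\<forall>i\<in>{0, 1, 2}. i \<in> f u \<longleftrightarrow> i \<in> f v) \<longrightarrow> u = v"
    unfolding u by (simp add: f_def)
  then have "inj_on f {..<8}" by (intro inj_onI) blast
  then have "graph_iso (cp_V 4) (cp_E 4) (even_sets 4) (even_E 4)"
    unfolding graph_iso_def bij_betw_def cp_V_def using V E by (intro exI[of _ f]) auto
  then show ?thesis by (rule graph_iso_sym)
qed

section \<open>The Gosset graph\<close>

lemma gosset_V_iff: "(c, U) \<in> gosset_V \<longleftrightarrow> U \<subseteq> {..<8} \<and> card U = 2"
  by (simp add: gosset_V_def)

lemma gosset_finite: "finite gosset_V" "(c, U) \<in> gosset_V \<Longrightarrow> finite U"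
proof -
  have "gosset_V \<subseteq> UNIV \<times> Pow {..<8}" by (auto simp: gosset_V_def)
  then show "finite gosset_V" by (rule finite_subset) simp
qed (auto simp: gosset_V_def intro: finite_subset)

lemma gosset_E_iff:
  "gosset_E (c, U) (d, W) \<longleftrightarrow> (c, U) \<in> gosset_V \<and> (d, W) \<in> gosset_V \<and>
    card (U \<inter> W) = (if c = d then 1 else 0)"
  using gosset_finite(2)[of c U] by (auto simp: gosset_E_def)

lemma gosset_simple: "simple_graph gosset_V gosset_E"
  by (auto simp: simple_graph_def gosset_E_iff gosset_V_iff Int_commute)

lemma card_pair_exchange:
  assumes "card U = 2" "i \<in> U" "j \<notin> U"
  shows "card (insert j (U - {i})) = 2" "card (U \<inter> insert j (U - {i})) = 1"
  using card_exchange[OF _ assms(2,3)] assms(1) by (auto simp: card_2_iff)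

lemma gosset_connected: "connected_graph gosset_V gosset_E"
\<comment> \<open>The measure is the distance to \<open>(False, {6, 7})\<close>: pairs of the other
  copy that avoid 6 and 7 are adjacent to it, and the antipode \<open>(True, {6, 7})\<close> has
  value 3.\<close>
proof (rule connected_by_descent[OF gosset_simple, of "(False, {6, 7})"
      "\<lambda>(c, U). if c then 1 + card (U \<inter> {6, 7}) else 2 - card (U \<inter> {6, 7})"])
  show "(False, {6, 7}) \<in> gosset_V" by (simp add: gosset_V_iff)
  fix v assume v: "v \<in> gosset_V" "v \<noteq> (False, {6, 7})"
  obtain c U where cU: "v = (c, U)" by fastforce
  have U: "U \<subseteq> {..<8}" "card U = 2" "finite U" using v gosset_finite(2) by (auto simp: cU gosset_V_iff)
  show "\<exists>w. gosset_E v w \<and> (case w of (c, U) \<Rightarrow> if c then 1 + card (U \<inter> {6, 7}) else 2 - card (U \<inter> {6, 7}))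
    < (case v of (c, U) \<Rightarrow> if c then 1 + card (U \<inter> {6, 7}) else 2 - card (U \<inter> {6, 7}))"
  proof (cases c)
    case False
    then have "U \<noteq> {6, 7}" using v cU by simp
    then obtain i j where ij: "i \<in> U" "i \<notin> {6, 7}" "j \<in> {6, 7}" "j \<notin> U"
      using exchange[of U "{6, 7}"] U by auto
    let ?W = "insert j (U - {i})"
    have "gosset_E v (c, ?W)" using v ij card_pair_exchange[OF U(2) ij(1,4)]
      by (auto simp: cU gosset_E_iff gosset_V_iff)
    moreover have "?W \<inter> {6, 7} = insert j (U \<inter> {6, 7})" using ij by auto
    then have "card (?W \<inter> {6, 7}) = card (U \<inter> {6, 7}) + 1" using ij U by simp
    moreover have "card (?W \<inter> {6, 7}) \<le> card {6, 7 :: nat}" by (intro card_mono) auto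
    ultimately show ?thesis using False by (intro exI[of _ "(c, ?W)"]) (simp add: cU)
  next
    case True
    show ?thesis
    proof (cases "U \<inter> {6, 7} = {}")
      case empty: True
      then show ?thesis using v True
        by (intro exI[of _ "(False, {6, 7})"]) (simp add: cU gosset_E_iff gosset_V_iff)
    next
      case False
      then obtain i where i: "i \<in> U" "i \<in> {6, 7}" by blast
      have "card (U - {i}) = 1" using i U by simp
      then obtain e where e: "U - {i} = {e}" by (metis card_1_singletonE)
      \<comment> \<open>A point outside \<open>U\<close> and different from 6 and 7.\<close>
      define j :: nat where "j = (if e = 0 then 1 else 0)"
      have "U = {i, e}" using i e by blast
      then have j: "j \<notin> U" "j < 8" "j \<notin> {6, 7}" using i by (auto simp: j_def)
      let ?W = "insert j (U - {i})"
      have "gosset_E v (c, ?W)" using v i j card_pair_exchange[OF U(2) i(1) j(1)]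
        by (auto simp: cU gosset_E_iff gosset_V_iff)
      moreover have "?W \<inter> {6, 7} = (U \<inter> {6, 7}) - {i}" using j by auto
      moreover have "card ((U \<inter> {6, 7}) - {i}) < card (U \<inter> {6, 7})"
        using i by (intro card_Diff1_less) auto
      ultimately show ?thesis using True by (intro exI[of _ "(c, ?W)"]) (simp add: cU)
    qed
  qed
qed

lemma swp_commute: "swp i j = swp j i"
  by (auto simp: swp_def)

text \<open>The transposition acts on both copies. A pair in the other copy is the antipode of the
  same pair in the first, so there the half space is reversed: it has the pairs with
  \<open>j\<close> and without \<open>i\<close>.\<close>

lemma gosset_mirror_swp:
  assumes e: "gosset_E (b, P) (b, Q)"
  shows "\<exists>\<phi> A. mirror gosset_V gosset_E (b, P) (b, Q) \<phi> A"
proof -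
  have PQ: "P \<subseteq> {..<8}" "card P = 2" "Q \<subseteq> {..<8}" "card Q = 2" "card (P \<inter> Q) + 1 = card P"
    and fin: "finite P" "finite Q"
    using e gosset_finite(2)[of b P] gosset_finite(2)[of b Q] by (simp_all add: gosset_E_iff gosset_V_iff)
  then obtain i j where ij: "i \<in> P" "i \<notin> Q" "j \<in> Q" "j \<notin> P" "Q = insert j (P - {i})"
    using exchange_unique[of P Q] by metis
  then have n: "i < 8" "j < 8" using PQ by auto
  define \<phi> :: "bool \<times> nat set \<Rightarrow> bool \<times> nat set" where "\<phi> = (\<lambda>(c, U). (c, swp i j ` U))"
  define A where "A = {(c, U). (c, U) \<in> gosset_V \<and> (if c = b then i \<in> U \<and> j \<notin> U else j \<in> U \<and> i \<notin> U)}"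
  have A: "(c, U) \<in> A \<longleftrightarrow> (c, U) \<in> gosset_V \<and> (if c = b then i \<in> U \<and> j \<notin> U else j \<in> U \<and> i \<notin> U)" for c U
    by (simp add: A_def)
  have \<phi>: "\<phi> (c, U) = (c, swp i j ` U)" for c U by (simp add: \<phi>_def)
  have V: "(c, swp i j ` U) \<in> gosset_V" if "(c, U) \<in> gosset_V" for c U
    using that swp_subset[OF n] by (simp add: gosset_V_iff card_swp)
  have mem: "i \<in> swp i j ` U \<longleftrightarrow> j \<in> U" "j \<in> swp i j ` U \<longleftrightarrow> i \<in> U" for U
    by (auto simp: swp_image)
  have "mirror gosset_V gosset_E (b, P) (b, Q) \<phi> A"
  proof (rule mirrorI; (unfold split_paired_all)?)
    fix c U assume U: "(c, U) \<in> gosset_V"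
    show "\<phi> (c, U) \<in> gosset_V" using V U by (simp add: \<phi>)
    show "\<phi> (\<phi> (c, U)) = (c, U)" by (simp add: \<phi> swp_image_image)
    show "(c, U) \<notin> A \<Longrightarrow> \<phi> (c, U) \<notin> A \<Longrightarrow> \<phi> (c, U) = (c, U)"
      using U V by (auto simp: A \<phi> mem swp_image split: if_splits)
  next
    fix c U d W assume "gosset_E (c, U) (d, W)"
    then show "gosset_E (\<phi> (c, U)) (\<phi> (d, W))" using V by (simp add: \<phi> gosset_E_iff card_swp)
  next
    fix c U assume U: "(c, U) \<in> A"
    then show "\<phi> (c, U) \<notin> A" by (auto simp: A \<phi> mem split: if_splits)
    have "card (U \<inter> swp i j ` U) = 1"
    proof (cases "c = b")
      case True
      then show ?thesis using U card_pair_exchange[of U i j] by (simp add: A gosset_V_iff swp_image)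
    next
      case False
      then show ?thesis using U card_pair_exchange[of U j i] by (simp add: A gosset_V_iff swp_image)
    qed
    then show "gosset_E (c, U) (\<phi> (c, U))" using U V by (simp add: \<phi> gosset_E_iff A)
  next
    fix c U d W assume UW: "(c, U) \<in> A" "(d, W) \<in> A" "gosset_E (c, U) (\<phi> (d, W))"
    then have V': "finite U" "finite W" "card U = 2" "card W = 2"
      and card: "card (U \<inter> swp i j ` W) = (if c = d then 1 else 0)"
      using gosset_finite(2)[of c U] gosset_finite(2)[of d W]
      by (simp_all add: A gosset_V_iff \<phi> gosset_E_iff)
    show "(c, U) = (d, W)"
    proof (cases "c = d")
      case True
      then show ?thesis
        using swp_cross[of U W i j] swp_cross[of U W j i] swp_commute[of i j] UW V' card
        by (cases "d = b") (simp_all add: A)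
    next
      case False
      then have "U \<inter> swp i j ` W = {}" using card V' by simp
      moreover have "i \<in> U \<inter> swp i j ` W \<or> j \<in> U \<inter> swp i j ` W"
        using UW False by (cases "c = b") (auto simp: A mem)
      ultimately show ?thesis by blast
    qed
  next
    show "A \<subseteq> gosset_V" by (rule subrelI) (use A in blast)
    show "(b, P) \<in> A" using PQ ij by (simp add: A gosset_V_iff)
    show "\<phi> (b, P) = (b, Q)" using ij by (simp add: \<phi> swp_image)
  qed
  then show ?thesis by blast
qed

lemma card_relative_complement:
  assumes "finite W" "U \<subseteq> X"
  shows "card (U \<inter> W) + card ((X - U) \<inter> W) = card (X \<inter> W)"
proof -
  have "X \<inter> W = (U \<inter> W) \<union> ((X - U) \<inter> W)" using assms by blast
  then show ?thesis using assms by (simp add: card_Un_disjoint disjoint_iff)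
qed

lemma card_pair_complements:
  assumes "card X = 4" "U \<subseteq> X" "W \<subseteq> X" "card U = 2" "card W = 2"
  shows "card (X - U) = 2" "card ((X - U) \<inter> (X - W)) = card (U \<inter> W)"
proof -
  have fin: "finite X" "finite U" "finite W" using assms by (auto intro: card_ge_0_finite)
  show "card (X - U) = 2" using assms fin by (simp add: card_Diff_subset)
  have "card (X - W) = 2" using assms fin by (simp add: card_Diff_subset)
  moreover have "card (U \<inter> (X - W)) + card ((X - U) \<inter> (X - W)) = card (X \<inter> (X - W))"
    using card_relative_complement[of "X - W" U X] fin assms by simp
  moreover have "card (W \<inter> U) + card ((X - W) \<inter> U) = card (X \<inter> U)"
    using card_relative_complement[of U W X] fin assms by simp
  moreover have "X \<inter> (X - W) = X - W" "X \<inter> U = U" "W \<inter> U = U \<inter> W" "(X - W) \<inter> U = U \<inter> (X - W)"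
    using assms by blast+
  ultimately show "card ((X - U) \<inter> (X - W)) = card (U \<inter> W)" using assms by simp
qed

text \<open>The reflection in a 4-subset S of the 8 points complements the pairs inside S and those
  inside its complement, and exchanges the two copies of these pairs.\<close>
lemma gosset_mirror_complement:
  assumes e: "gosset_E (b, P) (\<not> b, Q)"
  shows "\<exists>\<phi> A. mirror gosset_V gosset_E (b, P) (\<not> b, Q) \<phi> A"
proof -
  have PQ: "P \<subseteq> {..<8}" "card P = 2" "Q \<subseteq> {..<8}" "card Q = 2" "P \<inter> Q = {}" "finite P" "finite Q"
    using e gosset_finite(2)[of b P] gosset_finite(2)[of _ Q] by (auto simp: gosset_E_iff gosset_V_iff)
  \<comment> \<open>\<open>P\<close> and \<open>Q\<close> are complementary in
    \<open>S True\<close>, so complementing inside it takes \<open>P\<close> to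
    \<open>Q\<close>.\<close>
  define S where "S k = (if k then P \<union> Q else {..<8} - (P \<union> Q))" for k
  have "card (P \<union> Q) = 4" using PQ by (simp add: card_Un_disjoint)
  then have S4: "card (S k) = 4" for k using PQ by (simp add: S_def card_Diff_subset)
  have S8: "S k \<subseteq> {..<8}" "finite (S k)" for k using PQ by (auto simp: S_def)
  have disj: "S True \<inter> S False = {}" "S True \<union> S False = {..<8}" using PQ by (auto simp: S_def)
  have disj': "S k \<inter> S l = {}" if "k \<noteq> l" for k l using that disj by (cases k; cases l) auto
  define inside where "inside k U \<longleftrightarrow> U \<subseteq> S k" for k U
  have one: "\<not> (inside k U \<and> inside l U)" if "card U = 2" "k \<noteq> l" for k l and U :: "nat set"
  proof
    assume "inside k U \<and> inside l U"
    then have "U \<subseteq> S k \<inter> S l" by (auto simp: inside_def)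
    then show False using disj'[OF that(2)] that(1) by auto
  qed
  define \<phi> where "\<phi> = (\<lambda>(c, U). if inside True U then (\<not> c, S True - U) 
    else if inside False U then (\<not> c, S False - U) else (c, U))"
  have \<phi>_in: "\<phi> (c, U) = (\<not> c, S k - U)" if "inside k U" "card U = 2" for c U k
    using that one[OF that(2), of True False] by (cases k) (auto simp: \<phi>_def)
  have \<phi>_out: "\<phi> (c, U) = (c, U)" if "\<And>k. \<not> inside k U" for c U
    using that by (simp add: \<phi>_def)
  have compl: "inside k (S k - U)" "card (S k - U) = 2" "S k - (S k - U) = U"
    if "inside k U" "card U = 2" for k U
    using that card_pair_complements(1)[OF S4, of U k U] by (auto simp: inside_def)
  have V: "(c, S k - U) \<in> gosset_V" if "inside k U" "card U = 2" for c k U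
    using compl[OF that] S8 by (auto simp: gosset_V_iff)
  have mixed: "card (S k \<inter> W) = 1" if "W \<subseteq> {..<8}" "card W = 2" "\<And>l. \<not> inside l W" for k W
  proof -
    have fin: "finite W" using that by (auto intro: card_ge_0_finite)
    have "card (S True \<inter> W) + card (S False \<inter> W) = card ((S True \<inter> W) \<union> (S False \<inter> W))"
      using disj fin by (intro card_Un_disjoint[symmetric]) auto
    moreover have "(S True \<inter> W) \<union> (S False \<inter> W) = W" using disj(2) that(1) by blast
    moreover have "card (S l \<inter> W) \<noteq> 0" for l
    proof
      assume "card (S l \<inter> W) = 0"
      then have "S l \<inter> W = {}" using fin by simp
      then have "W \<subseteq> S (\<not> l)" using disj(2) that(1) by (cases l) auto
      then show False using that(3) by (auto simp: inside_def)
    qed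
    from this[of True] this[of False] have "card (S True \<inter> W) \<noteq> 0" "card (S False \<inter> W) \<noteq> 0" .
    ultimately show ?thesis using that(2) by (cases k) simp_all
  qed
  \<comment> \<open>A pair \<open>W\<close> inside neither 4-set meets \<open>S k\<close> in one
    point, lying either in \<open>U\<close> or in its complement. So the size of the intersection
    switches between 0 and 1, exactly as the change of copy of \<open>U\<close> requires.\<close>
  have in_mixed: "card ((S k - U) \<inter> W) = 1 - card (U \<inter> W) \<and> card (U \<inter> W) \<le> 1"
    if "inside k U" "W \<subseteq> {..<8}" "card W = 2" "\<And>l. \<not> inside l W" for k U W
    using card_relative_complement[of W U "S k"] mixed[OF that(2-4), of k] that card_ge_0_finite[of W]
    by (auto simp: inside_def)
  have in_in: "card ((S k - U) \<inter> (S l - W)) = card (U \<inter> W)"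
    if "inside k U" "inside l W" "card U = 2" "card W = 2" for k l U W
  proof (cases "k = l")
    case True
    then show ?thesis using card_pair_complements(2)[OF S4, of U k W] that by (simp add: inside_def)
  next
    case False
    then have "(S k - U) \<inter> (S l - W) = {}" "U \<inter> W = {}" using disj'[OF False] that by (auto simp: inside_def)
    then show ?thesis by simp
  qed
  have pres: "gosset_E (\<phi> (c, U)) (\<phi> (d, W))" if E: "gosset_E (c, U) (d, W)" for c U d W
  proof -
    have UW: "U \<subseteq> {..<8}" "card U = 2" "W \<subseteq> {..<8}" "card W = 2" 
      and card: "card (U \<inter> W) = (if c = d then 1 else 0)"
      using E by (auto simp: gosset_E_iff gosset_V_iff)
    have V': "(x, U) \<in> gosset_V" "(x, W) \<in> gosset_V" for x using UW by (auto simp: gosset_V_iff)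
    consider k l where "inside k U" "inside l W" | k where "inside k U" "\<And>l. \<not> inside l W"
      | l where "\<And>k. \<not> inside k U" "inside l W" | "\<And>k. \<not> inside k U" "\<And>l. \<not> inside l W" by blast
    then show ?thesis
    proof cases
      case (1 k l)
      then show ?thesis using \<phi>_in[OF 1(1) UW(2)] \<phi>_in[OF 1(2) UW(4)] V[OF 1(1) UW(2)] V[OF 1(2) UW(4)]
          in_in[OF 1 UW(2,4)] card by (simp add: gosset_E_iff)
    next
      case (2 k)
      then show ?thesis using \<phi>_in[OF 2(1) UW(2)] \<phi>_out[OF 2(2)] V[OF 2(1) UW(2)] V'
          in_mixed[OF 2(1) UW(3,4) 2(2)] card by (auto simp: gosset_E_iff)
    next
      case (3 l)
      then show ?thesis using \<phi>_in[OF 3(2) UW(4)] \<phi>_out[OF 3(1)] V[OF 3(2) UW(4)] V'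
          in_mixed[OF 3(2) UW(1,2) 3(1)] card by (auto simp: gosset_E_iff Int_commute)
    next
      case 4
      then show ?thesis using \<phi>_out E by simp
    qed
  qed
  \<comment> \<open>Pairs inside \<open>S False\<close> are disjoint from \<open>P\<close> and
    \<open>Q\<close>; in copy \<open>\<not> b\<close> they are adjacent to \<open>(b, P)\<close> but
    not to \<open>(\<not> b, Q)\<close>, so they belong to this side.\<close>
  define A where "A = {(c, U). (c, U) \<in> gosset_V \<and> inside (c = b) U}"
  have A: "(c, U) \<in> A \<longleftrightarrow> (c, U) \<in> gosset_V \<and> inside (c = b) U" for c U by (simp add: A_def)
  have "mirror gosset_V gosset_E (b, P) (\<not> b, Q) \<phi> A"
  proof (rule mirrorI; (unfold split_paired_all)?)
    fix c U assume "(c, U) \<in> gosset_V"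
    then have U: "U \<subseteq> {..<8}" "card U = 2" by (auto simp: gosset_V_iff)
    have "\<phi> (c, U) \<in> gosset_V \<and> \<phi> (\<phi> (c, U)) = (c, U) \<and> ((c, U) \<notin> A \<longrightarrow> \<phi> (c, U) \<notin> A \<longrightarrow> \<phi> (c, U) = (c, U))"
    proof (cases "\<exists>k. inside k U")
      case True
      then obtain k where k: "inside k U" by blast
      have "(c, U) \<in> A \<or> \<phi> (c, U) \<in> A"
        using k compl[OF k U(2)] V[OF k U(2)] \<open>(c, U) \<in> gosset_V\<close> \<phi>_in[OF k U(2)]
        by (cases "k = (c = b)") (auto simp: A)
      then show ?thesis using \<phi>_in[OF k U(2)] \<phi>_in[OF compl(1,2)[OF k U(2)]] compl(3)[OF k U(2)] V[OF k U(2)]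
        by auto
    qed (use \<phi>_out \<open>(c, U) \<in> gosset_V\<close> in simp)
    then show "\<phi> (c, U) \<in> gosset_V" "\<phi> (\<phi> (c, U)) = (c, U)"
      "(c, U) \<notin> A \<Longrightarrow> \<phi> (c, U) \<notin> A \<Longrightarrow> \<phi> (c, U) = (c, U)" by auto
  next
    fix c U d W assume "gosset_E (c, U) (d, W)"
    then show "gosset_E (\<phi> (c, U)) (\<phi> (d, W))" by (rule pres)
  next
    fix c U assume U: "(c, U) \<in> A"
    then have k: "inside (c = b) U" "card U = 2" by (auto simp: A gosset_V_iff)
    have "\<not> inside ((\<not> c) = b) (S (c = b) - U)"
      using one[OF compl(2)[OF k], of "c = b" "(\<not> c) = b"] compl(1)[OF k] by simp
    then show "\<phi> (c, U) \<notin> A" using \<phi>_in[OF k] by (simp add: A)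
    have "U \<inter> (S (c = b) - U) = {}" by blast
    then show "gosset_E (c, U) (\<phi> (c, U))" using \<phi>_in[OF k] V[OF k] U by (simp add: A gosset_E_iff)
  next
    fix c U d W assume UW: "(c, U) \<in> A" "(d, W) \<in> A" "gosset_E (c, U) (\<phi> (d, W))"
    then have k: "inside (c = b) U" "card U = 2" "inside (d = b) W" "card W = 2"
      by (auto simp: A gosset_V_iff)
    have fin: "finite U" "finite W" using k by (auto intro: card_ge_0_finite)
    have card: "card (U \<inter> (S (d = b) - W)) = (if c = (\<not> d) then 1 else 0)"
      using UW(3) \<phi>_in[OF k(3,4)] by (auto simp: gosset_E_iff)
    show "(c, U) = (d, W)"
    proof (cases "c = d")
      case True
      then have "U \<inter> (S (d = b) - W) = {}" using card fin by simp
      then have "U \<subseteq> W" using k True by (auto simp: inside_def)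
      then show ?thesis using True k fin card_subset_eq[of W U] by simp
    next
      case False
      then have "S (c = b) \<inter> S (d = b) = {}" by (intro disj') auto
      then have "U \<inter> (S (d = b) - W) = {}" using k(1) unfolding inside_def by blast
      then show ?thesis using card False by auto
    qed
  next
    show "A \<subseteq> gosset_V" by (rule subrelI) (use A in blast)
    show "(b, P) \<in> A" using PQ by (simp add: A gosset_V_iff inside_def S_def)
    have "S True - P = Q" "inside True P" using PQ by (auto simp: S_def inside_def)
    then show "\<phi> (b, P) = (\<not> b, Q)" using \<phi>_in[of True P b] PQ by simp
  qed
  then show ?thesis by blast
qed

lemma gosset_has_mirrors: "has_mirrors gosset_V gosset_E"
  unfolding has_mirrors_def
proof (intro ballI impI)
  fix x y assume xy: "gosset_E x y"
  obtain b P c Q where "x = (b, P)" "y = (c, Q)" by fastforce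
  then show "\<exists>\<phi> A. mirror gosset_V gosset_E x y \<phi> A"
    using xy gosset_mirror_swp gosset_mirror_complement by (cases "c = b") auto
qed

lemma gosset_mirror_graph: "mirror_graph gosset_V gosset_E"
  using gosset_simple gosset_connected gosset_has_mirrors by unfold_locales auto

lemma gosset_not_diam2: "\<not> diam2 gosset_V gosset_E"
proof
  assume diam: "diam2 gosset_V gosset_E"
  have "(False, {0, 1}) \<in> gosset_V" "(True, {0, 1}) \<in> gosset_V" by (auto simp: gosset_V_iff)
  moreover have "\<not> gosset_E (False, {0, 1}) (True, {0, 1})" by (simp add: gosset_E_iff)
  ultimately obtain w where w: "gosset_E (False, {0, 1}) w" "gosset_E w (True, {0, 1})"
    using diam2D[OF diam] by (metis Pair_inject)
  obtain c U where "w = (c, U)" by fastforce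
  then show False using w by (cases c) (simp_all add: gosset_E_iff Int_commute)
qed

section \<open>The Schlaefli graph\<close>

lemma schlafli_V_iff:
  "LA i \<in> schlafli_V \<longleftrightarrow> i < 6" "LB i \<in> schlafli_V \<longleftrightarrow> i < 6"
  "LC s \<in> schlafli_V \<longleftrightarrow> s \<subseteq> {..<6} \<and> card s = 2"
proof -
  show "LC s \<in> schlafli_V \<longleftrightarrow> s \<subseteq> {..<6} \<and> card s = 2"
  proof
    assume "s \<subseteq> {..<6} \<and> card s = 2"
    then obtain i j where "s = {i, j}" "i \<noteq> j" "i < 6" "j < 6" by (auto simp: card_2_iff)
    then have "\<exists>i j. s = {i, j} \<and> i < j \<and> j < 6"
      by (cases "i < j") (blast, metis insert_commute linorder_neqE_nat)
    then show "LC s \<in> schlafli_V" by (auto simp: schlafli_V_def)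
  qed (auto simp: schlafli_V_def)
qed (auto simp: schlafli_V_def)

lemma card_pairs_meet:
  assumes "card s = 2" "card t = 2"
  shows "card (s \<inter> t) = 1 \<longleftrightarrow> s \<noteq> t \<and> s \<inter> t \<noteq> {}"
proof -
  have fin: "finite s" "finite t" using assms by (auto intro: card_ge_0_finite)
  have "card (s \<inter> t) \<le> 2" using card_mono[OF fin(1), of "s \<inter> t"] assms by simp
  moreover have "card (s \<inter> t) = 2 \<longleftrightarrow> s = t"
    using card_subset_eq[OF fin(1), of "s \<inter> t"] card_subset_eq[OF fin(2), of "s \<inter> t"] assms by auto
  moreover have "card (s \<inter> t) = 0 \<longleftrightarrow> s \<inter> t = {}" using fin by simp
  ultimately show ?thesis by (auto simp: le_Suc_eq numeral_2_eq_2)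
qed

text \<open>The 27 neighbours of \<open>(False, {6, 7})\<close> are six pairs through 6, six pairs
  through 7, and the fifteen pairs of the other copy that avoid both: the lines a_i, b_i and
  c_ij.\<close>

lemma schlafli_nbrs_gosset:
  "graph_iso schlafli_V schlafli_E (nbrs gosset_V gosset_E (False, {6, 7})) gosset_E"
proof -
  define g where "g p = (case p of LA i \<Rightarrow> (False, {i, 6}) | LB i \<Rightarrow> (False, {i, 7}) | LC s \<Rightarrow> (True, s))" for p
  let ?N = "nbrs gosset_V gosset_E (False, {6, 7})"
  \<comment> \<open>Splits a statement about all lines, and in nested use about all pairs of lines,
    by the kinds of line.\<close>
  have ball: "(\<forall>p\<in>schlafli_V. Q p) \<longleftrightarrow> (\<forall>i<6. Q (LA i)) \<and> (\<forall>i<6. Q (LB i)) \<and>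
      (\<forall>s. s \<subseteq> {..<6} \<and> card s = 2 \<longrightarrow> Q (LC s))" for Q
    by (metis line27.exhaust schlafli_V_iff)
  have six: "6 \<notin> s" "7 \<notin> s" "s \<subseteq> {..<8}" if "s \<subseteq> {..<6}" for s :: "nat set"
  proof -
    show "6 \<notin> s" "7 \<notin> s" using that by auto
    show "s \<subseteq> {..<8}" by (rule subset_trans[OF that]) simp
  qed
  have N: "(c, U) \<in> ?N \<longleftrightarrow> U \<subseteq> {..<8} \<and> card U = 2 \<and> card ({6, 7} \<inter> U) = (if c then 0 else 1)" for c U
    by (auto simp: nbrs_def gosset_E_iff gosset_V_iff)
  have "\<forall>p\<in>schlafli_V. g p \<in> ?N"
    unfolding ball using six by (auto simp: g_def N)
  moreover have onto: "\<exists>p\<in>schlafli_V. g p = (c, U)" if cU: "(c, U) \<in> ?N" for c U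
  proof (cases c)
    case True
    then have "{6, 7} \<inter> U = {}" using cU by (simp add: N)
    then have "U \<subseteq> {..<6}"
    proof -
      have "u < 6" if "u \<in> U" for u
      proof -
        have "u < 8" "u \<noteq> 6" "u \<noteq> 7" using that cU \<open>{6, 7} \<inter> U = {}\<close> by (auto simp: N)
        then show ?thesis by linarith
      qed
      then show ?thesis by blast
    qed
    then show ?thesis using True cU by (intro bexI[of _ "LC U"]) (auto simp: g_def N schlafli_V_iff)
  next
    case False
    then have card: "card U = 2" "card ({6, 7} \<inter> U) = 1" "U \<subseteq> {..<8}" using cU by (auto simp: N)
    then obtain a where a: "{6, 7} \<inter> U = {a}" by (metis card_1_singletonE)
    then have "a \<in> U" by blast
    then have "card (U - {a}) = 1" using card(1) by simp
    then obtain i where i: "U - {a} = {i}" by (metis card_1_singletonE)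
    then have U: "U = {i, a}" "i \<noteq> a" "a = 6 \<or> a = 7" using a by auto
    moreover have "i \<notin> {6, 7}" using a U(1,2) by blast
    then have "i \<noteq> 6" "i \<noteq> 7" "i < 8" using card(3) U(1) by simp_all
    then have "i < 6" by linarith
    ultimately show ?thesis using False
      by (auto simp: g_def schlafli_V_iff intro: bexI[of _ "LA i"] bexI[of _ "LB i"])
  qed
  moreover have "\<forall>p\<in>schlafli_V. \<forall>q\<in>schlafli_V. g p = g q \<longrightarrow> p = q"
    unfolding ball by (auto simp: g_def doubleton_eq_iff)
  then have "inj_on g schlafli_V" by (intro inj_onI) blast
  moreover have "?N \<subseteq> g ` schlafli_V"
  proof
    fix v assume "v \<in> ?N"
    then show "v \<in> g ` schlafli_V" using onto[of "fst v" "snd v"] by (metis imageI prod.collapse)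
  qed
  ultimately have bij: "bij_betw g schlafli_V ?N"
    unfolding bij_betw_def by blast
  have single: "{i, a} \<inter> s = (if i \<in> s then {i} else {})" if "a \<notin> s" for i a and s :: "nat set"
    using that by auto
  have single': "s \<inter> {i, a} = (if i \<in> s then {i} else {})" if "a \<notin> s" for i a and s :: "nat set"
    using that by auto
  have AA: "card ({i, a} \<inter> {j, a}) = Suc 0 \<longleftrightarrow> i \<noteq> j" if "i \<noteq> a" "j \<noteq> a" for i j a :: nat
  proof -
    have "{i, a} \<inter> {j, a} = (if i = j then {i, a} else {a})" using that by auto
    then show ?thesis using that by simp
  qed
  have AB: "card ({i, a} \<inter> {j, b}) = Suc 0 \<longleftrightarrow> i = j"
    if "i \<noteq> a" "j \<noteq> a" "i \<noteq> b" "j \<noteq> b" "a \<noteq> b" for i j a b :: nat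
  proof -
    have "{i, a} \<inter> {j, b} = (if i = j then {i} else {})" using that by auto
    then show ?thesis by simp
  qed
  have "\<forall>p\<in>schlafli_V. \<forall>q\<in>schlafli_V. p \<noteq> q \<and> \<not> lines_meet p q \<longleftrightarrow>
    card (snd (g p) \<inter> snd (g q)) = (if fst (g p) = fst (g q) then 1 else 0)"
    unfolding ball
    by (intro conjI allI impI)
      (use six in \<open>simp_all add: g_def AA AB doubleton_eq_iff single single' card_pairs_meet[unfolded One_nat_def]\<close>)
  moreover have "gosset_E u v \<longleftrightarrow> card (snd u \<inter> snd v) = (if fst u = fst v then 1 else 0)"
    if "u \<in> ?N" "v \<in> ?N" for u v
    using that by (cases u; cases v) (simp add: gosset_E_iff nbrs_def)
  ultimately show ?thesis unfolding graph_iso_def using bij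
    by (intro exI[of _ g]) (auto simp: schlafli_E_def bij_betwE)
qed

text \<open>Mirrors pass to neighbourhoods, so those of the Gosset graph already provide them; no
  reflection of the 27 lines is built by hand.\<close>

lemma schlafli_has_mirrors: "has_mirrors schlafli_V schlafli_E"
  using has_mirrors_iso[OF graph_iso_sym mirror_graph.nbrs_has_mirrors[OF gosset_mirror_graph]]
    schlafli_nbrs_gosset graph_iso_restr(2) by blast

text \<open>The 16 lines skew to a_5 are the a_i with i < 5, the line b_5, and the c_s with 5 not in
  s. They correspond to the even subsets of five points with 4, 0 and 2 elements.\<close>

lemma even_5_nbrs_schlafli:
  "graph_iso (even_sets 5) (even_E 5) (nbrs schlafli_V schlafli_E (LA 5)) schlafli_E"
proof (rule graph_iso_sym)
  define h where "h p = (case p of LA i \<Rightarrow> {..<5} - {i} | LB i \<Rightarrow> {} | LC s \<Rightarrow> s)" for p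
  let ?N = "nbrs schlafli_V schlafli_E (LA 5)"
  have LC: "s \<subseteq> {..<6} \<and> 5 \<notin> s \<longleftrightarrow> s \<subseteq> {..<5}" for s :: "nat set"
  proof -
    have "{..<6} = insert 5 {..<5 :: nat}" by auto
    then show ?thesis by (auto simp: subset_insert)
  qed
  have N: "LA i \<in> ?N \<longleftrightarrow> i < 5" "LB i \<in> ?N \<longleftrightarrow> i = 5" "LC s \<in> ?N \<longleftrightarrow> s \<subseteq> {..<5} \<and> card s = 2" for i s
    using LC[of s] by (auto simp: nbrs_def schlafli_E_def schlafli_V_iff)
  have ball: "(\<forall>p\<in>?N. Q p) \<longleftrightarrow> (\<forall>i<5. Q (LA i)) \<and> Q (LB 5) \<and>
      (\<forall>s. s \<subseteq> {..<5} \<and> card s = 2 \<longrightarrow> Q (LC s))" for Q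
    by (metis line27.exhaust N)
  have hV: "\<forall>p\<in>?N. h p \<in> even_sets 5"
    unfolding ball by (auto simp: h_def even_sets_def)
  moreover have "\<exists>p\<in>?N. h p = U" if U: "U \<in> even_sets 5" for U
  proof -
    have fin: "finite U" and sub: "U \<subseteq> {..<5}" using U even_sets_finite(2)[OF U] by (simp_all add: even_sets_def)
    have "card U \<le> 5" using card_mono[OF _ sub] by simp
    then have "card U = 0 \<or> card U = 2 \<or> card U = 4" using U by (auto simp: even_sets_def elim!: evenE)
    then consider "U = {}" | "card U = 2" | "card U = 4" using fin by auto
    then show ?thesis
    proof cases
      case 3
      then have "card ({..<5} - U) = 1" using sub fin by (simp add: card_Diff_subset)
      then obtain i where "{..<5} - U = {i}" by (metis card_1_singletonE)
      then have "i < 5" "U = {..<5} - {i}" using sub by auto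
      then show ?thesis by (intro bexI[of _ "LA i"]) (auto simp: h_def N)
    qed (use sub in \<open>auto simp: h_def N intro: bexI[of _ "LB 5"] bexI[of _ "LC U"]\<close>)
  qed
  moreover have card4: "card ({..<5} - {i}) = 4" if "i < 5" for i :: nat using that by simp
  have ne: "\<not> {..<5} \<subseteq> {i}" for i :: nat using card_mono[of "{i}" "{..<5}"] by auto
  have "\<forall>p\<in>?N. \<forall>q\<in>?N. h p = h q \<longrightarrow> p = q"
    unfolding ball using card4 ne by (auto simp: h_def)
  then have "inj_on h ?N" by (intro inj_onI) blast
  ultimately have bij: "bij_betw h ?N (even_sets 5)"
    unfolding bij_betw_def by blast
  have AA: "symd ({..<5} - {i}) ({..<5} - {j}) = (if i = j then {} else {i, j})" if "i < 5" "j < 5" for i j :: nat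
    using that by (auto simp: symd_def)
  have AC: "card (symd ({..<5} - {i}) s) = 2 \<longleftrightarrow> i \<notin> s" "card (symd s ({..<5} - {i})) = 2 \<longleftrightarrow> i \<notin> s"
    if "i < 5" "s \<subseteq> {..<5}" "card s = 2" for i and s :: "nat set"
  proof -
    have fin: "finite s" using that by (auto intro: card_ge_0_finite)
    have "({..<5} - {i}) \<inter> s = s - {i}" using that by auto
    then have "card (symd ({..<5} - {i}) s) + 2 * card (s - {i}) = 4 + 2"
      using card_symd[of "{..<5} - {i}" s] fin card4[OF that(1)] that(3) by simp
    moreover have "card (s - {i}) = (if i \<in> s then 1 else 2)" using that by simp
    ultimately show "card (symd ({..<5} - {i}) s) = 2 \<longleftrightarrow> i \<notin> s" by auto
    then show "card (symd s ({..<5} - {i})) = 2 \<longleftrightarrow> i \<notin> s" by (simp add: symd_commute)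
  qed
  have CC: "card (symd s t) = 2 \<longleftrightarrow> s \<noteq> t \<and> s \<inter> t \<noteq> {}" if "card s = 2" "card t = 2" for s t :: "nat set"
    using card_symd[of s t] that card_ge_0_finite[of s] card_ge_0_finite[of t] card_pairs_meet[OF that] by auto
  have B: "symd {} s = s" "symd s {} = s" for s :: "nat set" by (auto simp: symd_def)
  have five: "5 \<notin> s" if "s \<subseteq> {..<5}" for s :: "nat set" using that by auto
  have "\<forall>p\<in>?N. \<forall>q\<in>?N. p \<noteq> q \<and> \<not> lines_meet p q \<longleftrightarrow> card (symd (h p) (h q)) = 2"
    unfolding ball using card4 five by (auto simp: h_def AA AC CC B)
  then show "graph_iso ?N schlafli_E (even_sets 5) (even_E 5)" unfolding graph_iso_def using bij hV
    by (intro exI[of _ h]) (auto simp: schlafli_E_def even_E_def nbrs_def)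
qed

lemma schlafli_simple: "simple_graph schlafli_V schlafli_E"
proof -
  have "lines_meet p q = lines_meet q p" for p q by (cases p; cases q) auto
  then show ?thesis by (auto simp: simple_graph_def schlafli_E_def)
qed

lemma schlafli_connected: "connected_graph schlafli_V schlafli_E"
proof (rule connected_by_descent[OF schlafli_simple, of "LA 0"
      "\<lambda>p. if p = LA 0 then 0 else if schlafli_E p (LA 0) then 1 else 2"])
  show "LA 0 \<in> schlafli_V" by (simp add: schlafli_V_iff)
  fix p assume p: "p \<in> schlafli_V" "p \<noteq> LA 0"
  have "schlafli_E p (LA 0) \<or> (\<exists>q. schlafli_E p q \<and> schlafli_E q (LA 0))"
  proof (cases p)
    case (LA i)
    then show ?thesis using p by (simp add: schlafli_E_def schlafli_V_iff)
  next
    case (LB i)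
    \<comment> \<open>Any two b-lines are skew, and b_0 is skew to a_0.\<close>
    then have "p = LB 0 \<or> schlafli_E p (LB 0)" "schlafli_E (LB 0) (LA 0)"
      using p by (auto simp: schlafli_E_def schlafli_V_iff)
    then show ?thesis by metis
  next
    case (LC s)
    show ?thesis
    proof (cases "0 \<in> s")
      case False
      then show ?thesis using LC p by (simp add: schlafli_E_def schlafli_V_iff)
    next
      case True
      have "card s = 2" using p LC by (simp add: schlafli_V_iff)
      then have "card (s - {0}) = 1" using True by simp
      then obtain e where e: "s - {0} = {e}" by (metis card_1_singletonE)
      \<comment> \<open>An index outside \<open>s\<close>, so that a_j is skew to c_s as well as to
        a_0.\<close>
      define j :: nat where "j = (if e = 1 then 2 else 1)"
      have "s = {0, e}" using e True by blast
      then have "j \<notin> s" "j \<noteq> 0" "j < 6" by (auto simp: j_def)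
      then have "schlafli_E p (LA j)" "schlafli_E (LA j) (LA 0)"
        using p LC by (auto simp: schlafli_E_def schlafli_V_iff)
      then show ?thesis by blast
    qed
  qed
  moreover have "\<not> schlafli_E (LA 0) (LA 0)" by (simp add: schlafli_E_def)
  ultimately show "\<exists>q. schlafli_E p q \<and> (if q = LA 0 then 0 else if schlafli_E q (LA 0) then 1 else 2)
      < (if p = LA 0 then 0 else if schlafli_E p (LA 0) then 1 else 2 :: nat)"
  proof (elim disjE exE conjE)
    assume "schlafli_E p (LA 0)"
    then show ?thesis using p(2) by (intro exI[of _ "LA 0"]) simp
  next
    fix q assume "schlafli_E p q" "schlafli_E q (LA 0)"
    then show ?thesis using p(2) \<open>\<not> schlafli_E (LA 0) (LA 0)\<close>
      by (cases "schlafli_E p (LA 0)") (auto intro: exI[of _ q] exI[of _ "LA 0"])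
  qed
qed

lemma schlafli_mirror_graph: "mirror_graph schlafli_V schlafli_E"
  using schlafli_simple schlafli_connected schlafli_has_mirrors by unfold_locales auto

section \<open>Neighbourhoods in the basic graphs\<close>

lemma connected_iso:
  assumes "graph_iso V E W F" "connected_graph V E"
  shows "connected_graph W F"
proof -
  obtain f where f: "bij_betw f V W" "\<forall>u\<in>V. \<forall>v\<in>V. E u v \<longleftrightarrow> F (f u) (f v)"
    using assms unfolding graph_iso_def by blast
  then have W: "W = f ` V" by (auto simp: bij_betw_def)
  have "(f u, f v) \<in> (adj_rel W F)\<^sup>*" if "(u, v) \<in> (adj_rel V E)\<^sup>*" for u v
    using that
  proof induction
    case (step v w)
    then have "(f v, f w) \<in> adj_rel W F" using f(2) by (auto simp: adj_rel_def W)
    then show ?case using step.IH by simp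
  qed simp
  then show ?thesis using assms(2) unfolding connected_graph_def W by auto
qed

lemma mirror_graph_iso:
  assumes "mirror_graph V E" "graph_iso V E W F" "\<And>u v. F u v \<Longrightarrow> u \<in> W \<and> v \<in> W"
  shows "mirror_graph W F"
proof -
  interpret mirror_graph V E by fact
  obtain f where f: "bij_betw f V W" "\<forall>u\<in>V. \<forall>v\<in>V. E u v \<longleftrightarrow> F (f u) (f v)"
    using assms unfolding graph_iso_def by blast
  then have W: "W = f ` V" by (auto simp: bij_betw_def)
  have "simple_graph W F" unfolding simple_graph_def
  proof (intro conjI allI impI)
    show "\<And>u v. F u v \<Longrightarrow> u \<in> W" "\<And>u v. F u v \<Longrightarrow> v \<in> W" using assms(3) by blast+
    show "F v u" if uv: "F u v" for u v
    proof -
      obtain a b where "u = f a" "v = f b" "a \<in> V" "b \<in> V" using assms(3)[OF uv] W by blast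
      then show ?thesis using f(2) uv adj_sym by blast
    qed
    show "\<not> F u u" for u
    proof
      assume "F u u"
      moreover from this obtain a where "u = f a" "a \<in> V" using assms(3) W by blast
      ultimately show False using f(2) adj_irrefl by blast
    qed
  qed
  then show ?thesis
    using connected_iso[OF assms(2) conn] has_mirrors_iso[OF assms(2) mirrors] by unfold_locales
qed

text \<open>All factors of a product share one vertex type, which
  \<open>basic_reflective_graph\<close> fixes to \<open>nat\<close>. \<open>F\<close> is confined to
  \<open>W\<close> so that the copy is again a simple graph.\<close>

lemma nat_copy:
  assumes "finite U"
  obtains W :: "nat set" and F where "graph_iso U D W F" "\<And>u v. F u v \<Longrightarrow> u \<in> W \<and> v \<in> W"
proof -
  obtain f where f: "bij_betw f U {0..<card U}" using ex_bij_betw_finite_nat[OF assms] by blast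
  define F where "F u v \<longleftrightarrow> u \<in> {0..<card U} \<and> v \<in> {0..<card U} \<and> D (inv_into U f u) (inv_into U f v)" for u v
  have "graph_iso U D {0..<card U} F"
    unfolding graph_iso_def F_def using f
    by (intro exI[of _ f]) (auto simp: bij_betw_inv_into_left dest: bij_betwE)
  then show thesis using that F_def by blast
qed

lemma nbrs_iso:
  assumes "graph_iso U D W F" "u \<in> U"
  obtains h where "h \<in> W" "graph_iso (nbrs U D u) D (nbrs W F h) F"
proof -
  obtain f where f: "bij_betw f U W" "\<forall>u\<in>U. \<forall>v\<in>U. D u v \<longleftrightarrow> F (f u) (f v)"
    using assms unfolding graph_iso_def by blast
  then have W: "W = f ` U" by (auto simp: bij_betw_def)
  have "bij_betw f (nbrs U D u) (nbrs W F (f u))"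
  proof (rule bij_betw_subset[OF f(1)])
    show "nbrs U D u \<subseteq> U" by (auto simp: nbrs_def)
    show "f ` nbrs U D u = nbrs W F (f u)" using f(2) assms(2) unfolding nbrs_def W by blast
  qed
  moreover have "\<forall>v\<in>nbrs U D u. \<forall>w\<in>nbrs U D u. D v w \<longleftrightarrow> F (f v) (f w)"
    using f(2) by (simp add: nbrs_def)
  ultimately have "graph_iso (nbrs U D u) D (nbrs W F (f u)) F" unfolding graph_iso_def by blast
  then show thesis using that assms(2) W by blast
qed

text \<open>Being basic is a statement up to \<open>graph_iso\<close> on \<open>W\<close>.
  \<open>mirror_graph W F\<close> adds that \<open>F\<close> is confined to \<open>W\<close> and
  that the graph is connected, which fails for members such as CP(1).\<close>

definition is_local :: "'a set \<Rightarrow> ('a \<Rightarrow> 'a \<Rightarrow> bool) \<Rightarrow> bool" where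
  "is_local C E \<longleftrightarrow> (\<exists>W F h. basic_reflective_graph W F \<and> mirror_graph W F \<and> h \<in> W \<and>
     graph_iso C E (nbrs W F h) F)"

lemma is_localI:
  assumes "finite U" "mirror_graph U D" "\<And>W F. graph_iso W F U D \<Longrightarrow> basic_reflective_graph W F"
    and "u \<in> U" "graph_iso C E (nbrs U D u) D"
  shows "is_local C E"
proof -
  obtain W F where WF: "graph_iso U D W F" "\<And>u v. F u v \<Longrightarrow> u \<in> W \<and> v \<in> (W :: nat set)"
    using nat_copy[OF assms(1)] by blast
  obtain h where h: "h \<in> W" "graph_iso (nbrs U D u) D (nbrs W F h) F" using nbrs_iso[OF WF(1) assms(4)] .
  show ?thesis unfolding is_local_def
    using assms(3)[OF graph_iso_sym[OF WF(1)]] mirror_graph_iso[OF assms(2) WF] h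
      graph_iso_trans[OF assms(5) h(2)] by blast
qed

lemma is_local_iso: "graph_iso C E C' E' \<Longrightarrow> is_local C' E' \<Longrightarrow> is_local C E"
  unfolding is_local_def using graph_iso_trans by blast

lemma is_local_rook:
  assumes "finite A" "finite B"
  shows "is_local (A \<times> B) rook_E"
proof (rule is_localI[OF johnson_finite(1) johnson_mirror_graph _ _ johnson_nbrs[OF assms]])
  show "{..<card A} \<in> johnson_V (card A + card B) (card A)" by (auto simp: johnson_V_def)
qed (auto simp: basic_reflective_graph_def)

text \<open>A complete graph is its product with a single vertex, and thus a neighbourhood in a
  Johnson graph.\<close>

lemma is_local_complete:
  assumes "finite V" "\<And>u v. u \<in> V \<Longrightarrow> v \<in> V \<Longrightarrow> E u v \<longleftrightarrow> u \<noteq> v"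
  shows "is_local V E"
proof (rule is_local_iso[OF _ is_local_rook[OF assms(1), of "{()}"]])
  show "graph_iso V E (V \<times> {()}) rook_E" unfolding graph_iso_def
    by (intro exI[of _ "\<lambda>v. (v, ())"]) (auto simp: bij_betw_def inj_on_def rook_E_def assms(2))
qed simp

lemma is_local_cp:
  assumes "k \<ge> 1"
  shows "is_local (cp_V k) (cp_E k)"
proof (rule is_localI[OF _ cp_mirror_graph _ _ cp_nbrs])
  show "0 \<in> cp_V (Suc k)" "finite (cp_V (Suc k))" by (auto simp: cp_V_def)
qed (use assms in \<open>auto simp: basic_reflective_graph_def\<close>)

lemma is_local_pairs: "is_local (johnson_V n 2) (johnson_E n 2)"
proof (rule is_localI[OF even_sets_finite(1) even_mirror_graph _ _ even_nbrs])
  show "{} \<in> even_sets n" by (simp add: even_sets_def)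
  show "basic_reflective_graph W F" if "graph_iso W F (even_sets n) (even_E n)" for W F
    using graph_iso_trans[OF that graph_iso_sym[OF halved_iso]] unfolding basic_reflective_graph_def by blast
qed

lemma is_local_even_5: "is_local (even_sets 5) (even_E 5)"
proof (rule is_localI[OF _ schlafli_mirror_graph _ _ even_5_nbrs_schlafli])
  show "LA 5 \<in> schlafli_V" by (simp add: schlafli_V_iff)
  have "schlafli_V \<subseteq> LA ` {..<6} \<union> LB ` {..<6} \<union> LC ` Pow {..<6}" by (auto simp: schlafli_V_def)
  then show "finite schlafli_V" by (rule finite_subset) simp
qed (auto simp: basic_reflective_graph_def)

lemma is_local_schlafli: "is_local schlafli_V schlafli_E"
proof (rule is_localI[OF gosset_finite(1) gosset_mirror_graph _ _ schlafli_nbrs_gosset])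
  show "(False, {6, 7}) \<in> gosset_V" by (simp add: gosset_V_iff)
qed (auto simp: basic_reflective_graph_def)

text \<open>Diameter at most two leaves \<open>k \<le> 2\<close> or \<open>n - k \<le> 2\<close>; up
  to complements these are complete graphs and graphs of pairs.\<close>

lemma is_local_johnson:
  assumes "diam2 (johnson_V n k) (johnson_E n k)" "k \<le> n"
  shows "is_local (johnson_V n k) (johnson_E n k)"
proof -
  have small: "is_local (johnson_V n k) (johnson_E n k)" if "k \<le> 2" for k
  proof (cases "k = 2")
    case False
    then consider "k = 0" | "k = 1" using \<open>k \<le> 2\<close> by linarith
    then have "johnson_E n k U W \<longleftrightarrow> U \<noteq> W"
      if UW: "U \<in> johnson_V n k" "W \<in> johnson_V n k" for U W
    proof cases
      case 1
      then have "U = {}" "W = {}" using UW johnson_finite(2)[OF UW(1)] johnson_finite(2)[OF UW(2)]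
        by (simp_all add: johnson_V_def)
      then show ?thesis using 1 by (simp add: johnson_E_def)
    next
      case 2
      then have "card U = 1" "card W = 1" using UW by (simp_all add: johnson_V_def)
      then obtain a b where "U = {a}" "W = {b}" by (metis card_1_singletonE)
      then show ?thesis using 2 UW by (auto simp: johnson_E_def)
    qed
    then show ?thesis by (intro is_local_complete[OF johnson_finite(1)])
  qed (use is_local_pairs in simp)
  have "k \<le> 2 \<or> n - k \<le> 2" using johnson_not_diam2[of k n] assms by linarith
  then show ?thesis using small is_local_iso[OF johnson_complement[OF assms(2)]] by blast
qed

text \<open>Diameter at most two leaves \<open>n \<le> 5\<close>: complete graphs, CP(4) and the
  halved 5-cube.\<close>

lemma is_local_even:
  assumes "diam2 (even_sets n) (even_E n)"
  shows "is_local (even_sets n) (even_E n)"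
proof -
  have "n < 6" using even_not_diam2[of n] assms by linarith
  then consider "n \<le> 3" | "n = 4" | "n = 5" by linarith
  then show ?thesis
  proof cases
    case 1
    then show ?thesis using is_local_complete[OF even_sets_finite(1)] even_complete by blast
  next
    case 2
    then show ?thesis using is_local_iso[OF even_4_iso is_local_cp] by simp
  qed (use is_local_even_5 in simp)
qed

lemma basic_cases:
  assumes "basic_reflective_graph W F"
  obtains k where "graph_iso W F (cp_V k) (cp_E k)" | n k where "graph_iso W F (johnson_V n k) (johnson_E n k)"
    | n where "graph_iso W F (even_sets n) (even_E n)"
    | "graph_iso W F schlafli_V schlafli_E" | "graph_iso W F gosset_V gosset_E"
  using assms graph_iso_trans[OF _ halved_iso] unfolding basic_reflective_graph_def by blast

text \<open>Only mirrors are claimed, because the families contain disconnected and empty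
  graphs.\<close>

lemma basic_has_mirrors:
  assumes "basic_reflective_graph W F"
  shows "has_mirrors W F"
  using assms
  by (cases rule: basic_cases)
    (meson graph_iso_sym has_mirrors_iso cp_has_mirrors johnson_has_mirrors even_has_mirrors
      schlafli_has_mirrors gosset_has_mirrors)+

lemma irrefl_iso:
  assumes "graph_iso W F U D" "simple_graph U D" "w \<in> W"
  shows "\<not> F w w"
  using assms unfolding graph_iso_def simple_graph_def by blast

lemma basic_irrefl:
  assumes "basic_reflective_graph W F" "w \<in> W"
  shows "\<not> F w w"
  using assms(1)
  by (cases rule: basic_cases)
    (meson irrefl_iso[OF _ _ assms(2)] cp_simple johnson_simple even_simple schlafli_simple gosset_simple)+

text \<open>\<open>W \<noteq> {}\<close> discards CP(0) and the Johnson graphs with more chosen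
  elements than points; the Gosset graph is discarded by its diameter.\<close>

lemma basic_is_local:
  assumes "basic_reflective_graph W F" "diam2 W F" "W \<noteq> {}"
  shows "is_local W F"
  using assms(1)
proof (cases rule: basic_cases)
  case (1 k)
  then have "cp_V k \<noteq> {}" using assms(3) by (auto simp: graph_iso_def bij_betw_def)
  then have "k \<ge> 1" by (cases k) (auto simp: cp_V_def)
  then show ?thesis using is_local_iso[OF 1 is_local_cp] by blast
next
  case (2 n k)
  then have "johnson_V n k \<noteq> {}" using assms(3) by (auto simp: graph_iso_def bij_betw_def)
  then have "k \<le> n" using card_mono[of "{..<n}"] by (fastforce simp: johnson_V_def)
  then show ?thesis using is_local_iso[OF 2 is_local_johnson[OF diam2_iso[OF 2 assms(2)]]] by blast
next
  case (3 n)
  show ?thesis using is_local_iso[OF 3 is_local_even[OF diam2_iso[OF 3 assms(2)]]] .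
next
  case 4
  then show ?thesis using is_local_iso is_local_schlafli by blast
next
  case 5
  then show ?thesis using diam2_iso[OF 5 assms(2)] gosset_not_diam2 by blast
qed

text \<open>A walk of length two in a product changes at most two coordinates.\<close>
lemma prod_diam2:
  assumes "diam2 (prod_V Gs) (prod_E Gs)" "xs \<in> prod_V Gs" "ys \<in> prod_V Gs"
    and ij: "i < length Gs" "j < length Gs" "i \<noteq> j" "xs ! i \<noteq> ys ! i" "xs ! j \<noteq> ys ! j"
  shows "snd (Gs ! i) (xs ! i) (ys ! i)" "k < length Gs \<Longrightarrow> k \<noteq> i \<Longrightarrow> k \<noteq> j \<Longrightarrow> xs ! k = ys ! k"
proof -
  have "\<not> prod_E Gs xs ys"
  proof
    assume "prod_E Gs xs ys"
    then obtain l where "\<And>k. k < length Gs \<Longrightarrow> k \<noteq> l \<Longrightarrow> ys ! k = xs ! k" by (rule prod_EE) blast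
    then show False using ij by metis
  qed
  moreover have "xs \<noteq> ys" using ij by blast
  ultimately obtain ws where ws: "prod_E Gs xs ws" "prod_E Gs ws ys"
    using diam2D[OF assms(1-3)] by blast
  from ws(1) obtain l where l: "snd (Gs ! l) (xs ! l) (ws ! l)"
    "\<And>k. k < length Gs \<Longrightarrow> k \<noteq> l \<Longrightarrow> ws ! k = xs ! k" by (rule prod_EE) blast
  from ws(2) obtain m where m: "snd (Gs ! m) (ws ! m) (ys ! m)"
    "\<And>k. k < length Gs \<Longrightarrow> k \<noteq> m \<Longrightarrow> ys ! k = ws ! k" by (rule prod_EE) blast
  \<comment> \<open>Two steps must repair two coordinates, so each is changed once, and the step in
    coordinate \<open>i\<close> leads directly from \<open>xs ! i\<close> to
    \<open>ys ! i\<close>.\<close>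
  have "l = i \<and> m = j \<or> l = j \<and> m = i" using l(2) m(2) ij by metis
  then show "snd (Gs ! i) (xs ! i) (ys ! i)" "k < length Gs \<Longrightarrow> k \<noteq> i \<Longrightarrow> k \<noteq> j \<Longrightarrow> xs ! k = ys ! k"
    using l m ij by metis+
qed

text \<open>Diameters add up in a product. So all factors but one are single vertices, and the
  remaining one is treated by \<open>basic_is_local\<close>; or exactly two factors have more than
  one vertex, these are complete, and their product is a rook graph.\<close>

lemma diam2_prod_is_local:
  assumes iso: "graph_iso C E (prod_V Gs) (prod_E Gs)" and "finite C" "C \<noteq> {}" "diam2 C E"
    and basic: "\<And>H. H \<in> set Gs \<Longrightarrow> basic_reflective_graph (fst H) (snd H)"
  shows "is_local C E"
proof (rule is_local_iso[OF iso])
  have diam: "diam2 (prod_V Gs) (prod_E Gs)" using diam2_iso iso assms by blast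
  obtain f where "bij_betw f C (prod_V Gs)" using iso by (auto simp: graph_iso_def)
  then have f: "prod_V Gs = f ` C" by (simp add: bij_betw_def)
  then have fin: "finite (prod_V Gs)" and "prod_V Gs \<noteq> {}" using assms by auto
  then obtain y where y: "y \<in> prod_V Gs" by blast
  let ?V = "\<lambda>i. fst (Gs ! i)" and ?E = "\<lambda>i. snd (Gs ! i)" and ?n = "length Gs"
  have basic': "basic_reflective_graph (?V i) (?E i)" if "i < ?n" for i using basic that by simp
  have yi: "y ! i \<in> ?V i" if "i < ?n" for i using y that by (simp add: prod_V_iff)
  have len: "length xs = ?n" if "xs \<in> prod_V Gs" for xs using that by (simp add: prod_V_iff)
  have mem: "xs ! i \<in> ?V i" if "xs \<in> prod_V Gs" "i < ?n" for xs i using that by (simp add: prod_V_iff)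
  have finV: "finite (?V i)" if "i < ?n" for i
  proof (rule finite_subset)
    show "?V i \<subseteq> (\<lambda>xs. xs ! i) ` prod_V Gs"
    proof
      fix a assume "a \<in> ?V i"
      then have "y[i := a] \<in> prod_V Gs" "y[i := a] ! i = a" using prod_V_update y that len by auto
      then show "a \<in> (\<lambda>xs. xs ! i) ` prod_V Gs" by (metis imageI)
    qed
  qed (use fin in simp)
  define triv where "triv i \<longleftrightarrow> ?V i = {y ! i}" for i
  have triv: "xs ! i = y ! i" if "triv i" "xs \<in> prod_V Gs" "i < ?n" for xs i
    using mem[OF that(2,3)] that(1) by (simp add: triv_def)
  have nontriv: "\<exists>a\<in>?V i. a \<noteq> y ! i" if "\<not> triv i" "i < ?n" for i
    using that yi[OF that(2)] unfolding triv_def by blast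
  consider "?n = 0" | i where "i < ?n" "\<And>j. j < ?n \<Longrightarrow> j \<noteq> i \<Longrightarrow> triv j"
    | i j where "i < ?n" "j < ?n" "i \<noteq> j" "\<not> triv i" "\<not> triv j" by (metis gr0I)
  then show "is_local (prod_V Gs) (prod_E Gs)"
  proof cases
    case 1
    then have "prod_V Gs = {[]}" by (auto simp: prod_V_def)
    moreover have "\<not> prod_E Gs [] []" using 1 by (simp add: prod_E_def)
    ultimately show ?thesis using is_local_complete[OF fin] by (metis singletonD)
  next
    case (2 i)
    have bij: "bij_betw (\<lambda>xs. xs ! i) (prod_V Gs) (?V i)"
    proof (rule bij_betw_byWitness[of _ "\<lambda>a. y[i := a]"])
      show "\<forall>xs\<in>prod_V Gs. y[i := xs ! i] = xs"
      proof
        fix xs assume xs: "xs \<in> prod_V Gs"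
        have "y[i := xs ! i] ! k = xs ! k" if "k < ?n" for k
          using triv[OF 2(2) xs, of k] that len[OF y] by (cases "k = i") auto
        then show "y[i := xs ! i] = xs" using len[OF xs] len[OF y] by (intro nth_equalityI) auto
      qed
      show "\<forall>a\<in>?V i. y[i := a] ! i = a" using 2(1) len[OF y] by simp
      show "(\<lambda>xs. xs ! i) ` prod_V Gs \<subseteq> ?V i" using mem 2(1) by blast
      show "(\<lambda>a. y[i := a]) ` ?V i \<subseteq> prod_V Gs" using prod_V_update[OF y 2(1)] by blast
    qed
    moreover have "prod_E Gs xs ys \<longleftrightarrow> ?E i (xs ! i) (ys ! i)" 
      if xy: "xs \<in> prod_V Gs" "ys \<in> prod_V Gs" for xs ys
    proof
      assume "prod_E Gs xs ys"
      then obtain k where k: "k < ?n" "?E k (xs ! k) (ys ! k)" by (rule prod_EE) blast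
      have "k = i"
      proof (rule ccontr)
        assume "k \<noteq> i"
        then have "?E k (y ! k) (y ! k)" using k triv[OF 2(2)] xy by metis
        then show False using basic_irrefl[OF basic' yi] k by blast
      qed
      then show "?E i (xs ! i) (ys ! i)" using k by simp
    next
      assume "?E i (xs ! i) (ys ! i)"
      moreover have "xs ! j = ys ! j" if "j < ?n" "j \<noteq> i" for j using triv[OF 2(2)] xy that by metis
      ultimately show "prod_E Gs xs ys" unfolding prod_E_def using xy 2(1) by blast
    qed
    ultimately have i: "graph_iso (prod_V Gs) (prod_E Gs) (?V i) (?E i)" unfolding graph_iso_def by blast
    show ?thesis using is_local_iso[OF i basic_is_local[OF basic'[OF 2(1)] diam2_iso[OF i diam]]]
      yi[OF 2(1)] by blast
  next
    case (3 i j)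
    \<comment> \<open>Two tuples with entries \<open>a\<close> and \<open>b\<close> at
      \<open>i\<close> are compared that differ at \<open>j\<close> as well; no step is left for a
      detour between \<open>a\<close> and \<open>b\<close>.\<close>
    have complete: "?E i a b" if ij: "i < ?n" "j < ?n" "i \<noteq> j" "\<not> triv j" and ab: "a \<in> ?V i" "b \<in> ?V i" "a \<noteq> b" 
      for i j a b
    proof -
      obtain c where c: "c \<in> ?V j" "c \<noteq> y ! j" using nontriv ij by blast
      show ?thesis
        using prod_diam2(1)[OF diam prod_V_update[OF y ij(1) ab(1)]
          prod_V_update[OF prod_V_update[OF y ij(1) ab(2)] ij(2) c(1)] ij(1-3)]
        ij ab c len[OF y] by simp
    qed
    \<comment> \<open>Three nontrivial coordinates would give tuples that differ in all three and
      are at least three steps apart.\<close>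
    have others: "triv k" if k: "k < ?n" "k \<noteq> i" "k \<noteq> j" for k
    proof (rule ccontr)
      assume "\<not> triv k"
      then obtain a b c where abc: "a \<in> ?V i" "a \<noteq> y ! i" "b \<in> ?V j" "b \<noteq> y ! j" "c \<in> ?V k" "c \<noteq> y ! k"
        using nontriv 3 k by metis
      have "y[i := a, j := b, k := c] \<in> prod_V Gs"
        using prod_V_update[OF prod_V_update[OF prod_V_update[OF y 3(1) abc(1)] 3(2) abc(3)] k(1) abc(5)] .
      from prod_diam2(2)[OF diam y this 3(1,2,3) _ _ k] show False
        using abc 3 k len[OF y] by simp
    qed
    define g where "g xs = (xs ! i, xs ! j)" for xs :: "nat list"
    have "bij_betw g (prod_V Gs) (?V i \<times> ?V j)"
    proof (rule bij_betw_byWitness[of _ "\<lambda>(a, b). y[i := a, j := b]"])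
      show "\<forall>xs\<in>prod_V Gs. (case g xs of (a, b) \<Rightarrow> y[i := a, j := b]) = xs"
      proof
        fix xs assume xs: "xs \<in> prod_V Gs"
        have "y[i := xs ! i, j := xs ! j] ! k = xs ! k" if "k < ?n" for k
          using triv[OF others xs, of k] that len[OF y] by (cases "k = i"; cases "k = j") auto
        then show "(case g xs of (a, b) \<Rightarrow> y[i := a, j := b]) = xs"
          using len[OF xs] len[OF y] by (auto intro: nth_equalityI simp: g_def)
      qed
      show "\<forall>p\<in>?V i \<times> ?V j. g (case p of (a, b) \<Rightarrow> y[i := a, j := b]) = p"
        using 3 len[OF y] by (auto simp: g_def)
      show "g ` prod_V Gs \<subseteq> ?V i \<times> ?V j" using mem 3 by (auto simp: g_def)
      show "(\<lambda>(a, b). y[i := a, j := b]) ` (?V i \<times> ?V j) \<subseteq> prod_V Gs"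
        using prod_V_update[OF prod_V_update[OF y 3(1)] 3(2)] by auto
    qed
    moreover have "prod_E Gs xs ys \<longleftrightarrow> rook_E (g xs) (g ys)"
      if xy: "xs \<in> prod_V Gs" "ys \<in> prod_V Gs" for xs ys
    proof
      assume "prod_E Gs xs ys"
      then obtain k where k: "k < ?n" "?E k (xs ! k) (ys ! k)"
        "\<And>l. l < ?n \<Longrightarrow> l \<noteq> k \<Longrightarrow> ys ! l = xs ! l" by (rule prod_EE) blast
      have ne: "xs ! k \<noteq> ys ! k" using k basic_irrefl[OF basic' mem] xy by metis
      then have "k = i \<or> k = j" using triv[OF others] xy k(1) by metis
      then show "rook_E (g xs) (g ys)" using ne k(3) 3 by (auto simp: rook_E_def g_def)
    next
      assume r: "rook_E (g xs) (g ys)"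
      have oth: "xs ! k = ys ! k" if "k < ?n" "k \<noteq> i" "k \<noteq> j" for k
        using triv[OF others] xy that by metis
      show "prod_E Gs xs ys"
      proof (cases "xs ! i = ys ! i")
        case True
        then have "xs ! j \<noteq> ys ! j" using r by (simp add: rook_E_def g_def)
        then have "?E j (xs ! j) (ys ! j)" using complete[of j i] 3 mem xy by metis
        then show ?thesis unfolding prod_E_def using xy oth True 3 by metis
      next
        case False
        then have "xs ! j = ys ! j" using r by (simp add: rook_E_def g_def)
        moreover have "?E i (xs ! i) (ys ! i)" using complete[of i j] 3 mem xy False by metis
        ultimately show ?thesis unfolding prod_E_def using xy oth 3 by metis
      qed
    qed
    ultimately have "graph_iso (prod_V Gs) (prod_E Gs) (?V i \<times> ?V j) rook_E"
      unfolding graph_iso_def by blast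
    then show ?thesis using is_local_iso is_local_rook finV 3 by blast
  qed
qed

text \<open>The induction is applied to the components of the neighbourhood of \<open>x\<close>,
  which are smaller since they omit \<open>x\<close>. If \<open>x\<close> has no neighbours, there
  are no factors, and the empty product is the one vertex \<open>[]\<close>.\<close>

lemma mirror_graph_is_product:
  assumes "mirror_graph V E" "finite V"
  shows "\<exists>Gs. (\<forall>H\<in>set Gs. basic_reflective_graph (fst H) (snd H)) \<and> graph_iso V E (prod_V Gs) (prod_E Gs)"
  using assms
proof (induction "card V" arbitrary: V E rule: less_induct)
  case less
  interpret mirror_graph V E by fact
  obtain x where x: "x \<in> V" using conn by (auto simp: connected_graph_def)
  define \<C> where "\<C> = local_comp x ` nbrs V E x"
  have "finite \<C>" using less.prems by (simp add: \<C>_def nbrs_def)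
  then obtain Cs where Cs: "set Cs = \<C>" "distinct Cs" using finite_distinct_list by blast
  have comp: "E x u \<and> C = local_comp x u" if Cu: "C \<in> \<C>" "u \<in> C" for C u
  proof -
    obtain w where w: "C = local_comp x w" "E x w" using Cu by (auto simp: \<C>_def nbrs_def)
    then have "E x u" using Cu by (simp add: local_comp_def)
    then show ?thesis using local_comp_eq[OF w(2), of u] local_comp(1)[of x u] Cu w by blast
  qed
  have local: "is_local C E" if C: "C \<in> \<C>" for C
  proof -
    obtain u where u: "C = local_comp x u" "E x u" using C by (auto simp: \<C>_def nbrs_def)
    note c = local_comp[OF u(2), folded u(1)]
    have "C \<subset> V" using c(2) x adj_irrefl by (auto simp: nbrs_def)
    then have "finite C" "card C < card V" using less.prems by (auto intro: finite_subset psubset_card_mono)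
    moreover from this obtain Gs where "\<forall>H\<in>set Gs. basic_reflective_graph (fst H) (snd H)"
      "graph_iso C (restr C E) (prod_V Gs) (prod_E Gs)" using less.hyps c(5) by blast
    ultimately have "is_local C (restr C E)" using diam2_prod_is_local c(1,4) by blast
    then show ?thesis using is_local_iso graph_iso_restr(2) graph_iso_refl by metis
  qed
  then have "\<forall>C. \<exists>W F h. C \<in> \<C> \<longrightarrow> basic_reflective_graph W F \<and> mirror_graph W F \<and> h \<in> W \<and>
     graph_iso C E (nbrs W F h) F" unfolding is_local_def by blast
  then obtain W F h where WFh: "\<And>C. C \<in> \<C> \<Longrightarrow> basic_reflective_graph (W C) (F C) \<and>
    mirror_graph (W C) (F C) \<and> h C \<in> W C \<and> graph_iso C E (nbrs (W C) (F C) (h C)) (F C)" by metis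
  define Gs where "Gs = map (\<lambda>C. (W C, F C)) Cs"
  have Gs: "basic_reflective_graph (fst H) (snd H)" "mirror_graph (fst H) (snd H)" if "H \<in> set Gs" for H
    using that WFh Cs by (auto simp: Gs_def)
  let ?ys = "map h Cs"
  have nth: "Cs ! i \<in> \<C>" if "i < length Cs" for i using that Cs by auto
  have ys: "?ys \<in> prod_V Gs" using WFh nth by (simp add: prod_V_iff Gs_def)
  have "graph_iso (nbrs V E x) E (nbrs (prod_V Gs) (prod_E Gs) ?ys) (prod_E Gs)"
  proof (rule prod_nbrs_iso[OF _ ys, of _ "\<lambda>i. Cs ! i"])
    show "simple_graph (fst H) (snd H)" if "H \<in> set Gs" for H
      using Gs(2)[OF that] by (simp add: mirror_graph_def conn_graph_def)
    have "nbrs V E x = \<Union>\<C>"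
      using local_comp(1,2) by (fastforce simp: \<C>_def nbrs_def)
    also have "\<dots> = (\<Union>i<length Gs. Cs ! i)" unfolding Cs(1)[symmetric] 
      by (auto simp: Gs_def set_conv_nth)
    finally show "nbrs V E x = (\<Union>i<length Gs. Cs ! i)" .
    show "graph_iso (Cs ! i) E (nbrs (fst (Gs ! i)) (snd (Gs ! i)) (?ys ! i)) (snd (Gs ! i))"
      if "i < length Gs" for i using that WFh nth by (simp add: Gs_def)
    fix i j u v assume ij: "i < length Gs" "j < length Gs" "u \<in> Cs ! i" "v \<in> Cs ! j" "i \<noteq> j"
    then have C: "Cs ! i \<in> \<C>" "Cs ! j \<in> \<C>" "Cs ! i \<noteq> Cs ! j"
      using nth Cs by (auto simp: Gs_def nth_eq_iff_index_eq)
    have uv: "E x u" "E x v" "Cs ! i = local_comp x u" "Cs ! j = local_comp x v"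
      using comp C ij by blast+
    have "v \<notin> Cs ! i" using comp[OF C(1), of v] uv C(3) by metis
    then show "u \<noteq> v \<and> \<not> E u v" using local_comp(3)[OF uv(1), of u v] uv ij(3) by metis
  qed
  then have "graph_iso V E (prod_V Gs) (prod_E Gs)"
    using local_iso_global[OF less.prems(1) prod_mirror_graph[OF Gs(2)] x ys] by blast
  then show ?case using Gs(1) by blast
qed

theorem theorem4p3:
  fixes V :: "'a set" and E :: "'a \<Rightarrow> 'a \<Rightarrow> bool"
  assumes "finite V" and "simple_graph V E" and "connected_graph V E"
  shows "reflective V E \<longleftrightarrow>
    (\<exists>Gs :: (nat set \<times> (nat \<Rightarrow> nat \<Rightarrow> bool)) list.
        (\<forall>H\<in>set Gs. basic_reflective_graph (fst H) (snd H)) \<and>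
        graph_iso V E (prod_V Gs) (prod_E Gs))"
proof
  assume "reflective V E"
  then have "mirror_graph V E" using reflective_has_mirrors assms by unfold_locales auto
  then show "\<exists>Gs :: (nat set \<times> (nat \<Rightarrow> nat \<Rightarrow> bool)) list.
      (\<forall>H\<in>set Gs. basic_reflective_graph (fst H) (snd H)) \<and> graph_iso V E (prod_V Gs) (prod_E Gs)"
    using mirror_graph_is_product assms(1) by blast
next
  assume "\<exists>Gs :: (nat set \<times> (nat \<Rightarrow> nat \<Rightarrow> bool)) list.
      (\<forall>H\<in>set Gs. basic_reflective_graph (fst H) (snd H)) \<and> graph_iso V E (prod_V Gs) (prod_E Gs)"
  \<comment> \<open>Only mirrors need to be carried over from the product: that \<open>V\<close> is
    simple and connected is assumed.\<close>
  then have "has_mirrors V E"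
    using has_mirrors_iso graph_iso_sym prod_has_mirrors basic_has_mirrors by metis
  then interpret mirror_graph V E using assms by unfold_locales
  show "reflective V E" by (rule reflective)
qed

end
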